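(* Let either $I=\{-1,0,1,2,\dots\}$ (infinite case) or $I=\{-1,0,\dots,N\}$ for some $N\ge 0$ (finite case). Suppose we are given elements $\omega_i\in\mathcal{D}_1(\mathbb{R})$ $(i\in I)$ and prescribed values $v(\omega_i)$ such that: (a) $\omega_{-1}=x$, $\omega_0=y$, $v(\omega_{-1})=-1$; (b) for every $i\ge 0$ in $I$ (in the finite case: for every $0\le i\le N-1$), $v(\omega_i)=\frac{m_{i+1}}{n_{i+1}}\in\mathbb{Q}$ in lowest terms with $n_{i+1}>0$, and $\omega_{i+1}=x^{m_{i+1}}\omega_i^{n_{i+1}}-\beta_{i+1}$ with $\beta_{i+1}\in\mathbb{R}\setminus\{0\}$, where the residue is prescribed to be $\overline{x^{m_{i+1}}\omega_i^{n_{i+1}}}=\beta_{i+1}$, i.e. the prescribed values satisfy $v(\omega_{i+1})>0$; (c) in the finite case, $v(\omega_N)\notin\mathbb{Q}$; (d) $\sum_{i=-1}^k v(\omega_i)<0$ for all $k\ge -1$ in $I$; (e) $\operatorname{sgn}(\beta_i)$ is constant on the set of all $i$ for which $n_i$ is even. Then $v$ can be extended to a valuation on $\mathcal{D}_1(\mathbb{R})$ with residue field $\mathbb{R}$. For every choice of the family $\{\alpha_{i,j}\}_{i,j\ge 0}$, the extension $v$ for which $$\alpha_{i,j}=\overline{\omega_{i-1}^{\,m_jn_i/d_{i,j}}\;\omega_{j-1}^{\,-m_in_j/d_{i,j}}},\qquad d_{i,j}=\gcd\{m_jn_i,\,m_in_j\},$$ is unique. The associated value group is group-isomorphic to a subgroup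 of $\mathbb{Q}\times\mathbb{Z}$, generated by $\{v(\omega_i)\}_{i\in I}$.
   Context: A valuation on a division ring $D$ is a map $v:D\to\Gamma\cup\{\infty\}$, with $\Gamma$ an additively written totally ordered group and $\infty>\gamma$ for all $\gamma\in\Gamma$, such that $v(a)=\infty\iff a=0$, $v(ab)=v(a)+v(b)$ and $v(a+b)\ge\min\{v(a),v(b)\}$. Its valuation ring is $\mathcal{O}_v=\{a: v(a)\ge 0\}$, with maximal ideal $\mathcal{M}_v=\{a: v(a)>0\}$; $\overline{a}$ denotes the image of $a\in\mathcal{O}_v$ in $\mathcal{O}_v/\mathcal{M}_v$. Valuations are trivial on $\mathbb{R}$, and "residue field $\mathbb{R}$" means that the natural map $\mathbb{R}\to\mathcal{O}_v/\mathcal{M}_v$ is an isomorphism. The real Weyl algebra $\mathcal{A}_1(\mathbb{R})$ is the $\mathbb{R}$-algebra generated by $x,y$ subject to $yx-xy=1$. It is an Ore domain with quotient division ring $\mathcal{D}_1(\mathbb{R})$. The prescribed values lie in a totally ordered abelian group containing $\mathbb{Q}$ (as an ordered subgroup) and $v(\omega_N)$. "$v(\omega_N)\notin\mathbb{Q}$" means that $v(\omega_N)$ and $v(x)=-1$ are rationally independent. We put $m_0=1$, $n_0=-1$, so that $v(\omega_{i-1})=m_i/n_i$ for all $i\ge 0$ for which $v(\omega_{i-1})\in\mathbb{Q}$; the indices $i,j$ of $\alpha_{i,j}$ run over such indices, $i\ne j$ (with $\alpha_{i,i}=1$). *)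

theory Defs
  imports
    Complex_Main
    "HOL-Algebra.QuotRing"
    "HOL-Algebra.Generated_Groups"
    "HOL-Computational_Algebra.Polynomial"
    "HOL-Library.Product_Plus"
begin

section \<open>The real Weyl algebra\<close>

text \<open>
  The \<open>\<real>\<close>-algebra with generators \<open>x\<close>, \<open>y\<close> and the relation \<open>y x - x y = 1\<close>: algebra terms
  over \<open>x\<close>, \<open>y\<close> modulo the least congruence that contains the laws of unital associative
  \<open>\<real>\<close>-algebras (scalars \<open>r\<close> are represented by \<open>Scal r\<close>, standing for \<open>r \<cdot> 1\<close>) and the relation.
\<close>

datatype weyl_term =
  Scal real | GenX | GenY | Plus weyl_term weyl_term | Times weyl_term weyl_term

inductive weyl_eq :: "weyl_term \<Rightarrow> weyl_term \<Rightarrow> bool" where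
  weyl_refl: "weyl_eq a a"
| weyl_sym: "weyl_eq a b \<Longrightarrow> weyl_eq b a"
| weyl_trans: "weyl_eq a b \<Longrightarrow> weyl_eq b c \<Longrightarrow> weyl_eq a c"
| weyl_cong_plus: "weyl_eq a a' \<Longrightarrow> weyl_eq b b' \<Longrightarrow> weyl_eq (Plus a b) (Plus a' b')"
| weyl_cong_times: "weyl_eq a a' \<Longrightarrow> weyl_eq b b' \<Longrightarrow> weyl_eq (Times a b) (Times a' b')"
| weyl_add_assoc: "weyl_eq (Plus (Plus a b) c) (Plus a (Plus b c))"
| weyl_add_commute: "weyl_eq (Plus a b) (Plus b a)"
| weyl_add_zero: "weyl_eq (Plus (Scal 0) a) a"
| weyl_add_neg: "weyl_eq (Plus (Times (Scal (-1)) a) a) (Scal 0)"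
| weyl_mult_assoc: "weyl_eq (Times (Times a b) c) (Times a (Times b c))"
| weyl_mult_one: "weyl_eq (Times (Scal 1) a) a"
| weyl_distrib_right: "weyl_eq (Times (Plus a b) c) (Plus (Times a c) (Times b c))"
| weyl_distrib_left: "weyl_eq (Times a (Plus b c)) (Plus (Times a b) (Times a c))"
| weyl_scal_add: "weyl_eq (Plus (Scal r) (Scal s)) (Scal (r + s))"
| weyl_scal_mult: "weyl_eq (Times (Scal r) (Scal s)) (Scal (r * s))"
| weyl_scal_central: "weyl_eq (Times a (Scal r)) (Times (Scal r) a)"
| weyl_relation: "weyl_eq (Plus (Times GenY GenX) (Times (Scal (-1)) (Times GenX GenY))) (Scal 1)"

lemma equivp_weyl_eq: "equivp weyl_eq"
  by (rule equivpI)
    (auto simp: reflp_def symp_def transp_def intro: weyl_refl weyl_sym weyl_trans)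

text \<open>
  The representation on \<open>\<real>[t]\<close> with \<open>x\<close> acting as multiplication by \<open>t\<close> and \<open>y\<close> as \<open>d/dt\<close>;
  it shows that the presented algebra is not the zero ring.
\<close>

primrec weyl_act :: "weyl_term \<Rightarrow> real poly \<Rightarrow> real poly" where
  "weyl_act (Scal r) p = smult r p"
| "weyl_act GenX p = pCons 0 p"
| "weyl_act GenY p = pderiv p"
| "weyl_act (Plus a b) p = weyl_act a p + weyl_act b p"
| "weyl_act (Times a b) p = weyl_act a (weyl_act b p)"

lemma weyl_act_add: "weyl_act a (p + q) = weyl_act a p + weyl_act a q"
  by (induction a arbitrary: p q) (auto simp: smult_add_right pderiv_add)

lemma weyl_act_smult: "weyl_act a (smult r p) = smult r (weyl_act a p)"
  by (induction a arbitrary: p) (auto simp: smult_add_right pderiv_smult mult.commute)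

lemma weyl_eq_act: "weyl_eq a b \<Longrightarrow> weyl_act a = weyl_act b"
  by (induction rule: weyl_eq.induct)
    (auto simp: fun_eq_iff algebra_simps weyl_act_add weyl_act_smult smult_add_left pderiv_pCons)

quotient_type weyl = weyl_term / weyl_eq
  by (rule equivp_weyl_eq)

lift_definition weyl_x :: weyl is GenX .

lift_definition weyl_y :: weyl is GenY .

instantiation weyl :: real_algebra_1
begin

lift_definition zero_weyl :: weyl is "Scal 0" .

lift_definition one_weyl :: weyl is "Scal 1" .

lift_definition plus_weyl :: "weyl \<Rightarrow> weyl \<Rightarrow> weyl" is Plus
  by (rule weyl_cong_plus)

lift_definition times_weyl :: "weyl \<Rightarrow> weyl \<Rightarrow> weyl" is Times
  by (rule weyl_cong_times)

lift_definition uminus_weyl :: "weyl \<Rightarrow> weyl" is "Times (Scal (-1))"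
  by (intro weyl_cong_times weyl_refl)

lift_definition minus_weyl :: "weyl \<Rightarrow> weyl \<Rightarrow> weyl" is "\<lambda>a b. Plus a (Times (Scal (-1)) b)"
  by (intro weyl_cong_times weyl_cong_plus weyl_refl)

lift_definition scaleR_weyl :: "real \<Rightarrow> weyl \<Rightarrow> weyl" is "\<lambda>r. Times (Scal r)"
  by (intro weyl_cong_times weyl_refl)

instance
proof
  fix a b c :: weyl and r s :: real
  show "a + b + c = a + (b + c)" by transfer (rule weyl_add_assoc)
  show "a + b = b + a" by transfer (rule weyl_add_commute)
  show "0 + a = a" by transfer (rule weyl_add_zero)
  show "- a + a = 0" by transfer (rule weyl_add_neg)
  show "a - b = a + - b" by transfer (rule weyl_refl)
  show "a * b * c = a * (b * c)" by transfer (rule weyl_mult_assoc)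
  show "1 * a = a" by transfer (rule weyl_mult_one)
  show "a * 1 = a" by transfer (rule weyl_trans[OF weyl_scal_central weyl_mult_one])
  show "(a + b) * c = a * c + b * c" by transfer (rule weyl_distrib_right)
  show "a * (b + c) = a * b + a * c" by transfer (rule weyl_distrib_left)
  show "(0::weyl) \<noteq> 1"
    by transfer (auto dest!: weyl_eq_act fun_cong[of _ _ 1])
  show "r *\<^sub>R (a + b) = r *\<^sub>R a + r *\<^sub>R b" by transfer (rule weyl_distrib_left)
  show "(r + s) *\<^sub>R a = r *\<^sub>R a + s *\<^sub>R a"
    by transfer
      (rule weyl_trans[OF weyl_cong_times[OF weyl_sym[OF weyl_scal_add] weyl_refl] weyl_distrib_right])
  show "r *\<^sub>R s *\<^sub>R a = (r * s) *\<^sub>R a"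
    by transfer
      (rule weyl_trans[OF weyl_sym[OF weyl_mult_assoc] weyl_cong_times[OF weyl_scal_mult weyl_refl]])
  show "1 *\<^sub>R a = a" by transfer (rule weyl_mult_one)
  show "r *\<^sub>R a * b = r *\<^sub>R (a * b)" by transfer (rule weyl_mult_assoc)
  show "a * r *\<^sub>R b = r *\<^sub>R (a * b)"
    by transfer
      (rule weyl_trans[OF weyl_sym[OF weyl_mult_assoc]
          weyl_trans[OF weyl_cong_times[OF weyl_scal_central weyl_refl] weyl_mult_assoc]])
qed

end

lemma weyl_commutation: "weyl_y * weyl_x - weyl_x * weyl_y = 1"
  by transfer (rule weyl_relation)

text \<open>
  \<open>\<iota>\<close> exhibits the division algebra \<open>'d\<close> as a quotient division ring of the algebra \<open>'a\<close>: it is an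
  embedding of \<open>\<real>\<close>-algebras and every element of \<open>'d\<close> is a fraction. For an Ore domain \<open>'a\<close> this
  determines \<open>'d\<close> up to a unique isomorphism over \<open>'a\<close>.
\<close>

definition quotient_division_ring :: "('a::real_algebra_1 \<Rightarrow> 'd::real_div_algebra) \<Rightarrow> bool" where
  "quotient_division_ring \<iota> \<longleftrightarrow>
     (\<forall>a b. \<iota> (a + b) = \<iota> a + \<iota> b) \<and> (\<forall>a b. \<iota> (a * b) = \<iota> a * \<iota> b) \<and> \<iota> 1 = 1 \<and>
     (\<forall>r a. \<iota> (r *\<^sub>R a) = r *\<^sub>R \<iota> a) \<and> inj \<iota> \<and>
     (\<forall>z. \<exists>a s. s \<noteq> 0 \<and> z = \<iota> a * inverse (\<iota> s))"


section \<open>Totally ordered groups\<close>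

text \<open>Written additively, but not assumed commutative.\<close>

class linordered_group_add = group_add + linorder +
  assumes translate_left_mono: "a \<le> b \<Longrightarrow> c + a \<le> c + b"
    and translate_right_mono: "a \<le> b \<Longrightarrow> a + c \<le> b + c"

instance linordered_ab_group_add \<subseteq> linordered_group_add
  by standard (auto intro: add_left_mono add_right_mono)

definition ordered_group_embedding ::
    "('g::linordered_group_add \<Rightarrow> 'h::linordered_group_add) \<Rightarrow> bool" where
  "ordered_group_embedding f \<longleftrightarrow> (\<forall>a b. f (a + b) = f a + f b) \<and> strict_mono f"

datatype 'g with_infinity = Fin 'g | Infinity

instantiation with_infinity :: (linorder) linorder
begin

fun less_eq_with_infinity :: "'a with_infinity \<Rightarrow> 'a with_infinity \<Rightarrow> bool" where
  "Fin a \<le> Fin b \<longleftrightarrow> a \<le> b"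
| "_ \<le> Infinity \<longleftrightarrow> True"
| "Infinity \<le> Fin _ \<longleftrightarrow> False"

definition less_with_infinity :: "'a with_infinity \<Rightarrow> 'a with_infinity \<Rightarrow> bool" where
  "a < b \<longleftrightarrow> a \<le> b \<and> \<not> b \<le> (a :: 'a with_infinity)"

instance
proof
  fix a b c :: "'a with_infinity"
  show "a < b \<longleftrightarrow> a \<le> b \<and> \<not> b \<le> a" by (rule less_with_infinity_def)
  show "a \<le> a" by (cases a) auto
  show "a \<le> b \<Longrightarrow> b \<le> c \<Longrightarrow> a \<le> c" by (cases a; cases b; cases c) auto
  show "a \<le> b \<Longrightarrow> b \<le> a \<Longrightarrow> a = b" by (cases a; cases b) auto
  show "a \<le> b \<or> b \<le> a" by (cases a; cases b) auto
qed

end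

instantiation with_infinity :: (monoid_add) monoid_add
begin

definition zero_with_infinity :: "'a with_infinity" where
  "0 = Fin 0"

fun plus_with_infinity :: "'a with_infinity \<Rightarrow> 'a with_infinity \<Rightarrow> 'a with_infinity" where
  "Fin a + Fin b = Fin (a + b)"
| "Infinity + _ = Infinity"
| "Fin _ + Infinity = Infinity"

instance
proof
  fix a b c :: "'a with_infinity"
  show "a + b + c = a + (b + c)" by (cases a; cases b; cases c) (auto simp: add.assoc)
  show "0 + a = a" "a + 0 = a" by (cases a; simp add: zero_with_infinity_def)+
qed

end


section \<open>Valuations\<close>

definition valuation :: "('d::division_ring \<Rightarrow> 'g::linordered_group_add with_infinity) \<Rightarrow> bool" where
  "valuation v \<longleftrightarrow>
     (\<forall>a. v a = Infinity \<longleftrightarrow> a = 0) \<and>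
     (\<forall>a b. v (a * b) = v a + v b) \<and>
     (\<forall>a b. v (a + b) \<ge> min (v a) (v b))"

definition trivial_on_reals ::
    "('d::real_div_algebra \<Rightarrow> 'g::linordered_group_add with_infinity) \<Rightarrow> bool" where
  "trivial_on_reals v \<longleftrightarrow> (\<forall>r. r \<noteq> 0 \<longrightarrow> v (of_real r) = 0)"

definition ring_of :: "'a::ring_1 set \<Rightarrow> 'a ring" where
  "ring_of A = \<lparr>carrier = A, monoid.mult = (*), one = 1, zero = 0, add = (+)\<rparr>"

definition valuation_ring ::
    "('d::division_ring \<Rightarrow> 'g::linordered_group_add with_infinity) \<Rightarrow> 'd ring" where
  "valuation_ring v = ring_of {a. v a \<ge> 0}"

definition maximal_ideal_of ::
    "('d::division_ring \<Rightarrow> 'g::linordered_group_add with_infinity) \<Rightarrow> 'd set" where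
  "maximal_ideal_of v = {a. v a > 0}"

definition residue_field ::
    "('d::division_ring \<Rightarrow> 'g::linordered_group_add with_infinity) \<Rightarrow> 'd set ring" where
  "residue_field v = valuation_ring v Quot maximal_ideal_of v"

definition residue ::
    "('d::division_ring \<Rightarrow> 'g::linordered_group_add with_infinity) \<Rightarrow> 'd \<Rightarrow> 'd set" where
  "residue v a = maximal_ideal_of v +>\<^bsub>valuation_ring v\<^esub> a"

definition residue_field_is_real ::
    "('d::real_div_algebra \<Rightarrow> 'g::linordered_group_add with_infinity) \<Rightarrow> bool" where
  "residue_field_is_real v \<longleftrightarrow>
     (\<lambda>r. residue v (of_real r)) \<in> ring_iso (ring_of (UNIV :: real set)) (residue_field v)"

definition add_group :: "'a::group_add set \<Rightarrow> 'a monoid" where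
  "add_group A = \<lparr>carrier = A, monoid.mult = (+), one = 0\<rparr>"

definition value_group ::
    "('d::division_ring \<Rightarrow> 'g::linordered_group_add with_infinity) \<Rightarrow> 'g monoid" where
  "value_group v = add_group {g. \<exists>a. v a = Fin g}"

text \<open>
  \<open>v\<close> is a valuation, trivial on \<open>\<real>\<close> and with residue field \<open>\<real>\<close>, that takes the prescribed value
  \<open>\<nu> i\<close> at \<open>\<omega> i\<close>. The group \<open>'h\<close> in which \<open>v\<close> takes its values may be larger than the group \<open>'g\<close>
  of the prescribed values, which is regarded as a subgroup of \<open>'h\<close> by means of \<open>e\<close>.
\<close>

definition extends_to_valuation ::
    "('g::linordered_group_add \<Rightarrow> 'h::linordered_group_add) \<Rightarrow> int set \<Rightarrow> (int \<Rightarrow> 'd) \<Rightarrow> (int \<Rightarrow> 'g)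
      \<Rightarrow> ('d::real_div_algebra \<Rightarrow> 'h with_infinity) \<Rightarrow> bool" where
  "extends_to_valuation e I \<omega> \<nu> v \<longleftrightarrow>
     valuation v \<and> trivial_on_reals v \<and> residue_field_is_real v \<and>
     (\<forall>i\<in>I. v (\<omega> i) = Fin (e (\<nu> i)))"

text \<open>
  The residues \<open>\<alpha> i j\<close>, for distinct \<open>i, j \<ge> 0\<close> such that \<open>v(\<omega>\<^sub>i\<^sub>-\<^sub>1)\<close> and \<open>v(\<omega>\<^sub>j\<^sub>-\<^sub>1)\<close> are rational
  (\<open>q\<close> is the embedding of \<open>\<rat>\<close>). A real number stands for its class in the residue field. The
  divisions are exact, and \<open>d \<noteq> 0\<close> as long as at most one of the \<open>m i\<close> vanishes; when \<open>m 0 = 1\<close>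
  and \<open>v(\<omega>\<^sub>i) > 0\<close> for \<open>i > 0\<close>, only \<open>m 1\<close> can.
\<close>

definition has_residues ::
    "(rat \<Rightarrow> 'g) \<Rightarrow> int set \<Rightarrow> (int \<Rightarrow> 'd) \<Rightarrow> (int \<Rightarrow> 'g) \<Rightarrow> (int \<Rightarrow> int) \<Rightarrow> (int \<Rightarrow> int)
      \<Rightarrow> (int \<Rightarrow> int \<Rightarrow> real) \<Rightarrow> ('d::real_div_algebra \<Rightarrow> 'h::linordered_group_add with_infinity)
      \<Rightarrow> bool" where
  "has_residues q I \<omega> \<nu> m n \<alpha> v \<longleftrightarrow>
     (\<forall>i j. 0 \<le> i \<and> i - 1 \<in> I \<and> \<nu> (i - 1) \<in> range q \<and>
            0 \<le> j \<and> j - 1 \<in> I \<and> \<nu> (j - 1) \<in> range q \<and> i \<noteq> j \<longrightarrow>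
        (let d = gcd (m j * n i) (m i * n j) in
           residue v (of_real (\<alpha> i j)) =
           residue v (\<omega> (i - 1) powi ((m j * n i) div d) * \<omega> (j - 1) powi (- ((m i * n j) div d)))))"


section \<open>Irrational values\<close>

text \<open>
  In a totally ordered abelian group containing \<open>\<rat>\<close>, an element lies outside \<open>\<rat>\<close> if and only if
  it is rationally independent of \<open>-1\<close>.
\<close>

definition int_multiple :: "int \<Rightarrow> 'g::ab_group_add \<Rightarrow> 'g" where
  "int_multiple k g = (if k \<ge> 0 then (\<Sum>i<nat k. g) else - (\<Sum>i<nat (- k). g))"

lemma int_multiple_nonneg: "k \<ge> 0 \<Longrightarrow> int_multiple k g = (\<Sum>i<nat k. g)"
  by (simp add: int_multiple_def)

lemma int_multiple_minus: "int_multiple (- k) g = - int_multiple k g"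
  by (cases "k = 0") (auto simp: int_multiple_def)

lemma not_rational_iff_rationally_independent:
  fixes q :: "rat \<Rightarrow> 'g::linordered_ab_group_add"
  assumes "ordered_group_embedding q"
  shows "g \<notin> range q \<longleftrightarrow>
    (\<forall>a b. int_multiple a g + int_multiple b (q (- 1)) = 0 \<longrightarrow> a = 0 \<and> b = 0)"
proof -
  have q_add: "q (r + s) = q r + q s" for r s
    using assms by (simp add: ordered_group_embedding_def)
  have q_zero: "q 0 = 0"
    using q_add[of 0 0] by simp
  have q_minus: "q (- r) = - q r" for r
    using q_add[of r "- r"] q_zero by (metis add.right_inverse add_left_cancel)
  have q_inj: "inj q"
    using assms by (simp add: ordered_group_embedding_def strict_mono_imp_inj_on)
  have q_sum: "(\<Sum>i<k. q r) = q (of_nat k * r)" for k :: nat and r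
    by (induction k) (auto simp: q_zero algebra_simps q_add)
  have q_mult: "int_multiple k (q r) = q (of_int k * r)" for k r
    by (auto simp: int_multiple_def q_sum simp flip: q_minus)
  have sum_add: "(\<Sum>i<k. a + b) = (\<Sum>i<k. a) + (\<Sum>i<k. (b::'g))" for k :: nat and a b
    by (rule sum.distrib)
  have mult_add: "int_multiple k (a + b) = int_multiple k a + int_multiple k (b::'g)" for k a b
    by (auto simp: int_multiple_def sum_add)
  have pos: "0 < (\<Sum>i<k. a)" if "k > 0" "0 < (a::'g)" for k :: nat and a
    using that by (intro sum_pos) auto
  have torsion_free: "a = 0" if k: "k \<noteq> 0" and eq: "int_multiple k a = 0" for k and a :: 'g
  proof (rule ccontr)
    assume "a \<noteq> 0"
    have z: "(\<Sum>i<nat \<bar>k\<bar>. a) = 0"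
      using eq by (auto simp: int_multiple_def split: if_splits)
    then have "(\<Sum>i<nat \<bar>k\<bar>. - a) = 0"
      by (simp add: sum_negf)
    with z pos[of "nat \<bar>k\<bar>" a] pos[of "nat \<bar>k\<bar>" "- a"] k \<open>a \<noteq> 0\<close> show False
      by (cases a "0 :: 'g" rule: linorder_cases) auto
  qed
  show ?thesis
  proof
    assume g: "g \<notin> range q"
    show "\<forall>a b. int_multiple a g + int_multiple b (q (- 1)) = 0 \<longrightarrow> a = 0 \<and> b = 0"
    proof (intro allI impI)
      fix a b :: int
      assume eq: "int_multiple a g + int_multiple b (q (- 1)) = 0"
      then have eq': "int_multiple a g + q (- of_int b) = 0"
        by (simp add: q_mult)
      have a: "a = 0"
      proof (rule ccontr)
        assume a: "a \<noteq> 0"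
        have "int_multiple a (g + q (- (of_int b / of_int a))) = 0"
          using eq' a by (simp add: mult_add q_mult)
        then have "g + q (- (of_int b / of_int a)) = 0"
          by (rule torsion_free[OF a])
        then have "g = q (of_int b / of_int a)"
          by (simp add: q_minus)
        with g show False by blast
      qed
      with eq' have "q (- of_int b) = q 0"
        by (simp add: int_multiple_def q_zero)
      with a show "a = 0 \<and> b = 0"
        using q_inj by (auto dest: injD)
    qed
  next
    assume indep: "\<forall>a b. int_multiple a g + int_multiple b (q (- 1)) = 0 \<longrightarrow> a = 0 \<and> b = 0"
    show "g \<notin> range q"
    proof
      assume "g \<in> range q"
      then obtain r where r: "g = q r" by blast
      obtain a b where ab: "quotient_of r = (a, b)" by fastforce
      then have "b > 0" and r': "r = of_int a / of_int b"
        by (auto simp: quotient_of_denom_pos quotient_of_div)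
      then have "int_multiple b g + int_multiple a (q (- 1)) = 0"
        by (simp add: r q_mult q_zero flip: q_add)
      with indep \<open>b > 0\<close> show False by fastforce
    qed
  qed
qed

end

theory Submission
  imports Defs "HOL-Computational_Algebra.Primes"
begin

text \<open>
  Put \<open>E = x y\<close>, so that \<open>E x\<^sup>t = x\<^sup>t (E + t)\<close>. The division ring is the ring of fractions of the ring of sums
  \<open>\<Sum> x\<^sup>s f\<^sub>s(E)\<close>, and giving the monomials \<open>x\<^sup>s E\<^sup>j\<close> additive values yields a valuation of that ring as soon
  as \<open>v(x) < 0\<close> and \<open>v(E) < 0\<close>; condition (d) says that this is so at every level.
  The first approximation of \<open>v\<close> is the monomial valuation with the values of \<open>x\<close> and \<open>\<omega>\<^sub>0\<close>. When \<open>v(\<omega>\<^sub>k)\<close> is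
  rational, the ring is re-embedded into itself by \<open>x \<mapsto> \<plusminus> x\<^sup>e\<close>, \<open>E \<mapsto> E/e + c x\<^sup>h + \<dots>\<close>, a Newton--Puiseux step that
  removes the leading terms of \<open>\<omega>\<^sub>k\<^sub>+\<^sub>1\<close>; the next approximation is a monomial valuation in the new coordinates,
  and condition (e) makes the required real roots exist.

  The approximations increase and become stationary on every nonzero element. If there are infinitely many of them,
  this is because the commutator with \<open>x\<close> lowers the degree in \<open>E\<close> by one: an element that never
  became stationary would force the values of all \<open>\<omega>\<^sub>k\<close> to have bounded denominators, and then the
  increasing sums in (d) could not stay bounded.

  For uniqueness, every extension dominates the first approximation. If it dominates the \<open>k\<close>-th one and
  the residue of the unit \<open>T = W \<omega>\<^sub>k\<^sup>e\<close> is the one chosen in the \<open>k\<close>-th step, it dominates the next, since a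
  polynomial in \<open>\<omega>\<^sub>k\<^sub>+\<^sub>1\<close> approximates \<open>T - r\<close>. Hence two extensions agree once their residues do, and these
  are determined by the \<open>\<alpha>\<^sub>i\<^sub>,\<^sub>j\<close> because odd real roots are unique.
\<close>

section \<open>The skew Laurent polynomial ring\<close>

text \<open>Commuting \<open>E\<close> past \<open>\<rho>^t\<close> only produces terms of lower
  degree in \<open>E\<close>, and these weigh more because \<open>E\<close> has negative value; so
  in the lowest weight everything commutes. The value of \<open>E\<close> starts as
  \<open>v(x) + v(y)\<close> and grows in each step by the value of the next
  \<open>\<omega>\<close>, which becomes linear in the new \<open>E\<close>: hence the sums in (d).
  Dividing \<open>E\<close> by \<open>e\<close> restores its relation with \<open>\<rho>^e\<close>,
  so all steps stay in one ring. Of the exponent \<open>nn k = e * f\<close> only \<open>e\<close>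
  is new ramification, while \<open>f\<close> asks for a root in the residue field. A sign can be
  put in front of \<open>\<rho>\<close> to keep roots real, but it is frozen once an even exponent
  has occurred; this shapes the invariant \<open>Lev\<close>. In the uniqueness proof the obstacle
  is that the prescribed data do not give the value of \<open>T - r\<close>, only a lower bound
  \<open>\<delta>\<close>. As \<open>r\<close> is a simple root of the polynomial
  \<open>\<Omega>\<close> that relates \<open>T\<close> to the next \<open>\<omega>\<close>,
  inverting \<open>\<Omega>\<close> as a truncated power series yields a substitute
  \<open>\<kappa>\<close> whose value is controlled.\<close>

definition pshift :: "int \<Rightarrow> real poly \<Rightarrow> real poly" where
  "pshift t P = pcompose P [:of_int t, 1:]"

lemma pshift_pshift: "pshift s (pshift t P) = pshift (s + t) P"
  by (simp add: pshift_def pcompose_assoc[symmetric] pcompose_pCons add.commute)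

lemma pshift_simps [simp]:
  "pshift 0 P = P" "pshift t 0 = 0" "pshift t 1 = 1" "pshift t (P + Q) = pshift t P + pshift t Q"
  "pshift t (P * Q) = pshift t P * pshift t Q" "pshift t (smult r P) = smult r (pshift t P)"
  "pshift t (sum f A) = (\<Sum>i\<in>A. pshift t (f i))" "pshift t [:a:] = [:a:]"
  "pshift t [:a, b:] = [:a + b * of_int t, b:]"
  by (simp_all add: pshift_def pcompose_add pcompose_mult pcompose_smult pcompose_sum pcompose_pCons
      one_pCons)

lemma smult_sum_right: "smult r (sum f A) = (\<Sum>i\<in>A. smult r (f i))" for f :: "'b \<Rightarrow> real poly"
  by (induction A rule: infinite_finite_induct) (auto simp: smult_add_right)

lemma pshift_eq_0_iff [simp]: "pshift t P = 0 \<longleftrightarrow> P = 0"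
  by (metis pshift_simps(1,2) pshift_pshift ab_left_minus)

text \<open>\<open>part b s\<close> is the polynomial \<open>f\<^sub>s\<close> in \<open>b = \<Sum> \<rho>\<^sup>s f\<^sub>s(E)\<close>, where \<open>E \<rho>\<^sup>t = \<rho>\<^sup>t (E + t)\<close>.\<close>

typedef skew = "{f :: int \<Rightarrow> real poly. finite {s. f s \<noteq> 0}}"
  morphisms part Abs_skew
  by (rule exI[of _ "\<lambda>_. 0"]) simp

setup_lifting type_definition_skew

lemma finite_part [simp]: "finite {s. part b s \<noteq> 0}"
  using part[of b] by simp

lemma skew_eqI: "(\<And>s. part a s = part b s) \<Longrightarrow> a = b"
  by (simp add: part_inject[symmetric] fun_eq_iff)

text \<open>Moving \<open>f s\<close> to the right past \<open>\<rho>^(u - s)\<close> shifts its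
  argument by \<open>u - s\<close>; this is the product forced by the commutation relation.\<close>

definition skew_times :: "(int \<Rightarrow> real poly) \<Rightarrow> (int \<Rightarrow> real poly) \<Rightarrow> int \<Rightarrow> real poly" where
  "skew_times f g u = (\<Sum>s | f s \<noteq> 0. pshift (u - s) (f s) * g (u - s))"

lemma skew_times_eq:
  assumes "finite A" "{s. f s \<noteq> 0} \<subseteq> A"
  shows "skew_times f g u = (\<Sum>s\<in>A. pshift (u - s) (f s) * g (u - s))"
  unfolding skew_times_def using assms by (intro sum.mono_neutral_left) auto

lemma skew_times_supp:
  "{u. skew_times f g u \<noteq> 0} \<subseteq> (\<lambda>(s, t). s + t) ` ({s. f s \<noteq> 0} \<times> {t. g t \<noteq> 0})"
proof
  fix u assume "u \<in> {u. skew_times f g u \<noteq> 0}"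
  then obtain s where "f s \<noteq> 0" "g (u - s) \<noteq> 0"
    unfolding skew_times_def by (auto elim!: sum.not_neutral_contains_not_neutral)
  then show "u \<in> (\<lambda>(s, t). s + t) ` ({s. f s \<noteq> 0} \<times> {t. g t \<noteq> 0})"
    by (intro image_eqI[of _ _ "(s, u - s)"]) auto
qed

lemma skew_times_assoc:
  assumes f: "finite {s. f s \<noteq> 0}" and g: "finite {s. g s \<noteq> 0}" and h: "finite {s. h s \<noteq> 0}"
  shows "skew_times (skew_times f g) h = skew_times f (skew_times g h)"
proof
  fix u
  define A where "A = {s. f s \<noteq> 0}"
  define C where "C = {s. g s \<noteq> 0}"
  define B where "B = (\<lambda>(s, t). s + t) ` (A \<times> C)"
  have fin: "finite A" "finite B" "finite C"
    using f g by (auto simp: A_def B_def C_def)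
  have "skew_times (skew_times f g) h u
      = (\<Sum>t\<in>B. pshift (u - t) (\<Sum>s\<in>A. pshift (t - s) (f s) * g (t - s)) * h (u - t))"
    using skew_times_supp[of f g] fin by (subst skew_times_eq[of B]) (auto simp: A_def B_def C_def skew_times_def)
  also have "\<dots> = (\<Sum>t\<in>B. \<Sum>s\<in>A. pshift (u - s) (f s) * pshift (u - t) (g (t - s)) * h (u - t))"
    by (simp add: pshift_pshift sum_distrib_right)
  also have "\<dots> = (\<Sum>s\<in>A. \<Sum>t\<in>B. pshift (u - s) (f s) * pshift (u - t) (g (t - s)) * h (u - t))"
    by (rule sum.swap)
  also have "\<dots> = (\<Sum>s\<in>A. \<Sum>r\<in>C. pshift (u - s) (f s) * (pshift (u - s - r) (g r) * h (u - s - r)))"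
  proof (rule sum.cong[OF refl])
    fix s assume s: "s \<in> A"
    have "(\<Sum>t\<in>B. pshift (u - s) (f s) * pshift (u - t) (g (t - s)) * h (u - t))
        = (\<Sum>t\<in>(\<lambda>r. s + r) ` C. pshift (u - s) (f s) * pshift (u - t) (g (t - s)) * h (u - t))"
    proof (rule sum.mono_neutral_right)
      show "\<forall>t\<in>B - (+) s ` C. pshift (u - s) (f s) * pshift (u - t) (g (t - s)) * h (u - t) = 0"
      proof
        fix t assume "t \<in> B - (+) s ` C"
        then have "t - s \<notin> C" by (auto simp: image_iff)
        then show "pshift (u - s) (f s) * pshift (u - t) (g (t - s)) * h (u - t) = 0"
          by (simp add: C_def)
      qed
    qed (use s fin in \<open>auto simp: B_def\<close>)
    also have "\<dots> = (\<Sum>r\<in>C. pshift (u - s) (f s) * (pshift (u - s - r) (g r) * h (u - s - r)))"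
      by (subst sum.reindex) (auto simp: inj_on_def mult.assoc diff_diff_eq)
    finally show "(\<Sum>t\<in>B. pshift (u - s) (f s) * pshift (u - t) (g (t - s)) * h (u - t))
        = (\<Sum>r\<in>C. pshift (u - s) (f s) * (pshift (u - s - r) (g r) * h (u - s - r)))" .
  qed
  also have "\<dots> = skew_times f (skew_times g h) u"
    by (simp add: skew_times_def A_def C_def sum_distrib_left)
  finally show "skew_times (skew_times f g) h u = skew_times f (skew_times g h) u" .
qed

instantiation skew :: real_algebra_1
begin

lift_definition zero_skew :: skew is "\<lambda>_. 0" by simp

lift_definition one_skew :: skew is "\<lambda>u. if u = 0 then 1 else 0" by simp

lift_definition plus_skew :: "skew \<Rightarrow> skew \<Rightarrow> skew" is "\<lambda>f g u. f u + g u"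
  subgoal for f g by (rule finite_subset[of _ "{s. f s \<noteq> 0} \<union> {s. g s \<noteq> 0}"]) auto
  done

lift_definition minus_skew :: "skew \<Rightarrow> skew \<Rightarrow> skew" is "\<lambda>f g u. f u - g u"
  subgoal for f g by (rule finite_subset[of _ "{s. f s \<noteq> 0} \<union> {s. g s \<noteq> 0}"]) auto
  done

lift_definition uminus_skew :: "skew \<Rightarrow> skew" is "\<lambda>f u. - f u"
  by simp

lift_definition times_skew :: "skew \<Rightarrow> skew \<Rightarrow> skew" is skew_times
  by (rule finite_subset[OF skew_times_supp]) auto

lift_definition scaleR_skew :: "real \<Rightarrow> skew \<Rightarrow> skew" is "\<lambda>r f u. smult r (f u)"
  subgoal for r f by (rule finite_subset[of _ "{s. f s \<noteq> 0}"]) auto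
  done

instance
proof
  fix a b c :: skew and r t :: real
  show "a * b * c = a * (b * c)"
    by transfer (simp add: skew_times_assoc)
  show "1 * a = a"
    by transfer (auto simp: fun_eq_iff skew_times_eq[of "{0}"])
  show "a * 1 = a"
  proof transfer
    fix f :: "int \<Rightarrow> real poly" assume f: "finite {s. f s \<noteq> 0}"
    show "skew_times f (\<lambda>u. if u = 0 then 1 else 0) = f"
    proof
      fix u
      have "skew_times f (\<lambda>u. if u = 0 then 1 else 0) u
          = (\<Sum>s\<in>insert u {s. f s \<noteq> 0}. pshift (u - s) (f s) * (if u - s = 0 then 1 else 0))"
        using f by (intro skew_times_eq) auto
      also have "\<dots> = (\<Sum>s\<in>{u}. pshift (u - s) (f s) * (if u - s = 0 then 1 else 0))"
        using f by (intro sum.mono_neutral_right) auto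
      finally show "skew_times f (\<lambda>u. if u = 0 then 1 else 0) u = f u" by simp
    qed
  qed
  show "(a + b) * c = a * c + b * c"
  proof transfer
    fix f g h :: "int \<Rightarrow> real poly"
    assume "finite {s. f s \<noteq> 0}" "finite {s. g s \<noteq> 0}"
    then have "finite ({s. f s \<noteq> 0} \<union> {s. g s \<noteq> 0})" (is "finite ?A") by simp
    then show "skew_times (\<lambda>u. f u + g u) h = (\<lambda>u. skew_times f h u + skew_times g h u)"
      by (intro ext, subst (1 2 3) skew_times_eq[of ?A])
        (auto simp: algebra_simps sum.distrib)
  qed
  show "a * (b + c) = a * b + a * c"
    by transfer (auto simp: skew_times_def fun_eq_iff algebra_simps sum.distrib)
  show "(r *\<^sub>R a) * b = r *\<^sub>R (a * b)"
  proof transfer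
    fix r and f g :: "int \<Rightarrow> real poly" assume f: "finite {s. f s \<noteq> 0}"
    show "skew_times (\<lambda>u. smult r (f u)) g = (\<lambda>u. smult r (skew_times f g u))"
      using f by (intro ext, subst (1 2) skew_times_eq[of "{s. f s \<noteq> 0}"])
        (auto simp: smult_sum_right)
  qed
  show "a * (r *\<^sub>R b) = r *\<^sub>R (a * b)"
    by transfer (auto simp: skew_times_def fun_eq_iff smult_sum_right)
  show "(0::skew) \<noteq> 1"
    by transfer (auto simp: fun_eq_iff)
qed (transfer; auto simp: algebra_simps smult_add_right smult_add_left)+

end

definition sm :: "int \<Rightarrow> real poly \<Rightarrow> skew" where
  "sm s P = Abs_skew (\<lambda>u. if u = s then P else 0)"

lemma part_zero [simp]: "part 0 s = 0" by transfer simp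
lemma part_one: "part 1 s = (if s = 0 then 1 else 0)" by transfer simp
lemma part_add [simp]: "part (a + b) s = part a s + part b s" by transfer simp
lemma part_diff [simp]: "part (a - b) s = part a s - part b s" by transfer simp
lemma part_uminus [simp]: "part (- a) s = - part a s" by transfer simp
lemma part_scaleR [simp]: "part (r *\<^sub>R a) s = smult r (part a s)" by transfer simp
lemma part_sm: "part (sm s P) u = (if u = s then P else 0)"
  unfolding sm_def by (subst Abs_skew_inverse) auto
lemma part_sum: "part (sum f A) u = (\<Sum>i\<in>A. part (f i) u)"
  by (induction A rule: infinite_finite_induct) auto
lemma part_times: "part (a * b) u = (\<Sum>s | part a s \<noteq> 0. pshift (u - s) (part a s) * part b (u - s))"
  by transfer (simp add: skew_times_def)
lemma part_of_real: "part (of_real r) s = (if s = 0 then [:r:] else 0)"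
  by (simp add: of_real_def part_one one_pCons)

lemma sm_add: "sm s (P + Q) = sm s P + sm s Q"
  by (rule skew_eqI) (simp add: part_sm)
lemma sm_0 [simp]: "sm s 0 = 0"
  by (rule skew_eqI) (simp add: part_sm)
lemma sm_one: "sm 0 1 = 1"
  by (rule skew_eqI) (simp add: part_sm part_one)
lemma scaleR_sm: "r *\<^sub>R sm s P = sm s (smult r P)"
  by (rule skew_eqI) (simp add: part_sm)
lemma of_real_sm: "of_real r = sm 0 [:r:]"
  by (rule skew_eqI) (simp add: part_sm part_of_real)

lemma sm_mult: "sm s P * sm t Q = sm (s + t) (pshift t P * Q)"
proof (cases "P = 0")
  case False
  show ?thesis
  proof (rule skew_eqI)
    fix u
    have "{r. part (sm s P) r \<noteq> 0} = {s}" using False by (auto simp: part_sm)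
    then show "part (sm s P * sm t Q) u = part (sm (s + t) (pshift t P * Q)) u"
      by (auto simp: part_times part_sm)
  qed
qed simp

lemma skew_sum_sm: "b = (\<Sum>s | part b s \<noteq> 0. sm s (part b s))"
  by (rule skew_eqI) (auto simp: part_sum part_sm sum.delta)

lemma skew_induct [case_names sm add]:
  assumes "\<And>s P. Q (sm s P)" and "\<And>a b. Q a \<Longrightarrow> Q b \<Longrightarrow> Q (a + b)"
  shows "Q b"
proof -
  have "Q (\<Sum>s\<in>A. sm s (part b s))" if "finite A" for A
    using that
  proof induction
    case empty
    show ?case using assms(1)[of 0 0] by simp
  next
    case (insert x F)
    then show ?case using assms by simp
  qed
  from this[OF finite_part] show ?thesis by (subst skew_sum_sm)
qed

definition rho :: "int \<Rightarrow> skew" where "rho s = sm s 1"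
definition En :: skew where "En = sm 0 [:0, 1:]"

lemma rho_mult: "rho s * rho t = rho (s + t)"
  by (simp add: rho_def sm_mult)
lemma rho_0 [simp]: "rho 0 = 1"
  by (simp add: rho_def sm_one)
lemma En_rho: "En * rho t = rho t * (En + of_int t)"
proof -
  have "(of_int t :: skew) = sm 0 [:of_int t:]"
    using of_real_sm[of "of_int t"] by simp
  then show ?thesis
    by (simp add: rho_def En_def sm_mult sm_add[symmetric])
qed

section \<open>Evaluation of real polynomials and homomorphisms out of the skew ring\<close>

definition pe :: "real poly \<Rightarrow> 'a::real_algebra_1 \<Rightarrow> 'a" where
  "pe P T = fold_coeffs (\<lambda>a x. of_real a + T * x) P 0"

lemma pe_0 [simp]: "pe 0 T = 0"
  by (simp add: pe_def)
lemma pe_pCons [simp]: "pe (pCons a P) T = of_real a + T * pe P T"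
  by (cases "P = 0 \<and> a = 0") (auto simp: pe_def)
lemma pe_1 [simp]: "pe 1 T = 1"
  by (simp add: one_pCons)
lemma pe_add: "pe (P + Q) T = pe P T + pe Q T"
  by (induction P Q rule: poly_induct2) (auto simp: algebra_simps)
lemma pe_smult: "pe (smult r P) T = r *\<^sub>R pe P T"
  by (induction P) (auto simp: algebra_simps of_real_def)
lemma pe_minus: "pe (- P) T = - pe P T"
  using pe_smult[of "-1" P T] by simp
lemma pe_diff: "pe (P - Q) T = pe P T - pe Q T"
  using pe_add[of P "- Q" T] by (simp add: pe_minus)
lemma of_real_commute: "of_real r * (x::'a::real_algebra_1) = x * of_real r"
  by (simp add: of_real_def)
lemma pe_mult: "pe (P * Q) T = pe P T * pe Q T"
  by (induction P) (auto simp: pe_add pe_smult algebra_simps of_real_def mult.assoc)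
lemma pe_power: "pe (P ^ n) T = pe P T ^ n"
  by (induction n) (auto simp: pe_mult)
lemma pe_pcompose: "pe (pcompose P Q) T = pe P (pe Q T)"
  by (induction P) (auto simp: pcompose_pCons pe_add pe_mult)
lemma sm_pe: "sm s P = rho s * pe P En"
proof -
  have "pe P En = sm 0 P"
  proof (induction P)
    case (pCons a P)
    have "pe (pCons a P) En = sm 0 [:a:] + sm 0 ([:0, 1:] * P)"
      using pCons by (simp add: of_real_sm En_def sm_mult)
    also have "\<dots> = sm 0 (pCons a P)"
      by (simp add: sm_add[symmetric])
    finally show ?case .
  qed simp
  then show ?thesis by (simp add: rho_def sm_mult)
qed

text \<open>The candidate homomorphism with \<open>\<rho>^s \<mapsto> R s\<close> and
  \<open>E \<mapsto> F\<close>. A family \<open>R\<close> over the integers, instead of the powers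
  of one element, covers negative exponents in targets that are not division rings.\<close>

definition hm :: "(int \<Rightarrow> 'a::real_algebra_1) \<Rightarrow> 'a \<Rightarrow> skew \<Rightarrow> 'a" where
  "hm R F b = (\<Sum>s | part b s \<noteq> 0. R s * pe (part b s) F)"

lemma hm_eq: "finite A \<Longrightarrow> {s. part b s \<noteq> 0} \<subseteq> A \<Longrightarrow> hm R F b = (\<Sum>s\<in>A. R s * pe (part b s) F)"
  unfolding hm_def by (intro sum.mono_neutral_left) auto

lemma hm_sm [simp]: "hm R F (sm s P) = R s * pe P F"
  by (subst hm_eq[of "{s}"]) (auto simp: part_sm)

lemma hm_add: "hm R F (a + b) = hm R F a + hm R F b"
  by (subst (1 2 3) hm_eq[of "{s. part a s \<noteq> 0} \<union> {s. part b s \<noteq> 0}"])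
    (auto simp: pe_add algebra_simps sum.distrib)

definition alg_hom :: "('a::real_algebra_1 \<Rightarrow> 'b::real_algebra_1) \<Rightarrow> bool" where
  "alg_hom h \<longleftrightarrow> (\<forall>a b. h (a + b) = h a + h b) \<and> (\<forall>a b. h (a * b) = h a * h b) \<and>
     (\<forall>r. h (of_real r) = of_real r)"

text \<open>The hypotheses on \<open>R\<close> and \<open>F\<close> mirror the defining relations of
  the skew ring. They give \<open>P(F) R t = R t P(F + t)\<close>, which is the product rule on
  monomials, and the rest is bilinearity.\<close>

lemma alg_hom_hm:
  assumes R: "\<And>s t. R (s + t) = R s * R t" "R 0 = 1" and F: "\<And>t. F * R t = R t * (F + of_int t)"
  shows "alg_hom (hm R F)"
proof -
  have comm: "pe P F * R t = R t * pe P (F + of_int t)" for P t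
  proof (induction P)
    case (pCons a P)
    have "pe (pCons a P) F * R t = of_real a * R t + F * (pe P F * R t)"
      by (simp add: algebra_simps mult.assoc)
    also have "\<dots> = R t * of_real a + (F * R t) * pe P (F + of_int t)"
      by (simp add: of_real_commute pCons.IH mult.assoc)
    also have "\<dots> = R t * pe (pCons a P) (F + of_int t)"
      by (simp add: F algebra_simps mult.assoc)
    finally show ?case .
  qed simp
  have shift: "pe (pshift t P) F = pe P (F + of_int t)" for t P
    by (simp add: pshift_def pe_pcompose add.commute)
  have mono: "hm R F (sm s P * sm t Q) = hm R F (sm s P) * hm R F (sm t Q)" for s t P Q
  proof -
    have "hm R F (sm s P) * hm R F (sm t Q) = R s * (pe P F * R t) * pe Q F"
      by (simp add: mult.assoc)
    also have "\<dots> = hm R F (sm s P * sm t Q)"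
      by (simp add: sm_mult R comm shift pe_mult mult.assoc)
    finally show ?thesis by simp
  qed
  have left: "hm R F (sm s P * b) = hm R F (sm s P) * hm R F b" for s P b
    by (induction b rule: skew_induct) (simp_all add: mono hm_add ring_distribs del: hm_sm)
  have "hm R F (a * b) = hm R F a * hm R F b" for a b
    by (induction a rule: skew_induct) (simp_all add: left hm_add ring_distribs del: hm_sm)
  then show ?thesis
    by (auto simp: alg_hom_def hm_add of_real_sm R)
qed

lemma
  assumes "alg_hom h"
  shows alg_hom_add: "h (a + b) = h a + h b" and alg_hom_mult: "h (a * b) = h a * h b"
    and alg_hom_of_real: "h (of_real r) = of_real r"
    and alg_hom_0: "h 0 = 0" and alg_hom_1: "h 1 = 1"
    and alg_hom_scaleR: "h (r *\<^sub>R a) = r *\<^sub>R h a"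
    and alg_hom_uminus: "h (- a) = - h a"
    and alg_hom_diff: "h (a - b) = h a - h b"
    and alg_hom_power: "h (a ^ n) = h a ^ n"
    and alg_hom_sum: "h (sum f A) = (\<Sum>i\<in>A. h (f i))"
proof -
  show add: "h (a + b) = h a + h b" and mult: "h (a * b) = h a * h b"
    and re: "h (of_real r) = of_real r" for a b r
    using assms by (auto simp: alg_hom_def)
  show zero: "h 0 = 0" and one: "h 1 = 1" using re[of 0] re[of 1] by simp_all
  show sc: "h (r *\<^sub>R a) = r *\<^sub>R h a" for r a
    using mult[of "of_real r" a] re[of r] by (simp add: of_real_def)
  show um: "h (- a) = - h a" for a using sc[of "-1" a] by simp
  show "h (a - b) = h a - h b" using add[of a "- b"] um by simp
  show "h (a ^ n) = h a ^ n" by (induction n) (auto simp: mult one)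
  show "h (sum f A) = (\<Sum>i\<in>A. h (f i))"
    by (induction A rule: infinite_finite_induct) (auto simp: add zero)
qed

lemma alg_hom_pe: "alg_hom h \<Longrightarrow> h (pe P T) = pe P (h T)"
  by (induction P) (auto simp: alg_hom_add alg_hom_mult alg_hom_of_real alg_hom_0)

lemma alg_hom_comp: "alg_hom g \<Longrightarrow> alg_hom h \<Longrightarrow> alg_hom (\<lambda>b. g (h b))"
  by (simp add: alg_hom_def)

lemma alg_hom_id: "alg_hom (\<lambda>b. b)"
  by (simp add: alg_hom_def)

section \<open>Monomial weights and re-embeddings\<close>

definition cf :: "skew \<Rightarrow> int \<Rightarrow> nat \<Rightarrow> real" where
  "cf b s j = coeff (part b s) j"

lemma cf_simps [simp]:
  "cf 0 s j = 0" "cf (a + b) s j = cf a s j + cf b s j" "cf (a - b) s j = cf a s j - cf b s j"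
  "cf (- a) s j = - cf a s j" "cf (r *\<^sub>R a) s j = r * cf a s j"
  by (simp_all add: cf_def)

lemma cf_sum: "cf (sum f A) s j = (\<Sum>i\<in>A. cf (f i) s j)"
  by (induction A rule: infinite_finite_induct) auto

lemma cf_sm: "cf (sm s P) u j = (if u = s then coeff P j else 0)"
  by (simp add: cf_def part_sm)

lemma cf_rho: "cf (rho s) u j = (if u = s \<and> j = 0 then 1 else 0)"
  by (auto simp: rho_def cf_sm)

lemma cf_En: "cf En u j = (if u = 0 \<and> j = 1 then 1 else 0)"
  by (cases j) (auto simp: En_def cf_sm coeff_pCons split: nat.splits)

lemma cf_of_real: "cf (of_real r) u j = (if u = 0 \<and> j = 0 then r else 0)"
  by (cases j) (auto simp: of_real_sm cf_sm)

lemma cf_one: "cf 1 u j = (if u = 0 \<and> j = 0 then 1 else 0)"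
  using cf_of_real[of 1] by simp

lemma skew_cf_eqI: "(\<And>s j. cf a s j = cf b s j) \<Longrightarrow> a = b"
  by (auto intro!: skew_eqI poly_eqI simp: cf_def)

lemma finite_cf: "finite {(s, j). cf b s j \<noteq> 0}"
proof (rule finite_subset)
  show "{(s, j). cf b s j \<noteq> 0} \<subseteq> Sigma {s. part b s \<noteq> 0} (\<lambda>s. {..degree (part b s)})"
    by (auto simp: cf_def le_degree)
qed auto

lemma cf_mon: "cf (rho s * En ^ j) u i = (if u = s \<and> i = j then 1 else 0)"
proof -
  have "rho s * En ^ j = sm s (monom 1 j)"
    using sm_pe[of s "monom 1 j"] by (simp add: monom_altdef pe_power)
  then show ?thesis by (auto simp: cf_sm)
qed

lemma skew_sum_mon: "b = (\<Sum>(s, j) | cf b s j \<noteq> 0. cf b s j *\<^sub>R (rho s * En ^ j))"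
proof (rule skew_cf_eqI)
  fix u i
  have "cf (\<Sum>(s, j) | cf b s j \<noteq> 0. cf b s j *\<^sub>R (rho s * En ^ j)) u i
      = (\<Sum>x | case x of (s, j) \<Rightarrow> cf b s j \<noteq> 0. if x = (u, i) then cf b u i else 0)"
    unfolding cf_sum by (intro sum.cong) (auto simp: cf_mon split: if_splits)
  also have "\<dots> = cf b u i" using finite_cf[of b] by (simp add: sum.delta)
  finally show "cf b u i = cf (\<Sum>(s, j) | cf b s j \<noteq> 0. cf b s j *\<^sub>R (rho s * En ^ j)) u i" by simp
qed

lemma coeff_pshift:
  assumes "\<And>i'. i' > i \<Longrightarrow> coeff P i' = 0"
  shows "coeff (pshift t P) i = coeff P i"
proof -
  have deg: "degree P \<le> i" using assms by (intro degree_le) auto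
  have deg': "degree (pshift t P) = degree P"
    by (simp add: pshift_def degree_pcompose)
  show ?thesis
  proof (cases "degree P = i")
    case True
    have "lead_coeff (pshift t P) = lead_coeff P"
      unfolding pshift_def by (subst lead_coeff_comp) auto
    with True deg' show ?thesis by simp
  next
    case False
    with deg deg' show ?thesis by (simp add: coeff_eq_0)
  qed
qed

definition nmul :: "nat \<Rightarrow> 'g::ab_group_add \<Rightarrow> 'g" where
  "nmul n g = (\<Sum>i<n. g)"

lemma nmul_simps [simp]: "nmul 0 g = 0" "nmul (Suc n) g = g + nmul n g" "nmul n 0 = 0"
  by (simp_all add: nmul_def add.commute)

lemma nmul_add: "nmul (i + j) g = nmul i g + nmul j g"
  by (induction i) (auto simp: algebra_simps)

lemma nmul_diff: "nmul n (g - h) = nmul n g - nmul n h"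
  by (induction n) (auto simp: algebra_simps)

lemma nmul_plus: "nmul n (g + h) = nmul n g + nmul n h"
  by (induction n) (auto simp: algebra_simps)

lemma nmul_int: "nmul n (g::int) = int n * g"
  by (induction n) (auto simp: algebra_simps)

lemma nmul_mono: "g \<le> h \<Longrightarrow> nmul n g \<le> nmul n (h::'g::linordered_ab_group_add)"
  by (simp add: nmul_def sum_mono)

lemma nmul_nonneg: "0 \<le> g \<Longrightarrow> 0 \<le> nmul n (g::'g::linordered_ab_group_add)"
  by (simp add: nmul_def sum_nonneg)

lemma nmul_pos: "0 < g \<Longrightarrow> 0 < n \<Longrightarrow> 0 < nmul n (g::'g::linordered_ab_group_add)"
  by (simp add: nmul_def sum_pos lessThan_empty_iff)

lemma nmul_mono_nat: "0 \<le> g \<Longrightarrow> i \<le> j \<Longrightarrow> nmul i g \<le> nmul j (g::'g::linordered_ab_group_add)"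
  using nmul_add[of i "j - i" g] nmul_nonneg[of g "j - i"] by simp

text \<open>Both generators have negative weight. Commutation only creates terms of lower degree in
  \<open>E\<close>, which therefore weigh more, so the associated graded ring is
  commutative.\<close>

locale weight =
  fixes wt :: "int \<Rightarrow> nat \<Rightarrow> 'g::linordered_ab_group_add"
  assumes wt_add: "wt (s + t) (i + j) = wt s i + wt t j"
    and wt_En: "wt 0 1 < 0" and wt_rho: "wt 1 0 < 0"
begin

lemma wt_0: "wt 0 0 = 0"
  using wt_add[of 0 0 0 0] by simp

lemma wt_less_nat: "i < j \<Longrightarrow> wt s j < wt s i"
proof (induction j)
  case (Suc j)
  have "wt s (Suc j) < wt s j"
    using wt_add[of s 0 j 1] wt_En by simp
  with Suc show ?case by (cases "i = j") auto
qed simp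

lemma wt_less_int:
  assumes "s < t" shows "wt t j < wt s j"
proof -
  have "wt (s + int n) j < wt s j" if "n > 0" for n
    using that
  proof (induction n)
    case (Suc n)
    have "wt (s + int (Suc n)) j < wt (s + int n) j"
      using wt_add[of "s + int n" 1 j 0] wt_rho by (simp add: algebra_simps)
    with Suc show ?case by (cases "n = 0") auto
  qed simp
  from this[of "nat (t - s)"] assms show ?thesis by simp
qed

lemma wt_eq_int_iff: "wt s j = wt t j \<longleftrightarrow> s = t"
  using wt_less_int[of s t j] wt_less_int[of t s j] by (cases s t rule: linorder_cases) auto

text \<open>
  Lower bounds, strict lower bounds, and two kinds of leading monomials \<open>\<rho>\<^sup>s E\<^sup>j\<close>: \<open>sl\<close> requires that no other
  monomial has the least weight, \<open>lead\<close> selects the one of highest degree in \<open>E\<close> among those that have it.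
\<close>

definition lbd :: "'g \<Rightarrow> skew \<Rightarrow> bool" where
  "lbd g b \<longleftrightarrow> (\<forall>s j. cf b s j \<noteq> 0 \<longrightarrow> g \<le> wt s j)"

definition slb :: "'g \<Rightarrow> skew \<Rightarrow> bool" where
  "slb g b \<longleftrightarrow> (\<forall>s j. cf b s j \<noteq> 0 \<longrightarrow> g < wt s j)"

definition sl :: "skew \<Rightarrow> real \<Rightarrow> int \<Rightarrow> nat \<Rightarrow> bool" where
  "sl b c s j \<longleftrightarrow> c \<noteq> 0 \<and> cf b s j = c \<and>
     (\<forall>t i. cf b t i \<noteq> 0 \<longrightarrow> (t, i) \<noteq> (s, j) \<longrightarrow> wt s j < wt t i)"

definition lead :: "skew \<Rightarrow> int \<Rightarrow> nat \<Rightarrow> bool" where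
  "lead b s j \<longleftrightarrow> cf b s j \<noteq> 0 \<and>
     (\<forall>t i. cf b t i \<noteq> 0 \<longrightarrow> wt s j < wt t i \<or> (wt s j = wt t i \<and> i \<le> j))"

lemma lbd_mono: "lbd g b \<Longrightarrow> h \<le> g \<Longrightarrow> lbd h b"
  by (force simp: lbd_def)
lemma lbd_0 [simp]: "lbd g 0" by (simp add: lbd_def)
lemma lbd_add: "lbd g a \<Longrightarrow> lbd g b \<Longrightarrow> lbd g (a + b)"
  unfolding lbd_def by (metis add.right_neutral cf_simps(2))
lemma lbd_uminus: "lbd g a \<Longrightarrow> lbd g (- a)"
  by (simp add: lbd_def)
lemma lbd_diff: "lbd g a \<Longrightarrow> lbd g b \<Longrightarrow> lbd g (a - b)"
  using lbd_add[of g a "- b"] lbd_uminus[of g b] by simp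
lemma lbd_scaleR: "lbd g a \<Longrightarrow> lbd g (r *\<^sub>R a)"
  by (simp add: lbd_def)
lemma lbd_sum: "(\<And>i. i \<in> A \<Longrightarrow> lbd g (f i)) \<Longrightarrow> lbd g (sum f A)"
  by (induction A rule: infinite_finite_induct) (auto intro: lbd_add)
lemma lbd_of_real: "lbd 0 (of_real r)"
  by (auto simp: lbd_def cf_of_real wt_0 split: if_splits)
lemma lbd_one: "lbd 0 1"
  using lbd_of_real[of 1] by simp
text \<open>By finite support the least weight that occurs is attained, so a strict bound improves
  to a larger non-strict one. This is how domination later yields strict inequalities.\<close>

lemma slb_cases:
  assumes "slb g b"
  obtains "b = 0" | h where "h > g" "lbd h b"
proof (cases "b = 0")
  case False
  define S where "S = (\<lambda>(s, j). wt s j) ` {(s, j). cf b s j \<noteq> 0}"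
  have "\<exists>s j. cf b s j \<noteq> 0" using False skew_cf_eqI[of b 0] by auto
  then have S: "finite S" "S \<noteq> {}" using finite_cf[of b] by (auto simp: S_def)
  have "Min S \<in> S" using S by simp
  then have "Min S > g" using assms by (auto simp: S_def slb_def)
  moreover have "lbd (Min S) b"
    unfolding lbd_def using S by (auto intro!: Min_le simp: S_def)
  ultimately show ?thesis using that by blast
qed (use that in blast)

text \<open>In the lowest weight the product is that of commuting variables. The shift feeds a
  coefficient only from higher degrees in \<open>E\<close>; these weigh less, so if one of them
  occurred in \<open>a\<close>, the weight of the product monomial would exceed
  \<open>g + h\<close>.\<close>

lemma cf_times_le:
  assumes a: "lbd g a" and b: "lbd h b" and ul: "wt u l \<le> g + h"
  shows "cf (a * b) u l = (\<Sum>s | part a s \<noteq> 0. \<Sum>i\<le>l. cf a s i * cf b (u - s) (l - i))"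
proof -
  have "coeff (pshift (u - s) (part a s)) i * cf b (u - s) (l - i) = cf a s i * cf b (u - s) (l - i)"
    if i: "i \<le> l" for s i
  proof (cases "cf b (u - s) (l - i) = 0")
    case False
    then have h: "h \<le> wt (u - s) (l - i)" using b by (simp add: lbd_def)
    have ul': "wt u l = wt s i + wt (u - s) (l - i)"
      using wt_add[of s "u - s" i "l - i"] i by simp
    have "coeff (part a s) i' = 0" if "i' > i" for i'
    proof (rule ccontr)
      assume "coeff (part a s) i' \<noteq> 0"
      then have "g \<le> wt s i'" using a by (simp add: lbd_def cf_def)
      also have "\<dots> < wt s i" using that by (rule wt_less_nat)
      finally have "g + h < wt u l" using h ul' by (simp add: add_less_le_mono)
      with ul show False by simp
    qed
    then show ?thesis by (simp add: coeff_pshift cf_def)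
  qed simp
  then have "(\<Sum>s | part a s \<noteq> 0. \<Sum>i\<le>l. coeff (pshift (u - s) (part a s)) i * cf b (u - s) (l - i))
      = (\<Sum>s | part a s \<noteq> 0. \<Sum>i\<le>l. cf a s i * cf b (u - s) (l - i))"
    by (intro sum.cong refl) auto
  then show ?thesis
    by (simp add: cf_def part_times coeff_sum coeff_mult)
qed

lemma cf_times_nonzero:
  assumes a: "lbd g a" and b: "lbd h b" and ul: "wt u l \<le> g + h" and nz: "cf (a * b) u l \<noteq> 0"
  obtains s i where "i \<le> l" "cf a s i \<noteq> 0" "cf b (u - s) (l - i) \<noteq> 0"
    "wt s i = g" "wt (u - s) (l - i) = h" "wt u l = g + h"
proof -
  have "(\<Sum>s | part a s \<noteq> 0. \<Sum>i\<le>l. cf a s i * cf b (u - s) (l - i)) \<noteq> 0"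
    using nz cf_times_le[OF a b ul] by simp
  then obtain s where "(\<Sum>i\<le>l. cf a s i * cf b (u - s) (l - i)) \<noteq> 0"
    by (rule sum.not_neutral_contains_not_neutral)
  then obtain i where i: "i \<in> {..l}" and nz: "cf a s i * cf b (u - s) (l - i) \<noteq> 0"
    by (rule sum.not_neutral_contains_not_neutral)
  have ul': "wt u l = wt s i + wt (u - s) (l - i)"
    using wt_add[of s "u - s" i "l - i"] i by simp
  have "g \<le> wt s i" "h \<le> wt (u - s) (l - i)"
    using a b nz by (auto simp: lbd_def)
  with ul ul' have "wt s i = g" "wt (u - s) (l - i) = h"
    using add_less_le_mono[of g "wt s i" h "wt (u - s) (l - i)"]
      add_le_less_mono[of g "wt s i" h "wt (u - s) (l - i)"] by force+
  with that i nz ul' show ?thesis by auto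
qed

lemma lbd_times: "lbd g a \<Longrightarrow> lbd h b \<Longrightarrow> lbd (g + h) (a * b)"
  unfolding lbd_def[of "g + h"] by (metis cf_times_nonzero linear)

lemma lbd_power: "lbd g b \<Longrightarrow> lbd (nmul n g) (b ^ n)"
  by (induction n) (auto intro: lbd_one lbd_times)

lemma lead_lbd: "lead b s j \<Longrightarrow> lbd (wt s j) b"
  by (force simp: lead_def lbd_def)

lemma lbd_leadD: "lbd g b \<Longrightarrow> lead b s j \<Longrightarrow> g \<le> wt s j"
  by (simp add: lead_def lbd_def)

lemma lead_not_0: "lead b s j \<Longrightarrow> b \<noteq> 0"
  by (auto simp: lead_def)

lemma sl_lead: "sl b c s j \<Longrightarrow> lead b s j"
  by (force simp: sl_def lead_def)

lemma lead_ex: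
  assumes "b \<noteq> 0"
  shows "\<exists>s j. lead b s j"
proof -
  define S where "S = (\<lambda>(s, j). wt s j) ` {(s, j). cf b s j \<noteq> 0}"
  define J where "J = {j. \<exists>s. cf b s j \<noteq> 0 \<and> wt s j = Min S}"
  have "\<exists>s j. cf b s j \<noteq> 0" using assms skew_cf_eqI[of b 0] by auto
  then have S: "finite S" "S \<noteq> {}" using finite_cf[of b] by (auto simp: S_def)
  have "J \<subseteq> snd ` {(s, j). cf b s j \<noteq> 0}" by (force simp: J_def)
  then have J: "finite J" using finite_cf[of b] by (meson finite_imageI finite_subset)
  have "Min S \<in> S" using S by simp
  then obtain s0 j0 where "cf b s0 j0 \<noteq> 0" "wt s0 j0 = Min S" unfolding S_def by force
  then have "J \<noteq> {}" unfolding J_def by blast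
  with J have "Max J \<in> J" by simp
  then obtain s where s: "cf b s (Max J) \<noteq> 0" "wt s (Max J) = Min S" by (auto simp: J_def)
  have "lead b s (Max J)"
    unfolding lead_def
  proof (intro conjI allI impI)
    fix t i assume ti: "cf b t i \<noteq> 0"
    then have "Min S \<le> wt t i" using S by (auto intro!: Min_le simp: S_def)
    moreover have "i \<le> Max J" if "Min S = wt t i"
      using J that ti by (intro Max_ge) (auto simp: J_def)
    ultimately show "wt s (Max J) < wt t i \<or> wt s (Max J) = wt t i \<and> i \<le> Max J"
      using s by (cases "Min S = wt t i") auto
  qed (use s in auto)
  then show ?thesis by blast
qed

lemma lead_unique: "lead b s j \<Longrightarrow> lead b t i \<Longrightarrow> s = t \<and> j = i"
  unfolding lead_def using wt_eq_int_iff by (metis less_asym less_irrefl order_antisym)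

text \<open>Ties between monomials of equal weight are broken by the degree in \<open>E\<close>, so
  just one pair of monomials contributes to the leading one of the product: the graded ring is a
  domain.\<close>

lemma lead_times:
  assumes a: "lead a s j" and b: "lead b t i"
  shows "lead (a * b) (s + t) (j + i)" and "cf (a * b) (s + t) (j + i) = cf a s j * cf b t i"
proof -
  note la = lead_lbd[OF a] and lb = lead_lbd[OF b]
  have le: "j' \<le> j" if "cf a s' j' \<noteq> 0" "wt s' j' = wt s j" for s' j'
    using a that by (force simp: lead_def)
  have le': "j' \<le> i" if "cf b s' j' \<noteq> 0" "wt s' j' = wt t i" for s' j'
    using b that by (force simp: lead_def)
  have "cf (a * b) (s + t) (j + i)
      = (\<Sum>s' | part a s' \<noteq> 0. \<Sum>j'\<le>j + i. cf a s' j' * cf b (s + t - s') (j + i - j'))"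
    by (rule cf_times_le[OF la lb]) (simp add: wt_add)
  also have "\<dots> = (\<Sum>s' | part a s' \<noteq> 0. if s' = s then cf a s j * cf b t i else 0)"
  proof (rule sum.cong[OF refl])
    fix s'
    have "cf a s' j' * cf b (s + t - s') (j + i - j')
        = (if s' = s \<and> j' = j then cf a s j * cf b t i else 0)" if j': "j' \<le> j + i" for j'
    proof (cases "cf a s' j' = 0 \<or> cf b (s + t - s') (j + i - j') = 0")
      case False
      then have ge: "wt s j \<le> wt s' j'" "wt t i \<le> wt (s + t - s') (j + i - j')"
        using la lb by (auto simp: lbd_def)
      have eq: "wt s j + wt t i = wt s' j' + wt (s + t - s') (j + i - j')"
        using wt_add[of s t j i] wt_add[of s' "s + t - s'" j' "j + i - j'"] j' by simp
      with ge have "wt s' j' = wt s j" "wt (s + t - s') (j + i - j') = wt t i"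
        using add_less_le_mono[of "wt s j" "wt s' j'" "wt t i" "wt (s + t - s') (j + i - j')"]
          add_le_less_mono[of "wt s j" "wt s' j'" "wt t i" "wt (s + t - s') (j + i - j')"] by force+
      with False le le' have "j' \<le> j" "j + i - j' \<le> i" by blast+
      with j' have "j' = j" by simp
      with \<open>wt s' j' = wt s j\<close> have "s' = s" by (simp add: wt_eq_int_iff)
      with \<open>j' = j\<close> show ?thesis by simp
    next
      case True
      then show ?thesis by auto
    qed
    then have "(\<Sum>j'\<le>j + i. cf a s' j' * cf b (s + t - s') (j + i - j'))
        = (\<Sum>j'\<le>j + i. if s' = s \<and> j' = j then cf a s j * cf b t i else 0)"
      by (intro sum.cong) auto
    also have "\<dots> = (if s' = s then cf a s j * cf b t i else 0)"
      by (cases "s' = s") (simp_all add: sum.delta)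
    finally show "(\<Sum>j'\<le>j + i. cf a s' j' * cf b (s + t - s') (j + i - j'))
        = (if s' = s then cf a s j * cf b t i else 0)" .
  qed
  also have "\<dots> = cf a s j * cf b t i"
    by (auto simp: cf_def)
  finally show cf: "cf (a * b) (s + t) (j + i) = cf a s j * cf b t i" .
  show "lead (a * b) (s + t) (j + i)"
    unfolding lead_def
  proof (intro conjI allI impI)
    show "cf (a * b) (s + t) (j + i) \<noteq> 0" using a b cf by (simp add: lead_def)
    fix u l assume nz: "cf (a * b) u l \<noteq> 0"
    have "wt (s + t) (j + i) \<le> wt u l"
      using lbd_times[OF la lb] nz by (simp add: lbd_def wt_add)
    moreover have "l \<le> j + i" if "wt (s + t) (j + i) = wt u l"
    proof -
      from that have "wt u l \<le> wt s j + wt t i" by (simp add: wt_add)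
      from cf_times_nonzero[OF la lb this nz] obtain s' i' where
        "i' \<le> l" "cf a s' i' \<noteq> 0" "cf b (u - s') (l - i') \<noteq> 0" "wt s' i' = wt s j" "wt (u - s') (l - i') = wt t i"
        by metis
      with le le' have "i' \<le> j" "l - i' \<le> i" by blast+
      with \<open>i' \<le> l\<close> show ?thesis by simp
    qed
    ultimately show "wt (s + t) (j + i) < wt u l \<or> wt (s + t) (j + i) = wt u l \<and> l \<le> j + i"
      by force
  qed
qed

lemma sl_times:
  assumes a: "sl a c s j" and b: "sl b d t i"
  shows "sl (a * b) (c * d) (s + t) (j + i)"
  unfolding sl_def
proof (intro conjI allI impI)
  note la = lead_lbd[OF sl_lead[OF a]] and lb = lead_lbd[OF sl_lead[OF b]]
  show "c * d \<noteq> 0" "cf (a * b) (s + t) (j + i) = c * d"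
    using a b lead_times(2)[OF sl_lead[OF a] sl_lead[OF b]] by (auto simp: sl_def)
  fix u l assume nz: "cf (a * b) u l \<noteq> 0" and ne: "(u, l) \<noteq> (s + t, j + i)"
  show "wt (s + t) (j + i) < wt u l"
  proof (rule ccontr)
    assume "\<not> wt (s + t) (j + i) < wt u l"
    then have "wt u l \<le> wt s j + wt t i" by (simp add: wt_add)
    from cf_times_nonzero[OF la lb this nz] obtain s' i' where *:
      "i' \<le> l" "cf a s' i' \<noteq> 0" "cf b (u - s') (l - i') \<noteq> 0" "wt s' i' = wt s j" "wt (u - s') (l - i') = wt t i"
      by metis
    then have "(s', i') = (s, j)" "(u - s', l - i') = (t, i)"
      using a b by (force simp: sl_def)+
    with ne * show False by auto
  qed
qed

lemma sl_one: "sl 1 1 0 0"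
  by (auto simp: sl_def cf_one)

lemma sl_rho: "sl (rho s) 1 s 0"
  by (auto simp: sl_def cf_rho)

lemma sl_scaleR: "sl b c s j \<Longrightarrow> r \<noteq> 0 \<Longrightarrow> sl (r *\<^sub>R b) (r * c) s j"
  by (auto simp: sl_def)

lemma sl_power: "sl b c s j \<Longrightarrow> sl (b ^ n) (c ^ n) (int n * s) (n * j)"
proof (induction n)
  case 0
  show ?case using sl_one by simp
next
  case (Suc n)
  from sl_times[OF Suc.prems Suc.IH[OF Suc.prems]] show ?case
    by (simp add: algebra_simps)
qed

lemma sl_lbd: "sl b c s j \<Longrightarrow> lbd (wt s j) b"
  by (intro lead_lbd sl_lead)

text \<open>Elements with the same single leading monomial are proportional modulo larger weight;
  this is the source of the residue field \<open>\<real>\<close>.\<close>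

lemma sl_diff_slb:
  assumes "sl a c s j" "sl b d s j"
  shows "slb (wt s j) (a - (c / d) *\<^sub>R b)"
  unfolding slb_def
proof (intro allI impI)
  fix t i assume nz: "cf (a - (c / d) *\<^sub>R b) t i \<noteq> 0"
  then have "(t, i) \<noteq> (s, j)" using assms by (auto simp: sl_def)
  with nz assms show "wt s j < wt t i"
    unfolding sl_def by (metis cf_simps(3,5) diff_zero mult_zero_right)
qed

end

section \<open>Integral weights and initial forms\<close>

definition iw :: "int \<Rightarrow> int \<Rightarrow> nat \<Rightarrow> int" where
  "iw H s j = - s - int j * H"

locale int_weight =
  fixes H :: int
  assumes H_pos: "H > 0"

sublocale int_weight \<subseteq> weight "iw H"
  by standard (use H_pos in \<open>auto simp: iw_def algebra_simps\<close>)

context int_weight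
begin

text \<open>The homogeneous part of weight \<open>g\<close>; the weight determines the exponent of \<open>\<rho>\<close>, so it is a polynomial in \<open>E\<close>.\<close>

definition inp :: "int \<Rightarrow> skew \<Rightarrow> real poly" where
  "inp g b = (\<Sum>j | \<exists>s. cf b s j \<noteq> 0. monom (cf b (- g - int j * H) j) j)"

lemma coeff_inp: "coeff (inp g b) j = cf b (- g - int j * H) j"
proof -
  have "{j. \<exists>s. cf b s j \<noteq> 0} \<subseteq> snd ` {(s, j). cf b s j \<noteq> 0}" by force
  then have "finite {j. \<exists>s. cf b s j \<noteq> 0}" using finite_cf[of b] by (meson finite_imageI finite_subset)
  then show ?thesis
    by (auto simp: inp_def coeff_sum if_distrib cong: if_cong)
qed

lemma inp_0 [simp]: "inp g 0 = 0"
  by (rule poly_eqI) (simp add: coeff_inp)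
lemma inp_add: "inp g (a + b) = inp g a + inp g b"
  by (rule poly_eqI) (simp add: coeff_inp)
lemma inp_diff: "inp g (a - b) = inp g a - inp g b"
  by (rule poly_eqI) (simp add: coeff_inp)
lemma inp_scaleR: "inp g (r *\<^sub>R a) = smult r (inp g a)"
  by (rule poly_eqI) (simp add: coeff_inp)
lemma inp_sum: "inp g (sum f A) = (\<Sum>i\<in>A. inp g (f i))"
  by (induction A rule: infinite_finite_induct) (auto simp: inp_add)

text \<open>Initial forms multiply like ordinary polynomials: once the degrees in \<open>E\<close>
  are fixed, the weight fixes the exponents of \<open>\<rho>\<close>, and the convolution over
  \<open>s\<close> collapses to one term.\<close>

lemma inp_times:
  assumes a: "lbd g a" and b: "lbd h b"
  shows "inp (g + h) (a * b) = inp g a * inp h b"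
proof (rule poly_eqI)
  fix l
  define u where "u = - (g + h) - int l * H"
  have "coeff (inp (g + h) (a * b)) l = cf (a * b) u l"
    by (simp add: coeff_inp u_def)
  also have "\<dots> = (\<Sum>s | part a s \<noteq> 0. \<Sum>i\<le>l. cf a s i * cf b (u - s) (l - i))"
    by (rule cf_times_le[OF a b]) (simp add: iw_def u_def)
  also have "\<dots> = (\<Sum>i\<le>l. \<Sum>s | part a s \<noteq> 0. cf a s i * cf b (u - s) (l - i))"
    by (rule sum.swap)
  also have "\<dots> = (\<Sum>i\<le>l. coeff (inp g a) i * coeff (inp h b) (l - i))"
  proof (rule sum.cong[OF refl])
    fix i assume i: "i \<in> {..l}"
    define s0 where "s0 = - g - int i * H"
    have u: "u - s0 = - h - int (l - i) * H"
      using i by (simp add: u_def s0_def of_nat_diff algebra_simps)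
    have "cf a s i * cf b (u - s) (l - i) = (if s = s0 then cf a s0 i * cf b (u - s0) (l - i) else 0)" for s
    proof (cases "cf a s i = 0 \<or> cf b (u - s) (l - i) = 0")
      case False
      then have "g \<le> iw H s i" "h \<le> iw H (u - s) (l - i)"
        using a b by (auto simp: lbd_def)
      then have "s = s0" using u by (simp add: iw_def s0_def)
      then show ?thesis by simp
    qed auto
    then have "(\<Sum>s | part a s \<noteq> 0. cf a s i * cf b (u - s) (l - i))
        = (\<Sum>s | part a s \<noteq> 0. if s = s0 then cf a s0 i * cf b (u - s0) (l - i) else 0)"
      by (intro sum.cong) auto
    also have "\<dots> = cf a s0 i * cf b (u - s0) (l - i)"
      by (auto simp: cf_def)
    finally show "(\<Sum>s | part a s \<noteq> 0. cf a s i * cf b (u - s) (l - i))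
        = coeff (inp g a) i * coeff (inp h b) (l - i)"
      unfolding coeff_inp u[symmetric] s0_def[symmetric] .
  qed
  finally show "coeff (inp (g + h) (a * b)) l = coeff (inp g a * inp h b) l"
    by (simp add: coeff_mult)
qed

lemma inp_one: "inp 0 1 = 1"
  by (rule poly_eqI) (simp add: coeff_inp cf_one)

lemma inp_of_real: "inp 0 (of_real r) = [:r:]"
  by (rule poly_eqI) (auto simp: coeff_inp cf_of_real coeff_pCons split: nat.splits)

lemma inp_power: "lbd g b \<Longrightarrow> inp (int n * g) (b ^ n) = inp g b ^ n"
proof (induction n)
  case 0
  show ?case by (simp add: inp_one)
next
  case (Suc n)
  have "inp (g + int n * g) (b * b ^ n) = inp g b * inp (int n * g) (b ^ n)"
    using lbd_power[OF Suc.prems, of n] by (intro inp_times Suc) (simp add: nmul_int)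
  with Suc show ?case by (simp add: algebra_simps)
qed

lemma inp_rho: "inp (- s) (rho s) = 1"
  by (rule poly_eqI) (use H_pos in \<open>auto simp: coeff_inp cf_rho\<close>)

lemma inp_sl: "sl b c s j \<Longrightarrow> inp (iw H s j) b = monom c j"
proof (rule poly_eqI)
  fix i assume b: "sl b c s j"
  have "cf b (- iw H s j - int i * H) i = 0" if "i \<noteq> j"
  proof (rule ccontr)
    assume "cf b (- iw H s j - int i * H) i \<noteq> 0"
    with b that have "iw H s j < iw H (- iw H s j - int i * H) i" by (auto simp: sl_def)
    then show False by (simp add: iw_def)
  qed
  with b show "coeff (inp (iw H s j) b) i = coeff (monom c j) i"
    by (auto simp: coeff_inp sl_def iw_def)
qed

lemma lbd_Suc_iff: "lbd (g + 1) b \<longleftrightarrow> lbd g b \<and> inp g b = 0"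
proof
  assume *: "lbd (g + 1) b"
  have "inp g b = 0"
  proof (rule poly_eqI)
    fix i show "coeff (inp g b) i = coeff 0 i"
      using * by (force simp: coeff_inp lbd_def iw_def)
  qed
  with * show "lbd g b \<and> inp g b = 0" using lbd_mono by force
next
  assume *: "lbd g b \<and> inp g b = 0"
  show "lbd (g + 1) b"
    unfolding lbd_def
  proof (intro allI impI)
    fix s j assume nz: "cf b s j \<noteq> 0"
    have "coeff (inp g b) j = 0" using * by simp
    then have "s \<noteq> - g - int j * H" using nz by (auto simp: coeff_inp)
    moreover have "g \<le> iw H s j" using * nz by (simp add: lbd_def)
    ultimately show "g + 1 \<le> iw H s j" by (auto simp: iw_def)
  qed
qed

text \<open>Evaluation respects congruence modulo weight 1, by Horner's scheme; the second bound
  also carries the induction for the first.\<close>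

lemma pe_cong:
  assumes "lbd 0 A" "lbd 1 B"
  shows "lbd 1 (pe P (A + B) - pe P A)" "lbd 0 (pe P A)"
proof (induction P)
  case (pCons a P)
  {
    case 1
    have "pe (pCons a P) (A + B) - pe (pCons a P) A
      = (A + B) * (pe P (A + B) - pe P A) + B * pe P A"
      by (simp add: algebra_simps)
    moreover have "lbd (0 + 1) ((A + B) * (pe P (A + B) - pe P A))"
      using assms pCons by (intro lbd_times lbd_add) (auto intro: lbd_mono)
    moreover have "lbd (1 + 0) (B * pe P A)"
      using assms pCons by (intro lbd_times) auto
    ultimately show ?case by (simp add: lbd_add)
  next
    case 2
    have "lbd (0 + 0) (A * pe P A)" using assms pCons by (intro lbd_times) auto
    then show ?case by (simp add: lbd_add lbd_of_real)
  }
qed auto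

end

section \<open>Shifts of \<open>E\<close>, ramified re-embeddings and Newton iteration\<close>

lemma pcompose_power: "pcompose (p ^ n) q = pcompose p q ^ n" for p :: "real poly"
  by (induction n) (auto simp: pcompose_mult one_pCons pcompose_pCons)

definition shift :: "real \<Rightarrow> int \<Rightarrow> skew \<Rightarrow> skew" where
  "shift c h = hm rho (En + c *\<^sub>R rho h)"

lemma alg_hom_shift: "alg_hom (shift c h)"
  unfolding shift_def
  by (rule alg_hom_hm) (auto simp: rho_mult En_rho algebra_simps)

lemma shift_rho [simp]: "shift c h (rho s) = rho s"
  by (simp add: shift_def rho_def[of s] hm_sm)

context int_weight
begin

text \<open>Because \<open>h \<le> H\<close>, the monomial \<open>\<rho>^h\<close> weighs at least
  as much as \<open>E\<close>. It enters the initial form only if the two weights agree, and then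
  the shift becomes a translation of the variable.\<close>

lemma shift_graded:
  assumes h: "h \<le> H" and b: "lbd g b"
  shows "lbd g (shift c h b)"
    and "inp g (shift c h b) = pcompose (inp g b) [:if h = H then c else 0, 1:]"
proof -
  define F where "F = En + c *\<^sub>R rho h"
  define d where "d = (if h = H then c else 0)"
  have F: "lbd (- H) F"
    using h by (auto simp: F_def lbd_def cf_En cf_rho iw_def split: if_splits)
  have Fi: "inp (- H) F = [:d, 1:]"
    by (rule poly_eqI) (auto simp: F_def coeff_inp cf_En cf_rho d_def coeff_pCons split: nat.splits)
  have En: "sl (En ^ j) 1 0 j" for j
  proof -
    have "sl En 1 0 1" by (auto simp: sl_def cf_En)
    from sl_power[OF this, of j] show ?thesis by simp
  qed
  define mon where "mon = (\<lambda>(s, j). cf b s j *\<^sub>R (rho s * En ^ j))"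
  define P where "P = {(s, j). cf b s j \<noteq> 0}"
  have bsum: "b = sum mon P" unfolding mon_def P_def by (rule skew_sum_mon)
  have mon: "lbd g (shift c h (mon (s, j))) \<and>
      inp g (shift c h (mon (s, j))) = pcompose (inp g (mon (s, j))) [:d, 1:]" if sj: "(s, j) \<in> P" for s j
  proof -
    have g: "g \<le> iw H s j" using sj b by (auto simp: P_def lbd_def)
    have sh: "shift c h (rho s * En ^ j) = rho s * F ^ j"
    proof -
      have "shift c h En = F" using hm_sm[of rho F 0 "[:0, 1:]"]
        by (simp add: shift_def F_def En_def)
      then show ?thesis by (simp add: alg_hom_mult[OF alg_hom_shift] alg_hom_power[OF alg_hom_shift])
    qed
    have l: "lbd (iw H s j) (rho s * F ^ j)"
      using lbd_times[OF sl_lbd[OF sl_rho[of s]] lbd_power[OF F, of j]] by (simp add: iw_def nmul_int)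
    have i: "inp (iw H s j) (rho s * F ^ j) = [:d, 1:] ^ j"
      using inp_times[OF sl_lbd[OF sl_rho[of s]] lbd_power[OF F, of j]] inp_power[OF F, of j] inp_rho[of s]
      by (simp add: iw_def nmul_int Fi)
    have i0: "inp (iw H s j) (rho s * En ^ j) = monom 1 j"
      using inp_sl[OF sl_times[OF sl_rho[of s] En[of j]]] by simp
    have l0: "lbd (iw H s j) (rho s * En ^ j)"
      using sl_lbd[OF sl_times[OF sl_rho[of s] En[of j]]] by simp
    have "inp g (rho s * F ^ j) = pcompose (inp g (rho s * En ^ j)) [:d, 1:]"
    proof (cases "g = iw H s j")
      case True
      have "pcompose (monom 1 j) [:d, 1:] = [:d, 1:] ^ j"
        by (simp add: monom_altdef pcompose_power pcompose_pCons)
      with True i i0 show ?thesis by simp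
    next
      case False
      with g have "g + 1 \<le> iw H s j" by simp
      with l l0 have "inp g (rho s * F ^ j) = 0" "inp g (rho s * En ^ j) = 0"
        using lbd_Suc_iff lbd_mono by blast+
      then show ?thesis by simp
    qed
    with l g show ?thesis
      by (auto simp: mon_def alg_hom_scaleR[OF alg_hom_shift] sh inp_scaleR pcompose_smult
          intro!: lbd_scaleR intro: lbd_mono)
  qed
  have sh: "shift c h b = (\<Sum>x\<in>P. shift c h (mon x))"
    by (subst bsum) (simp add: alg_hom_sum[OF alg_hom_shift])
  show "lbd g (shift c h b)"
    unfolding sh using mon by (intro lbd_sum) auto
  have "inp g (shift c h b) = (\<Sum>x\<in>P. pcompose (inp g (mon x)) [:d, 1:])"
    unfolding sh inp_sum using mon by (intro sum.cong) auto
  also have "\<dots> = pcompose (inp g b) [:d, 1:]"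
    using arg_cong[OF bsum, of "inp g"] by (simp add: inp_sum pcompose_sum)
  finally show "inp g (shift c h b) = pcompose (inp g b) [:if h = H then c else 0, 1:]"
    by (simp add: d_def)
qed

end

text \<open>\<open>E\<close> is divided by \<open>e\<close> because
  \<open>E \<rho>^e = \<rho>^e (E + e)\<close>: after division the pair satisfies the original
  relation again. The factor \<open>d\<close> is a sign in the applications.\<close>

definition reembed :: "real \<Rightarrow> nat \<Rightarrow> skew \<Rightarrow> skew" where
  "reembed d e = hm (\<lambda>s. (d powi s) *\<^sub>R rho (int e * s)) ((1 / real e) *\<^sub>R En)"

lemma alg_hom_reembed:
  assumes "d \<noteq> 0" "e > 0"
  shows "alg_hom (reembed d e)"
  unfolding reembed_def
proof (rule alg_hom_hm)
  show "d powi (s + t) *\<^sub>R rho (int e * (s + t))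
      = (d powi s *\<^sub>R rho (int e * s)) * (d powi t *\<^sub>R rho (int e * t))" for s t
    using assms by (simp add: rho_mult power_int_add algebra_simps)
  show "(1 / real e) *\<^sub>R En * d powi t *\<^sub>R rho (int e * t)
      = d powi t *\<^sub>R rho (int e * t) * ((1 / real e) *\<^sub>R En + of_int t)" for t
  proof -
    have "(of_int (int e * t) :: skew) = real e *\<^sub>R of_int t"
      by (simp add: scaleR_conv_of_real)
    with assms show ?thesis by (simp add: En_rho algebra_simps)
  qed
qed simp

lemma reembed_rho: "reembed d e (rho s) = (d powi s) *\<^sub>R rho (int e * s)"
  by (simp add: reembed_def rho_def[of s])

lemma cf_reembed:
  assumes "e > 0"
  shows "cf (reembed d e b) u j =
    (if int e dvd u then d powi (u div int e) * cf b (u div int e) j / real e ^ j else 0)"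
proof -
  have pe: "pe P ((1 / real e) *\<^sub>R En) = sm 0 (pcompose P [:0, 1 / real e:])" for P
  proof -
    have "(1 / real e) *\<^sub>R En = pe [:0, 1 / real e:] En" by (simp add: of_real_def)
    moreover have "pe Q En = sm 0 Q" for Q using sm_pe[of 0 Q] by simp
    ultimately show ?thesis by (metis pe_pcompose)
  qed
  have cfp: "coeff (pcompose (part b s) [:0, 1 / real e:]) j = cf b s j / real e ^ j" for s
    by (simp add: coeff_pcompose_linear power_divide cf_def)
  have "reembed d e b = (\<Sum>s | part b s \<noteq> 0. sm (int e * s) (smult (d powi s) (pcompose (part b s) [:0, 1 / real e:])))"
    by (simp add: reembed_def hm_def pe rho_def sm_mult scaleR_sm)
  then have "cf (reembed d e b) u j
      = (\<Sum>s | part b s \<noteq> 0. if u = int e * s then d powi s * (cf b s j / real e ^ j) else 0)"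
    by (simp add: cf_sum cf_sm cfp cong: if_cong)
  also have "\<dots> = (if int e dvd u then d powi (u div int e) * cf b (u div int e) j / real e ^ j else 0)"
  proof (cases "int e dvd u")
    case True
    have "(\<Sum>s | part b s \<noteq> 0. if u = int e * s then d powi s * (cf b s j / real e ^ j) else 0)
      = (\<Sum>s | part b s \<noteq> 0. if s = u div int e then d powi s * (cf b s j / real e ^ j) else 0)"
      using True assms by (intro sum.cong) auto
    also have "\<dots> = d powi (u div int e) * cf b (u div int e) j / real e ^ j"
      by (auto simp: cf_def)
    finally show ?thesis using True by simp
  next
    case False
    then have "u \<noteq> int e * s" for s by auto
    with False show ?thesis by simp
  qed
  finally show ?thesis .
qed

context int_weight
begin

text \<open>Newton iteration at a simple root: each step kills one more coefficient of degree 0 in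
  \<open>E\<close>. In step \<open>h\<close> the weight is changed to that of \<open>H - h\<close>,
  for which \<open>x\<close> has a linear initial form whose slope is the unchanged coefficient
  \<open>coeff (inp 0 x) 1\<close>; \<open>h < H\<close> keeps this auxiliary weight
  admissible.\<close>

lemma newton:
  assumes x: "lbd 0 x" and x0: "coeff (inp 0 x) 0 = 0" and x1: "coeff (inp 0 x) 1 \<noteq> 0"
    and K: "int K < H"
  shows "\<exists>\<Phi>. alg_hom \<Phi> \<and> (\<forall>s. \<Phi> (rho s) = rho s) \<and>
    (\<forall>g b. lbd g b \<longrightarrow> lbd g (\<Phi> b) \<and> inp g (\<Phi> b) = inp g b) \<and>
    (\<forall>s \<ge> - int K. cf (\<Phi> x) s 0 = 0)"
  using K
proof (induction K)
  case 0
  have "cf x s 0 = 0" if "s \<ge> 0" for s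
  proof (cases "s = 0")
    case True
    then show ?thesis using x0 by (simp add: coeff_inp)
  next
    case False
    with that x show ?thesis by (force simp: lbd_def iw_def)
  qed
  then show ?case
    by (intro exI[of _ "\<lambda>b. b"]) (auto simp: alg_hom_id)
next
  case (Suc K)
  then obtain \<Phi> where hom: "alg_hom \<Phi>" and rho: "\<And>s. \<Phi> (rho s) = rho s"
    and gr: "\<And>g b. lbd g b \<Longrightarrow> lbd g (\<Phi> b) \<and> inp g (\<Phi> b) = inp g b"
    and z: "\<And>s. s \<ge> - int K \<Longrightarrow> cf (\<Phi> x) s 0 = 0"
    by auto
  define h where "h = int K + 1"
  define y where "y = \<Phi> x"
  define b0 where "b0 = cf y (- h) 0"
  define C where "C = cf y (- H) 1"
  have h: "0 < h" "h < H" using Suc.prems by (auto simp: h_def)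
  interpret I: int_weight "H - h" using h by unfold_locales auto
  have y: "lbd 0 y" and yi: "inp 0 y = inp 0 x" using gr[OF x] by (auto simp: y_def)
  have C: "C \<noteq> 0" using x1 yi by (metis C_def coeff_inp diff_0 minus_zero mult_1 of_nat_1)
  \<comment> \<open>Passing from \<open>H\<close> to \<open>H - h\<close> adds \<open>j * h\<close>
    to the weight of a monomial of degree \<open>j\<close>, so degrees above 1 cannot occur in
    weight \<open>h\<close>.\<close>
  have y_pos: "int j * h \<le> iw (H - h) s j" if "cf y s j \<noteq> 0" for s j
    using y that by (fastforce simp: lbd_def iw_def algebra_simps)
  have y0: "h \<le> iw (H - h) s 0" if "cf y s 0 \<noteq> 0" for s
    using z[of s] that by (cases "s \<ge> - int K") (auto simp: y_def iw_def h_def)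
  have lb: "I.lbd h y"
    unfolding I.lbd_def
  proof (intro allI impI)
    fix s j assume nz: "cf y s j \<noteq> 0"
    show "h \<le> iw (H - h) s j"
    proof (cases "j = 0")
      case False
      then have "1 * h \<le> int j * h" using h by (intro mult_right_mono) auto
      with y_pos[OF nz] show ?thesis by simp
    qed (use y0 nz in auto)
  qed
  have ip: "I.inp h y = [:b0, C:]"
  proof (rule poly_eqI)
    fix j :: nat
    consider "j = 0" | "j = 1" | "j \<ge> 2" by linarith
    then show "coeff (I.inp h y) j = coeff [:b0, C:] j"
    proof cases
      case 3
      have "cf y (- h - int j * (H - h)) j = 0"
      proof (rule ccontr)
        assume "cf y (- h - int j * (H - h)) j \<noteq> 0"
        from y_pos[OF this] have "int j * h \<le> h" by (simp add: iw_def)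
        with 3 h show False by (simp add: mult_le_cancel_right1)
      qed
      then show ?thesis using 3 by (simp add: I.coeff_inp coeff_pCons split: nat.splits)
    qed (auto simp: I.coeff_inp b0_def C_def)
  qed
  define S where "S = shift (- b0 / C) (H - h)"
  have "I.inp h (S y) = pcompose [:b0, C:] [:- b0 / C, 1:]"
    using I.shift_graded(2)[OF order.refl lb, of "- b0 / C"] by (simp add: S_def ip)
  then have "coeff (I.inp h (S y)) 0 = 0"
    using C by (simp add: pcompose_pCons)
  then have z0: "cf (S y) (- h) 0 = 0" by (simp add: I.coeff_inp)
  have lb': "I.lbd h (S y)"
    using I.shift_graded(1)[OF order.refl lb] by (simp add: S_def)
  have "cf (S y) s 0 = 0" if "s \<ge> - h" for s
  proof (cases "s = - h")
    case False
    with that lb' show ?thesis by (force simp: I.lbd_def iw_def)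
  qed (use z0 in auto)
  moreover have "lbd g (S b) \<and> inp g (S b) = inp g b" if "lbd g b" for g b
    using shift_graded[OF _ that, of "H - h"] h by (simp add: S_def)
  moreover have "alg_hom S" "S (rho s) = rho s" for s
    by (simp_all add: S_def alg_hom_shift)
  ultimately show ?case
    by (intro exI[of _ "\<lambda>b. S (\<Phi> b)"])
      (auto simp: alg_hom_comp hom rho gr y_def h_def)
qed

end

text \<open>At a simple root \<open>\<Omega>\<close> is a local parameter, and \<open>P\<close> is
  the truncation of the inverse power series. Each step corrects the remainder by the multiple of
  \<open>\<Omega>^J\<close> that agrees with it at \<open>r\<close>.\<close>

lemma reversion:
  fixes \<Omega> U :: "real poly"
  assumes \<Omega>: "\<Omega> = [:- r, 1:] * U" and U: "poly U r \<noteq> 0" and J: "J \<ge> 1"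
  shows "\<exists>P S. coeff P 0 = 0 \<and> [:- r, 1:] = pcompose P \<Omega> + [:- r, 1:] ^ J * S"
  using J
proof (induction J rule: nat_induct_at_least)
  case base
  show ?case by (intro exI[of _ 0] exI[of _ 1]) simp
next
  case (Suc J)
  then obtain P S where P: "coeff P 0 = 0" and eq: "[:- r, 1:] = pcompose P \<Omega> + [:- r, 1:] ^ J * S"
    by blast
  define t where "t = poly S r / poly U r ^ J"
  have "poly (S - smult t (U ^ J)) r = 0" using U by (simp add: t_def poly_power)
  then obtain S' where S': "S - smult t (U ^ J) = [:- r, 1:] * S'"
    unfolding poly_eq_0_iff_dvd by (elim dvdE)
  have "[:- r, 1:] ^ J * S = smult t (\<Omega> ^ J) + [:- r, 1:] ^ J * (S - smult t (U ^ J))"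
    by (simp only: \<Omega> power_mult_distrib) (simp only: algebra_simps mult_smult_right mult_smult_left)
  also have "\<dots> = pcompose (monom t J) \<Omega> + [:- r, 1:] ^ Suc J * S'"
    proof -
    have "pcompose (monom t J) \<Omega> = smult t (\<Omega> ^ J)"
      by (simp add: monom_altdef pcompose_smult pcompose_power pcompose_pCons)
    then show ?thesis by (simp only: S' power_Suc mult_ac)
  qed
  finally have "[:- r, 1:] = pcompose (P + monom t J) \<Omega> + [:- r, 1:] ^ Suc J * S'"
    by (subst eq) (simp add: pcompose_add)
  moreover have "coeff (P + monom t J) 0 = 0" using P Suc by simp
  ultimately show ?case by blast
qed

section \<open>The chain of approximations\<close>

text \<open>
  \<open>lv k\<close> says that \<open>\<omega>\<^sub>k\<close> exists. The indices of \<open>mm\<close>, \<open>nn\<close> and \<open>be\<close> are lowered by one: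
  they stand for \<open>m\<^sub>k\<^sub>+\<^sub>1\<close>, \<open>n\<^sub>k\<^sub>+\<^sub>1\<close> and \<open>\<beta>\<^sub>k\<^sub>+\<^sub>1\<close>.
\<close>

locale chain =
  fixes q :: "rat \<Rightarrow> 'g::linordered_ab_group_add"
    and lv :: "nat \<Rightarrow> bool" and nu :: "nat \<Rightarrow> 'g" and mm :: "nat \<Rightarrow> int" and nn :: "nat \<Rightarrow> nat"
    and be :: "nat \<Rightarrow> real"
  assumes q_add: "q (r + s) = q r + q s" and q_mono: "strict_mono q"
    and lv_0: "lv 0" and lv_Suc: "lv (Suc k) \<Longrightarrow> lv k"
    and nn_pos: "lv (Suc k) \<Longrightarrow> nn k > 0"
    and cop: "lv (Suc k) \<Longrightarrow> coprime (mm k) (int (nn k))"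
    and nu_rat: "lv (Suc k) \<Longrightarrow> nu k = q (of_int (mm k) / of_nat (nn k))"
    and be_nz: "lv (Suc k) \<Longrightarrow> be k \<noteq> 0"
    and nu_pos: "lv (Suc k) \<Longrightarrow> nu (Suc k) > 0"
    and mu_less: "lv k \<Longrightarrow> (\<Sum>i\<le>k. nu i) < q 1"
    and irr: "lv k \<Longrightarrow> \<not> lv (Suc k) \<Longrightarrow> nu k \<notin> range q"
begin

definition mu :: "nat \<Rightarrow> 'g" where "mu k = (\<Sum>i\<le>k. nu i)"

lemma mu_Suc: "mu (Suc k) = mu k + nu (Suc k)"
  by (simp add: mu_def)

lemma q_0 [simp]: "q 0 = 0"
  using q_add[of 0 0] by simp
lemma q_minus: "q (- r) = - q r"
  using q_add[of r "- r"] by (metis add.right_inverse add_left_cancel q_0)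
lemma q_diff: "q (r - s) = q r - q s"
  using q_add[of r "- s"] by (simp add: q_minus)
lemma q_less_iff [simp]: "q r < q s \<longleftrightarrow> r < s"
  using q_mono by (simp add: strict_mono_less)
lemma q_le_iff [simp]: "q r \<le> q s \<longleftrightarrow> r \<le> s"
  using q_mono by (simp add: strict_mono_less_eq)
lemma q_eq_iff [simp]: "q r = q s \<longleftrightarrow> r = s"
  using q_mono by (simp add: strict_mono_eq)
lemma q_nmul: "nmul n (q r) = q (of_nat n * r)"
  by (induction n) (auto simp: algebra_simps q_add)

lemma lv_le: "lv k \<Longrightarrow> i \<le> k \<Longrightarrow> lv i"
  by (induction k) (auto simp: le_Suc_eq dest: lv_Suc)

text \<open>\<open>M\<close> is the ramification reached so far, so \<open>\<rho>\<close> has value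
  \<open>-1/M\<close>. The value of \<open>E\<close> is \<open>v(x) + v(y)\<close> at level 0 and
  increases by \<open>nu (Suc k)\<close> in each step, which makes it
  \<open>mu k - q 1\<close>.\<close>

definition wk :: "nat \<Rightarrow> nat \<Rightarrow> int \<Rightarrow> nat \<Rightarrow> 'g" where
  "wk k M s j = q (of_int (- s) / of_nat M) + nmul j (mu k - q 1)"

lemma weight_wk: "lv k \<Longrightarrow> M > 0 \<Longrightarrow> weight (wk k M)"
proof
  assume k: "lv k" and M: "M > 0"
  show "wk k M (s + t) (i + j) = wk k M s i + wk k M t j" for s t i j
  proof -
    have "of_int (- (s + t)) / of_nat M = of_int (- s) / of_nat M + (of_int (- t) / of_nat M :: rat)"
      by (simp add: diff_divide_distrib)
    then show ?thesis unfolding wk_def by (simp only: q_add nmul_add) (simp add: algebra_simps)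
  qed
  show "wk k M 0 1 < 0" using mu_less[OF k] by (simp add: wk_def mu_def)
  show "wk k M 1 0 < 0" using M q_less_iff[of "- 1 / of_nat M" 0] by (simp add: wk_def)
qed

fun om :: "nat \<Rightarrow> skew" where
  "om 0 = rho (- 1) * En"
| "om (Suc k) = rho (mm k) * om k ^ nn k - of_real (be k)"

declare om.simps(2) [simp del]

text \<open>Words are the elements whose values are dictated by the prescribed ones. The letter
  \<open>om k\<close> is excluded, so that at level \<open>k\<close> their leading monomials are
  free of \<open>E\<close>.\<close>

inductive_set Wd :: "nat \<Rightarrow> skew set" for k where
  Wd_rho: "rho s \<in> Wd k"
| Wd_om: "i < k \<Longrightarrow> om i \<in> Wd k"
| Wd_times: "w \<in> Wd k \<Longrightarrow> w' \<in> Wd k \<Longrightarrow> w * w' \<in> Wd k"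

lemma Wd_power: "w \<in> Wd k \<Longrightarrow> w ^ n \<in> Wd k"
  using Wd_rho[of 0 k] by (induction n) (auto intro: Wd_times)

lemma Wd_mono: "w \<in> Wd k \<Longrightarrow> k \<le> l \<Longrightarrow> w \<in> Wd l"
  by (induction rule: Wd.induct) (auto intro: Wd.intros)

text \<open>
  \<open>h\<close> is a re-embedding for which \<open>wk k M\<close>, taken after \<open>h\<close>, is the \<open>k\<close>-th approximation. The last two clauses keep
  track of the sign that has to be put in front of \<open>\<rho>\<close> before an even root can be extracted.
\<close>

definition Lev :: "nat \<Rightarrow> nat \<Rightarrow> real \<Rightarrow> (skew \<Rightarrow> skew) \<Rightarrow> bool" where
  "Lev k M \<epsilon> h \<longleftrightarrow> M > 0 \<and> (\<epsilon> = 1 \<or> \<epsilon> = - 1) \<and> alg_hom h \<and>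
     (\<forall>s. h (rho s) = (\<epsilon> powi s) *\<^sub>R rho (int M * s)) \<and>
     (\<forall>i<k. \<exists>c s. weight.sl (wk k M) (h (om i)) c s 0 \<and> wk k M s 0 = nu i) \<and>
     (\<exists>C b. weight.sl (wk k M) (h (om k)) C b 1 \<and> wk k M b 1 = nu k) \<and>
     (\<forall>u. \<exists>w\<in>Wd k. \<exists>c. weight.sl (wk k M) (h w) c u 0) \<and>
     (\<forall>i<k. nn i dvd M \<and> (even (nn i) \<longrightarrow> sgn (be i) = \<epsilon>)) \<and>
     (even M \<longrightarrow> (\<exists>i<k. even (nn i)))"

lemma Lev_0: "Lev 0 1 1 (\<lambda>b. b)"
proof -
  interpret weight "wk 0 1" by (rule weight_wk[OF lv_0]) simp
  have En: "sl En 1 0 1" by (auto simp: sl_def cf_En simp del: One_nat_def)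
  have "sl (om 0) 1 (- 1) 1" using sl_times[OF sl_rho[of "- 1"] En] by simp
  moreover have "wk 0 1 (- 1) 1 = nu 0" by (simp add: wk_def mu_def)
  moreover have "\<exists>w\<in>Wd 0. \<exists>c. sl w c u 0" for u
    using sl_rho[of u] Wd_rho by blast
  ultimately show ?thesis by (auto simp: Lev_def alg_hom_id)
qed

lemma Lev_hom: "Lev k M \<epsilon> h \<Longrightarrow> alg_hom h" and Lev_M: "Lev k M \<epsilon> h \<Longrightarrow> M > 0"
  and Lev_eps: "Lev k M \<epsilon> h \<Longrightarrow> \<epsilon> = 1 \<or> \<epsilon> = - 1"
  and Lev_rho: "Lev k M \<epsilon> h \<Longrightarrow> h (rho s) = (\<epsilon> powi s) *\<^sub>R rho (int M * s)"
  and Lev_om: "Lev k M \<epsilon> h \<Longrightarrow> i < k \<Longrightarrow> \<exists>y s. weight.sl (wk k M) (h (om i)) y s 0 \<and> wk k M s 0 = nu i"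
  and Lev_omk: "Lev k M \<epsilon> h \<Longrightarrow> \<exists>y s. weight.sl (wk k M) (h (om k)) y s 1 \<and> wk k M s 1 = nu k"
  and Lev_word: "Lev k M \<epsilon> h \<Longrightarrow> \<exists>w\<in>Wd k. \<exists>y. weight.sl (wk k M) (h w) y u 0"
  unfolding Lev_def by blast+

text \<open>\<open>om k\<close> leads with degree 1, so its \<open>j\<close>-th power supplies the
  degree in \<open>E\<close>, and a word of level \<open>k\<close> adjusts the exponent of
  \<open>\<rho>\<close>.\<close>

lemma Lev_word_ex:
  assumes k: "lv k" and Lev: "Lev k M \<epsilon> h"
  shows "\<exists>w\<in>Wd (Suc k). \<exists>c. weight.sl (wk k M) (h w) c u j"
proof -
  interpret weight "wk k M" using k Lev Lev_M by (intro weight_wk) auto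
  obtain C b where C: "sl (h (om k)) C b 1" using Lev_omk[OF Lev] by blast
  obtain w y where w: "w \<in> Wd k" "sl (h w) y (u - int j * b) 0"
    using Lev_word[OF Lev] by blast
  have "w * om k ^ j \<in> Wd (Suc k)"
    by (intro Wd_times Wd_power Wd_om Wd_mono[OF w(1)]) simp_all
  moreover have "sl (h (w * om k ^ j)) (y * C ^ j) u j"
    using sl_times[OF w(2) sl_power[OF C, of j]]
    by (simp add: alg_hom_mult[OF Lev_hom[OF Lev]] alg_hom_power[OF Lev_hom[OF Lev]])
  ultimately show ?thesis by blast
qed

end

text \<open>
  \<open>\<rho> \<mapsto> d \<rho>\<^sup>e\<close> makes the values of \<open>\<omega>\<^sub>0, \<dots>, \<omega>\<^sub>k\<close> integral multiples of that of \<open>\<rho>\<close>, and the shift by \<open>c\<close>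
  is chosen such that \<open>W \<omega>\<^sub>k\<^sup>e\<close> gets the residue \<open>cW \<xi>\<close>, a simple root of the polynomial \<open>\<Omega>\<close> defined below.
\<close>

locale step = chain +
  fixes k M :: nat and \<epsilon> :: real and h :: "skew \<Rightarrow> skew" and e f :: nat and a :: int and W :: skew
    and cW C :: real and b :: int and \<xi> d c :: real
  assumes lvS: "lv (Suc k)" and Lev: "Lev k M \<epsilon> h"
    and e_pos: "e > 0" and nef: "nn k = e * f" and aM: "a * int f = int M * mm k" and cop_ae: "coprime a (int e)"
    and W: "W \<in> Wd k" and slW: "weight.sl (wk k M) (h W) cW a 0"
    and slC: "weight.sl (wk k M) (h (om k)) C b 1" and wkb: "wk k M b 1 = nu k"
    and \<xi>: "\<xi> \<noteq> 0" "\<epsilon> powi mm k * \<xi> ^ f = be k"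
    and d: "d = 1 \<or> d = - 1" and c: "d powi a * (C * (d powi b) / real e * c) ^ e = \<xi>"
begin

definition M' :: nat where "M' = e * M"
text \<open>In units of \<open>1/M'\<close> the value of \<open>E\<close> at level \<open>k\<close>
  is \<open>-H\<close>; this follows from comparing the leading monomial of \<open>om k\<close> with
  its value \<open>a/M'\<close>, see \<open>mu_H\<close>.\<close>

definition H :: int where "H = - (a + int e * b)"
definition h1 :: "skew \<Rightarrow> skew" where "h1 x = reembed d e (h x)"
definition \<epsilon>' :: real where "\<epsilon>' = \<epsilon> * d ^ M"
definition C' :: real where "C' = C * (d powi b) / real e"
abbreviation "nu' \<equiv> nu (Suc k)"

lemma M_pos: "M > 0" and eps: "\<epsilon> = 1 \<or> \<epsilon> = - 1" and hom_h: "alg_hom h"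
  and h_rho: "h (rho s) = (\<epsilon> powi s) *\<^sub>R rho (int M * s)"
  using Lev by (auto simp: Lev_def)

lemma lvk: "lv k" using lvS lv_Suc by blast

lemma M'_pos: "M' > 0" using M_pos e_pos by (simp add: M'_def)

lemma f_pos: "f > 0" using nn_pos[OF lvS] nef by (cases f) auto

lemma d_nz: "d \<noteq> 0" using d by auto
lemma d_powi: "d powi s = 1 \<or> d powi s = - 1" using d by (auto simp: power_int_def minus_one_power_iff split: if_splits)
lemma d_powi_sq: "d powi s * d powi s = 1" using d_powi[of s] by auto

lemma hom_h1: "alg_hom h1"
  unfolding h1_def using alg_hom_comp[OF alg_hom_reembed hom_h] d_nz e_pos by blast

lemma nu_a: "nu k = q (of_int a / of_nat M')"
proof -
  have "(of_int (a * int f) :: rat) = of_int (int M * mm k)" using aM by (simp only:)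
  then have "(of_int a :: rat) * of_nat f = of_nat M * of_int (mm k)" by simp
  then have "(of_int (mm k) :: rat) / of_nat (nn k) = of_int a / of_nat M'"
    using e_pos M_pos f_pos by (simp add: nef M'_def field_simps)
  then show ?thesis using nu_rat[OF lvS] by simp
qed

lemma mu_H: "mu k - q 1 = q (- of_int H / of_nat M')"
proof -
  have "nu k = q (of_int (- b) / of_nat M) + (mu k - q 1)" using wkb by (simp add: wk_def)
  then have "mu k - q 1 = q (of_int a / of_nat M' - of_int (- b) / of_nat M)"
    unfolding q_diff nu_a[symmetric] by (simp add: algebra_simps)
  moreover have "of_int a / of_nat M' - of_int (- b) / of_nat M = - of_int H / (of_nat M' :: rat)"
    using e_pos M_pos by (simp add: H_def M'_def field_simps)
  ultimately show ?thesis by simp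
qed

lemma H_pos: "H > 0"
proof -
  have "mu k - q 1 < 0" using mu_less[OF lvk] by (simp add: mu_def)
  then have "- of_int H / (of_nat M' :: rat) < 0" unfolding mu_H using q_less_iff[of _ 0] by simp
  then show ?thesis using M'_pos by (simp add: field_simps)
qed

text \<open>It implies that, within one weight, the degrees in \<open>E\<close> of an element of the
  image of \<open>h1\<close> agree modulo \<open>e\<close>.\<close>

lemma cop_He: "coprime H (int e)"
proof -
  have "gcd (int e) (b * int e + a) = gcd (int e) a" by (rule gcd_add_mult)
  moreover have "b * int e + a = - H" by (simp add: H_def)
  ultimately have "gcd (int e) (- H) = 1" using cop_ae by (simp add: gcd.commute)
  then show ?thesis by (simp add: coprime_iff_gcd_eq_1 gcd.commute)
qed

sublocale I: int_weight H by unfold_locales (rule H_pos)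
sublocale A: weight "wk k M" by (rule weight_wk[OF lvk M_pos])
sublocale B: weight "wk (Suc k) M'" by (rule weight_wk[OF lvS M'_pos])

lemma wk_iw: "wk k M u j = q (of_int (iw H (int e * u) j) / of_nat M')"
proof -
  have "wk k M u j = q (of_int (- u) / of_nat M + of_nat j * (- of_int H / of_nat M'))"
    by (simp only: wk_def mu_H q_nmul q_add)
  also have "of_int (- u) / of_nat M + of_nat j * (- of_int H / of_nat M') = of_int (iw H (int e * u) j) / (of_nat M' :: rat)"
    using e_pos M_pos by (simp add: iw_def M'_def field_simps)
  finally show ?thesis .
qed

text \<open>The next weight exceeds the integral one by \<open>nu'\<close> for each degree in
  \<open>E\<close>; this is the whole difference between consecutive approximations.\<close>

lemma wkS_iw: "wk (Suc k) M' s j = q (of_int (iw H s j) / of_nat M') + nmul j nu'"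
proof -
  have "wk (Suc k) M' s j = q (of_int (- s) / of_nat M') + nmul j (q (- of_int H / of_nat M') + nu')"
    using mu_H by (simp add: wk_def mu_Suc algebra_simps)
  also have "\<dots> = q (of_int (- s) / of_nat M' + of_nat j * (- of_int H / of_nat M')) + nmul j nu'"
    by (simp only: nmul_plus q_nmul q_add add.assoc)
  also have "of_int (- s) / of_nat M' + of_nat j * (- of_int H / of_nat M') = of_int (iw H s j) / (of_nat M' :: rat)"
    using M'_pos by (simp add: iw_def field_simps)
  finally show ?thesis .
qed

lemma rat_div_le [simp]: "of_int x / of_nat M' \<le> (of_int y / of_nat M' :: rat) \<longleftrightarrow> x \<le> y"
  using M'_pos by (simp add: divide_le_cancel)
lemma rat_div_less [simp]: "of_int x / of_nat M' < (of_int y / of_nat M' :: rat) \<longleftrightarrow> x < y"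
  using M'_pos by (simp add: divide_less_cancel)
lemma nu'_pos: "nu' > 0" by (rule nu_pos[OF lvS])

lemma nu'_less: "nu' < q (of_int H / of_nat M')"
proof -
  have "mu k + nu' < q 1" using mu_less[OF lvS] by (simp add: mu_def)
  moreover have "q 1 = mu k + q (of_int H / of_nat M')"
    using mu_H by (simp add: q_minus algebra_simps)
  ultimately show ?thesis by simp
qed

lemma cf_h1: "cf (h1 x) s j = (if int e dvd s then d powi (s div int e) * cf (h x) (s div int e) j / real e ^ j else 0)"
  unfolding h1_def by (rule cf_reembed[OF e_pos])

lemma cf_h1_mult: "cf (h1 x) (int e * u) j = d powi u * cf (h x) u j / real e ^ j"
  using e_pos by (simp add: cf_h1)

lemma cf_h1_dvd: "cf (h1 x) s j \<noteq> 0 \<Longrightarrow> int e dvd s"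
  by (auto simp: cf_h1 split: if_splits)

lemma sl_h1:
  assumes "A.sl (h x) y u j"
  shows "I.sl (h1 x) (y * d powi u / real e ^ j) (int e * u) j"
  unfolding I.sl_def
proof (intro conjI allI impI)
  show "y * d powi u / real e ^ j \<noteq> 0" "cf (h1 x) (int e * u) j = y * d powi u / real e ^ j"
    using assms d_nz e_pos by (auto simp: A.sl_def cf_h1_mult)
  fix t i assume nz: "cf (h1 x) t i \<noteq> 0" and ne: "(t, i) \<noteq> (int e * u, j)"
  then obtain v where t: "t = int e * v" using cf_h1_dvd by blast
  then have "cf (h x) v i \<noteq> 0" "(v, i) \<noteq> (u, j)" using nz ne by (auto simp: cf_h1_mult)
  then have "wk k M u j < wk k M v i" using assms by (simp add: A.sl_def)
  then show "iw H (int e * u) j < iw H t i" by (simp add: wk_iw t)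
qed

lemma lbd_h1: "A.lbd (q (of_int g / of_nat M')) (h x) \<longleftrightarrow> I.lbd g (h1 x)"
proof
  assume *: "A.lbd (q (of_int g / of_nat M')) (h x)"
  show "I.lbd g (h1 x)"
    unfolding I.lbd_def
  proof (intro allI impI)
    fix s j assume nz: "cf (h1 x) s j \<noteq> 0"
    then obtain u where s: "s = int e * u" using cf_h1_dvd by blast
    then have "cf (h x) u j \<noteq> 0" using nz by (auto simp: cf_h1_mult)
    then have "q (of_int g / of_nat M') \<le> wk k M u j" using * by (simp add: A.lbd_def)
    then show "g \<le> iw H s j" by (simp add: s wk_iw)
  qed
next
  assume *: "I.lbd g (h1 x)"
  show "A.lbd (q (of_int g / of_nat M')) (h x)"
    unfolding A.lbd_def
  proof (intro allI impI)
    fix u j assume "cf (h x) u j \<noteq> 0"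
    then have "cf (h1 x) (int e * u) j \<noteq> 0" using d_nz e_pos by (simp add: cf_h1_mult)
    then have "g \<le> iw H (int e * u) j" using * by (simp add: I.lbd_def)
    then show "q (of_int g / of_nat M') \<le> wk k M u j" by (simp add: wk_iw)
  qed
qed

lemma lead_h1:
  assumes "A.lead (h x) u j" shows "I.lead (h1 x) (int e * u) j"
  unfolding I.lead_def
proof (intro conjI allI impI)
  show "cf (h1 x) (int e * u) j \<noteq> 0"
    using assms d_nz e_pos by (auto simp: A.lead_def cf_h1_mult)
  fix t i assume nz: "cf (h1 x) t i \<noteq> 0"
  then obtain v where t: "t = int e * v" using cf_h1_dvd by blast
  then have "cf (h x) v i \<noteq> 0" using nz by (auto simp: cf_h1_mult)
  then have "wk k M u j < wk k M v i \<or> wk k M u j = wk k M v i \<and> i \<le> j"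
    using assms by (simp add: A.lead_def)
  then show "iw H (int e * u) j < iw H t i \<or> iw H (int e * u) j = iw H t i \<and> i \<le> j"
    using M'_pos by (auto simp: wk_iw t)
qed

lemma sl_C': "I.sl (h1 (om k)) C' (int e * b) 1"
  using sl_h1[OF slC] by (simp add: C'_def)

lemma sl_W1: "I.sl (h1 W) (cW * d powi a) (int e * a) 0"
  using sl_h1[OF slW] by simp

lemma C'_nz: "C' \<noteq> 0"
  using sl_C' by (simp add: I.sl_def)

lemma c': "(C' * c) ^ e = d powi a * \<xi>"
proof -
  have "d powi a * (d powi a * (C' * c) ^ e) = d powi a * \<xi>"
    using c by (simp add: C'_def)
  then show ?thesis using d_powi_sq[of a] by (simp add: mult.assoc[symmetric])
qed

lemma c_nz: "c \<noteq> 0"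
  using c' \<xi>(1) d_nz e_pos by (cases "c = 0") (auto simp: power_0_left)

lemma cW_nz: "cW \<noteq> 0" using slW by (simp add: A.sl_def)

lemma h1_rho: "h1 (rho s) = (\<epsilon>' powi s) *\<^sub>R rho (int M' * s)"
proof -
  have "d powi (int M * s) = (d ^ M) powi s" by (simp add: power_int_mult)
  then show ?thesis
    by (simp add: h1_def h_rho alg_hom_scaleR[OF alg_hom_reembed[OF d_nz e_pos]] reembed_rho
        \<epsilon>'_def power_int_mult_distrib M'_def algebra_simps)
qed

lemma eps': "\<epsilon>' = 1 \<or> \<epsilon>' = - 1"
  using eps d by (auto simp: \<epsilon>'_def minus_one_power_iff split: if_splits)

text \<open>\<open>W\<close> has value \<open>-a/M\<close> and \<open>om k\<close> has value
  \<open>a/(e * M)\<close>, so \<open>T\<close> has value 0. Its residue is the new information of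
  the step, and \<open>r\<close> is the choice made for it.\<close>

definition T :: skew where "T = W * om k ^ e"
definition r :: real where "r = cW * \<xi>"

lemma r_nz: "r \<noteq> 0" using cW_nz \<xi> by (simp add: r_def)

lemma sl_T: "I.sl (h1 T) (cW * d powi a * C' ^ e) (- int e * H) e"
proof -
  have "I.sl (h1 W * h1 (om k) ^ e) (cW * d powi a * C' ^ e) (int e * a + int e * (int e * b)) (0 + e * 1)"
    by (intro I.sl_times[OF sl_W1 I.sl_power[OF sl_C']])
  moreover have "int e * a + int e * (int e * b) = - int e * H" by (simp add: H_def algebra_simps)
  ultimately show ?thesis
    by (simp add: T_def alg_hom_mult[OF hom_h1] alg_hom_power[OF hom_h1])
qed

lemma lbd_T: "I.lbd 0 (h1 T)"
  using I.sl_lbd[OF sl_T] by (simp add: iw_def)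

lemma inp_T: "I.inp 0 (h1 T) = monom (cW * d powi a * C' ^ e) e"
  using I.inp_sl[OF sl_T] by (simp add: iw_def)

text \<open>Chosen such that \<open>pe \<Omega> T\<close> and \<open>om (Suc k)\<close> have the
  same initial form: \<open>W^f\<close> leads with \<open>cW^f \<rho>^(a * f)\<close>, where
  \<open>a * f = M * mm k\<close>, and \<open>h (rho (mm k))\<close> is the same power of
  \<open>\<rho>\<close> with the sign \<open>\<epsilon> powi mm k\<close>.\<close>

definition \<Omega> :: "real poly" where
  "\<Omega> = monom (\<epsilon> powi mm k / cW ^ f) f - [:be k:]"

lemma pe_Omega: "pe \<Omega> x = (\<epsilon> powi mm k / cW ^ f) *\<^sub>R x ^ f - of_real (be k)"
  by (simp add: \<Omega>_def pe_diff monom_altdef pe_smult pe_power)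

lemma sl_rom: "I.sl (h1 (rho (mm k) * om k ^ nn k)) (\<epsilon>' powi mm k * C' ^ nn k) (- int (nn k) * H) (nn k)"
proof -
  have "I.sl (\<epsilon>' powi mm k *\<^sub>R rho (int M' * mm k) * h1 (om k) ^ nn k) (\<epsilon>' powi mm k * 1 * C' ^ nn k)
      (int M' * mm k + int (nn k) * (int e * b)) (0 + nn k * 1)"
    using eps' by (intro I.sl_times[OF I.sl_scaleR[OF I.sl_rho] I.sl_power[OF sl_C']]) auto
  moreover have "int M' * mm k + int (nn k) * (int e * b) = - int (nn k) * H"
    using aM by (simp add: H_def M'_def nef algebra_simps)
  ultimately show ?thesis
    by (simp add: alg_hom_mult[OF hom_h1] alg_hom_power[OF hom_h1] h1_rho)
qed

lemma dMm: "d powi (int M * mm k) = (d powi a) ^ f"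
  by (simp add: aM[symmetric] power_int_mult)

lemma eps'_m: "\<epsilon>' powi mm k = \<epsilon> powi mm k * (d powi a) ^ f"
proof -
  have "(d ^ M) powi mm k = d powi (int M * mm k)" by (simp add: power_int_mult)
  then show ?thesis by (simp add: \<epsilon>'_def power_int_mult_distrib dMm)
qed

lemma lbd_om': "I.lbd 0 (h1 (om (Suc k)))"
  and inp_om': "I.inp 0 (h1 (om (Suc k))) = monom (\<epsilon>' powi mm k * C' ^ nn k) (nn k) - [:be k:]"
proof -
  have *: "h1 (om (Suc k)) = h1 (rho (mm k) * om k ^ nn k) - of_real (be k)"
    by (simp add: om.simps(2) alg_hom_diff[OF hom_h1] alg_hom_of_real[OF hom_h1])
  have l: "I.lbd 0 (h1 (rho (mm k) * om k ^ nn k))"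
    using I.sl_lbd[OF sl_rom] by (simp add: iw_def)
  then show "I.lbd 0 (h1 (om (Suc k)))"
    unfolding * by (intro I.lbd_diff I.lbd_of_real)
  show "I.inp 0 (h1 (om (Suc k))) = monom (\<epsilon>' powi mm k * C' ^ nn k) (nn k) - [:be k:]"
    unfolding * I.inp_diff I.inp_of_real using I.inp_sl[OF sl_rom] by (simp add: iw_def)
qed

lemma lbd_peT: "I.lbd 0 (h1 (pe P T))"
  using I.pe_cong(2)[OF lbd_T I.lbd_0] by (simp add: alg_hom_pe[OF hom_h1])

lemma om'_Omega: "I.lbd 1 (h1 (om (Suc k) - pe \<Omega> T))"
proof -
  have i: "I.inp 0 (h1 (pe \<Omega> T)) = smult (\<epsilon> powi mm k / cW ^ f) (I.inp 0 (h1 T) ^ f) - [:be k:]"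
    using I.inp_power[OF lbd_T, of f]
    by (simp add: pe_Omega alg_hom_diff[OF hom_h1] alg_hom_scaleR[OF hom_h1] alg_hom_power[OF hom_h1]
        alg_hom_of_real[OF hom_h1] I.inp_diff I.inp_scaleR I.inp_of_real)
  have "smult (\<epsilon> powi mm k / cW ^ f) (I.inp 0 (h1 T) ^ f) = monom (\<epsilon>' powi mm k * C' ^ nn k) (nn k)"
    using cW_nz by (simp add: inp_T monom_power smult_monom eps'_m nef power_mult_distrib power_mult)
  with i have "I.inp 0 (h1 (om (Suc k) - pe \<Omega> T)) = 0"
    by (simp add: alg_hom_diff[OF hom_h1] I.inp_diff inp_om')
  moreover have "I.lbd 0 (h1 (om (Suc k) - pe \<Omega> T))"
    by (simp only: alg_hom_diff[OF hom_h1]) (intro I.lbd_diff lbd_om' lbd_peT)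
  ultimately show ?thesis using I.lbd_Suc_iff[of 0] by simp
qed

text \<open>The initial form is a binomial with constant term \<open>- be k\<close>, so its nonzero
  root \<open>c\<close> is simple. This is the hypothesis of \<open>newton\<close> after translation
  by \<open>c\<close>.\<close>

lemma om'_inp_root:
  "poly (I.inp 0 (h1 (om (Suc k)))) c = 0" "poly (pderiv (I.inp 0 (h1 (om (Suc k))))) c \<noteq> 0"
proof -
  have "(C' * c) ^ nn k = (d powi a * \<xi>) ^ f" by (simp add: nef power_mult c')
  moreover have "(d powi a) ^ f * (d powi a) ^ f = 1"
    using d_powi_sq[of a] by (simp add: power_mult_distrib[symmetric])
  ultimately have "\<epsilon>' powi mm k * (C' * c) ^ nn k = be k"
    using \<xi>(2) by (simp add: eps'_m power_mult_distrib algebra_simps)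
  then show "poly (I.inp 0 (h1 (om (Suc k)))) c = 0"
    by (simp add: inp_om' poly_monom power_mult_distrib)
  show "poly (pderiv (I.inp 0 (h1 (om (Suc k))))) c \<noteq> 0"
    using C'_nz c_nz eps' nn_pos[OF lvS] by (auto simp: inp_om' pderiv_diff pderiv_monom poly_monom pderiv_pCons)
qed

lemma coeff_pcompose_shift:
  "coeff (pcompose p [:c, 1:]) 0 = poly p c" "coeff (pcompose p [:c, 1:]) 1 = poly (pderiv p) c"
proof -
  show "coeff (pcompose p [:c, 1:]) 0 = poly p c"
    by (simp add: poly_0_coeff_0[symmetric] poly_pcompose)
  have "coeff (pcompose p [:c, 1:]) 1 = poly (pderiv (pcompose p [:c, 1:])) 0"
    by (simp add: poly_0_coeff_0 coeff_pderiv)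
  also have "\<dots> = poly (pderiv p) c"
    by (simp add: pderiv_pcompose poly_pcompose pderiv_pCons)
  finally show "coeff (pcompose p [:c, 1:]) 1 = poly (pderiv p) c" .
qed

lemma ex_Psi:
  "\<exists>\<Psi> K. alg_hom \<Psi> \<and> (\<forall>s. \<Psi> (rho s) = rho s) \<and>
    (\<forall>g x. I.lbd g x \<longrightarrow> I.lbd g (\<Psi> x) \<and> I.inp g (\<Psi> x) = pcompose (I.inp g x) [:c, 1:]) \<and>
    (\<forall>s \<ge> - int K. cf (\<Psi> (h1 (om (Suc k)))) s 0 = 0) \<and>
    nu' < q (of_int (int K + 1) / of_nat M')"
proof -
  \<comment> \<open>\<open>K\<close> is the last index below \<open>H\<close> whose value does not
    exceed \<open>nu'\<close>. If maximality is due to \<open>H\<close>, then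
    \<open>(K + 1)/M' = H/M'\<close>, which exceeds \<open>nu'\<close> by (d).\<close>
  define S where "S = {i. int i < H \<and> q (of_int (int i) / of_nat M') \<le> nu'}"
  have "S \<subseteq> {..nat H}" by (auto simp: S_def)
  then have S: "finite S" by (rule finite_subset) simp
  have "0 \<in> S" using H_pos nu'_pos by (simp add: S_def)
  define K where "K = Max S"
  have "K \<in> S" using S \<open>0 \<in> S\<close> unfolding K_def by (intro Max_in) auto
  then have K: "int K < H" by (simp add: S_def)
  have K': "nu' < q (of_int (int K + 1) / of_nat M')"
  proof (cases "int K + 1 < H")
    case True
    have "Suc K \<notin> S" using Max_ge[OF S, of "Suc K"] unfolding K_def by linarith
    with True show ?thesis by (auto simp: S_def add.commute)
  next
    case False
    with K have "int K + 1 = H" by simp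
    then show ?thesis using nu'_less by simp
  qed
  define x where "x = shift c H (h1 (om (Suc k)))"
  note sg = I.shift_graded[OF order.refl, where c = c]
  have x: "I.lbd 0 x" and xi: "I.inp 0 x = pcompose (I.inp 0 (h1 (om (Suc k)))) [:c, 1:]"
    using sg[OF lbd_om'] by (auto simp: x_def)
  have "coeff (I.inp 0 x) 0 = 0" "coeff (I.inp 0 x) 1 \<noteq> 0"
    unfolding xi coeff_pcompose_shift using om'_inp_root by auto
  from I.newton[OF x this K] obtain \<Phi> where \<Phi>: "alg_hom \<Phi>" "\<And>s. \<Phi> (rho s) = rho s"
    "\<And>g b. I.lbd g b \<Longrightarrow> I.lbd g (\<Phi> b) \<and> I.inp g (\<Phi> b) = I.inp g b"
    "\<And>s. s \<ge> - int K \<Longrightarrow> cf (\<Phi> x) s 0 = 0"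
    by blast
  show ?thesis
    using \<Phi> sg K' by (intro exI[of _ "\<lambda>b. \<Phi> (shift c H b)"] exI[of _ K])
      (auto simp: alg_hom_comp alg_hom_shift x_def)
qed

end

text \<open>
  \<open>\<Psi>\<close> is a composition of the shifts \<open>E \<mapsto> E + c\<^sub>i \<rho>\<^sup>H\<^sup>-\<^sup>i\<close> with \<open>i \<le> K\<close>; they remove those terms of \<open>\<omega>\<^sub>k\<^sub>+\<^sub>1\<close> of degree \<open>0\<close> in \<open>E\<close>
  whose value is less than the prescribed one.
\<close>

locale step2 = step +
  fixes \<Psi> :: "skew \<Rightarrow> skew" and K :: nat
  assumes hom\<Psi>: "alg_hom \<Psi>" and \<Psi>_rho: "\<Psi> (rho s) = rho s"
    and \<Psi>_lbd: "I.lbd g x \<Longrightarrow> I.lbd g (\<Psi> x)"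
    and \<Psi>_inp: "I.lbd g x \<Longrightarrow> I.inp g (\<Psi> x) = pcompose (I.inp g x) [:c, 1:]"
    and \<Psi>_om': "s \<ge> - int K \<Longrightarrow> cf (\<Psi> (h1 (om (Suc k)))) s 0 = 0"
    and nu'_K: "nu' < q (of_int (int K + 1) / of_nat M')"
begin

definition h' :: "skew \<Rightarrow> skew" where "h' x = \<Psi> (h1 x)"

lemma hom_h': "alg_hom h'"
  unfolding h'_def using alg_hom_comp[OF hom\<Psi> hom_h1] by blast

lemma h'_rho: "h' (rho s) = (\<epsilon>' powi s) *\<^sub>R rho (int M' * s)"
  by (simp add: h'_def h1_rho alg_hom_scaleR[OF hom\<Psi>] \<Psi>_rho)

lemma B_lbd: "I.lbd g x \<Longrightarrow> B.lbd (q (of_int g / of_nat M')) x"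
  unfolding B.lbd_def
proof (intro allI impI)
  fix s j assume "I.lbd g x" "cf x s j \<noteq> 0"
  then have "g \<le> iw H s j" by (simp add: I.lbd_def)
  then have "q (of_int g / of_nat M') + 0 \<le> wk (Suc k) M' s j"
    unfolding wkS_iw by (intro add_mono nmul_nonneg less_imp_le[OF nu'_pos]) simp
  then show "q (of_int g / of_nat M') \<le> wk (Suc k) M' s j" by simp
qed

lemma lbd_h': "A.lbd (q (of_int g / of_nat M')) (h x) \<Longrightarrow> I.lbd g (h' x)"
  by (simp add: lbd_h1 h'_def \<Psi>_lbd)

text \<open>Since \<open>nu' > 0\<close>, every degree in \<open>E\<close> now costs extra, and a
  nonzero constant term of the initial form outweighs all competitors.\<close>

lemma B_sl:
  assumes "I.lbd g x" and "coeff (I.inp g x) 0 \<noteq> 0"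
  shows "B.sl x (coeff (I.inp g x) 0) (- g) 0" "wk (Suc k) M' (- g) 0 = q (of_int g / of_nat M')"
proof -
  show w: "wk (Suc k) M' (- g) 0 = q (of_int g / of_nat M')" by (simp add: wk_def)
  show "B.sl x (coeff (I.inp g x) 0) (- g) 0"
    unfolding B.sl_def w
  proof (intro conjI allI impI)
    fix t i assume nz: "cf x t i \<noteq> 0" and ne: "(t, i) \<noteq> (- g, 0)"
    have g: "g \<le> iw H t i" using assms nz by (simp add: I.lbd_def)
    show "q (of_int g / of_nat M') < wk (Suc k) M' t i"
    proof (cases "i = 0")
      case True
      with ne g have "g < iw H t i" by (auto simp: iw_def)
      with True show ?thesis by (simp add: wkS_iw)
    next
      case False
      then have "0 < nmul i nu'" by (intro nmul_pos nu'_pos) simp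
      moreover have "q (of_int g / of_nat M') \<le> q (of_int (iw H t i) / of_nat M')" using g by simp
      ultimately show ?thesis unfolding wkS_iw by (metis add.right_neutral add_le_less_mono)
    qed
  qed (use assms in \<open>auto simp: I.coeff_inp\<close>)
qed

lemma inp_h': "I.lbd g (h1 x) \<Longrightarrow> coeff (I.inp g (h' x)) 0 = poly (I.inp g (h1 x)) c"
  unfolding h'_def by (subst \<Psi>_inp) (simp_all add: coeff_pcompose_shift del: One_nat_def)

text \<open>The initial form \<open>y X^j\<close> turns into \<open>y (X + c)^j\<close>, whose
  constant term does not vanish because \<open>c\<close> is nonzero.\<close>

lemma sl_h':
  assumes "I.sl (h1 x) y s j"
  shows "\<exists>y'. B.sl (h' x) y' (- iw H s j) 0"
proof -
  have "coeff (I.inp (iw H s j) (h' x)) 0 = y * c ^ j"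
    using inp_h'[OF I.sl_lbd[OF assms]] by (simp add: I.inp_sl[OF assms] poly_monom)
  moreover have "y * c ^ j \<noteq> 0" using assms c_nz by (simp add: I.sl_def)
  moreover have "I.lbd (iw H s j) (h' x)" unfolding h'_def by (intro \<Psi>_lbd I.sl_lbd[OF assms])
  ultimately show ?thesis using B_sl(1) by metis
qed

lemma wk_B_neg: "wk (Suc k) M' (- iw H (int e * u) j) 0 = wk k M u j"
  by (simp add: wk_def[of "Suc k"] wk_iw)

lemma sl_h'_h:
  assumes "A.sl (h x) y u j"
  shows "\<exists>y' s. B.sl (h' x) y' s 0 \<and> wk (Suc k) M' s 0 = wk k M u j"
  using sl_h'[OF sl_h1[OF assms]] wk_B_neg by blast

lemma lbd_h'_0: "I.lbd 0 (h' (om (Suc k)))"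
  unfolding h'_def by (intro \<Psi>_lbd lbd_om')

text \<open>In degree 0 the terms up to value \<open>K/M'\<close> are gone, in degree 1 the
  coefficient is the derivative at a simple root, and degree \<open>i\<close> costs at least
  \<open>i\<close> times \<open>nu'\<close>.\<close>

lemma sl_om': "\<exists>y. B.sl (h' (om (Suc k))) y (- H) 1" and wk_om': "wk (Suc k) M' (- H) 1 = nu'"
proof -
  let ?y = "cf (h' (om (Suc k))) (- H) 1"
  show w: "wk (Suc k) M' (- H) 1 = nu'" by (simp add: wkS_iw iw_def)
  have "?y = coeff (I.inp 0 (h' (om (Suc k)))) 1" by (simp add: I.coeff_inp)
  also have "\<dots> = poly (pderiv (I.inp 0 (h1 (om (Suc k))))) c"
    unfolding h'_def by (subst \<Psi>_inp[OF lbd_om']) (rule coeff_pcompose_shift(2))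
  finally have nz: "?y \<noteq> 0" using om'_inp_root(2) by simp
  have "B.sl (h' (om (Suc k))) ?y (- H) 1"
    unfolding B.sl_def w
  proof (intro conjI allI impI)
    fix t i assume nz: "cf (h' (om (Suc k))) t i \<noteq> 0" and ne: "(t, i) \<noteq> (- H, 1)"
    have g: "0 \<le> iw H t i" using lbd_h'_0 nz by (simp add: I.lbd_def)
    then have g0: "0 \<le> q (of_int (iw H t i) / of_nat M')"
      using q_le_iff[of 0] by simp
    consider "i = 0" | "i = 1" | "i \<ge> 2" by linarith
    then show "nu' < wk (Suc k) M' t i"
    proof cases
      case 1
      then have "t < - int K" using nz \<Psi>_om'[of t] by (force simp: h'_def)
      with 1 have "int K + 1 \<le> iw H t i" by (simp add: iw_def)
      then have "q (of_int (int K + 1) / of_nat M') \<le> q (of_int (iw H t i) / of_nat M')"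
        by (simp only: q_le_iff rat_div_le)
      with nu'_K have "nu' < q (of_int (iw H t i) / of_nat M')" by (rule order.strict_trans2)
      with 1 show ?thesis by (simp add: wkS_iw)
    next
      case 2
      with ne g have "0 < iw H t i" by (auto simp: iw_def)
      then have "0 < q (of_int (iw H t i) / of_nat M')"
        using q_less_iff[of 0] M'_pos by simp
      with 2 show ?thesis by (simp add: wkS_iw)
    next
      case 3
      then have "nmul i nu' = nu' + nmul (i - 1) nu'" by (cases i) auto
      moreover have "0 < nmul (i - 1) nu'" using 3 by (intro nmul_pos nu'_pos) simp
      ultimately have "nu' < nmul i nu'" by simp
      also have "\<dots> \<le> wk (Suc k) M' t i" using g0 by (simp add: wkS_iw)
      finally show ?thesis .
    qed
  qed (use nz in auto)
  then show "\<exists>y. B.sl (h' (om (Suc k))) y (- H) 1" by blast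
qed

lemma Lev_parity: "i < k \<Longrightarrow> nn i dvd M" "i < k \<Longrightarrow> even (nn i) \<Longrightarrow> sgn (be i) = \<epsilon>"
  "even M \<Longrightarrow> \<exists>i<k. even (nn i)"
  using Lev unfolding Lev_def by blast+

lemma Lev': "Lev (Suc k) M' \<epsilon>' h'"
  unfolding Lev_def
proof (intro conjI allI impI)
  show "M' > 0" "\<epsilon>' = 1 \<or> \<epsilon>' = - 1" "alg_hom h'" by (fact M'_pos eps' hom_h')+
  show "h' (rho s) = (\<epsilon>' powi s) *\<^sub>R rho (int M' * s)" for s by (rule h'_rho)
  show "\<exists>y s. B.sl (h' (om i)) y s 0 \<and> wk (Suc k) M' s 0 = nu i" if "i < Suc k" for i
  proof (cases "i = k")
    case True
    with sl_h'_h[OF slC] wkb show ?thesis by auto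
  next
    case False
    with that obtain y u where "A.sl (h (om i)) y u 0" "wk k M u 0 = nu i"
      using Lev_om[OF Lev, of i] by auto
    with sl_h'_h show ?thesis by metis
  qed
  show "\<exists>y b. B.sl (h' (om (Suc k))) y b 1 \<and> wk (Suc k) M' b 1 = nu'"
    using sl_om' wk_om' by blast
  show "\<exists>w\<in>Wd (Suc k). \<exists>y. B.sl (h' w) y u 0" for u
  proof -
    \<comment> \<open>Bezout: as \<open>a\<close> is prime to \<open>e\<close>, some
      \<open>l\<close> has \<open>e\<close> dividing \<open>u + l * a\<close>. It is reduced modulo
      \<open>e\<close> to be nonnegative, since it becomes the degree in \<open>E\<close> of a word
      at level \<open>k\<close>.\<close>
    obtain s l where sl: "u = int e * s - int l * a"
    proof -
      obtain x y where xy: "x * a + y * int e = 1"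
        using cop_ae bezout_coefficients_fst_snd[of a "int e"] by (metis coprime_iff_gcd_eq_1)
      define l where "l = nat ((- u * x) mod int e)"
      have l: "int l = (- u * x) mod int e" using e_pos by (simp add: l_def)
      have "(u + int l * a) mod int e = (u + (- u * x) * a) mod int e"
        unfolding l by (metis mod_add_right_eq mod_mult_left_eq)
      also have "u + (- u * x) * a = int e * (u * y)"
      proof -
        have "u * (x * a + y * int e) = u" using xy by simp
        then show ?thesis by (simp add: algebra_simps)
      qed
      finally have "int e dvd u + int l * a" by (simp add: dvd_eq_mod_eq_0)
      then obtain s where "u + int l * a = int e * s" by blast
      then show ?thesis using that[of s l] by simp
    qed
    obtain w y where w: "w \<in> Wd (Suc k)" "A.sl (h w) y (s + int l * b) l"
      using Lev_word_ex[OF lvk Lev] by blast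
    have "- iw H (int e * (s + int l * b)) l = u"
      by (simp add: iw_def H_def sl algebra_simps)
    with sl_h'[OF sl_h1[OF w(2)]] w(1) show ?thesis by auto
  qed
  fix i assume i: "i < Suc k"
  show "nn i dvd M'"
  proof (cases "i = k")
    case True
    have "coprime (int (nn k)) (mm k)" using cop[OF lvS] by (simp add: coprime_commute)
    \<comment> \<open>\<open>M' * mm k = e * (a * f) = a * nn k\<close>.\<close>
    moreover have "int (nn k) dvd int M' * mm k"
      using aM by (simp add: nef M'_def) (metis dvd_triv_left mult.assoc mult.commute)
    ultimately have "int (nn k) dvd int M'" by (simp add: coprime_dvd_mult_left_iff)
    with True show ?thesis by simp
  next
    case False
    with i Lev_parity(1)[of i] show ?thesis by (simp add: M'_def)
  qed
  assume ev: "even (nn i)"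
  show "sgn (be i) = \<epsilon>'"
  proof (cases "i = k")
    case True
    with ev cop[OF lvS] have "odd (mm k)"
      by (metis coprime_common_divisor even_of_nat_iff odd_one)
    then have m: "\<epsilon>' powi mm k = \<epsilon>'"
      using eps' by (auto simp: power_int_minus_left_odd)
    \<comment> \<open>An even power of a nonzero real is positive, so \<open>be k\<close> inherits
      the sign \<open>\<epsilon>'\<close>.\<close>
    have "\<epsilon>' * (C' * c) ^ nn k = be k"
      using om'_inp_root(1) m by (simp add: inp_om' poly_monom power_mult_distrib)
    moreover have "(C' * c) ^ nn k > 0"
      using ev True C'_nz c_nz by (simp add: zero_less_power_eq)
    ultimately have "sgn (be k) = sgn \<epsilon>'" by (metis sgn_mult sgn_pos mult.right_neutral)
    with eps' True show ?thesis by auto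
  next
    case False
    with i ev Lev_parity(1,2)[of i] have *: "sgn (be i) = \<epsilon>" "nn i dvd M" by auto
    \<comment> \<open>\<open>d ^ M\<close> can change the sign only while \<open>M\<close> is odd,
      so the sign is frozen as soon as one \<open>nn i\<close> is even.\<close>
    with ev have "even M" by (meson dvd_trans)
    with d have "\<epsilon>' = \<epsilon>" by (auto simp: \<epsilon>'_def)
    with * show ?thesis by simp
  qed
next
  assume ev: "even M'"
  show "\<exists>i<Suc k. even (nn i)"
  proof (cases "even M")
    case True
    with Lev_parity(3) obtain i where "i < k" "even (nn i)" by blast
    then show ?thesis by (intro exI[of _ i]) auto
  next
    case False
    with ev have "even (nn k)" by (simp add: M'_def nef)
    then show ?thesis by blast
  qed
qed

end

lemma (in weight) lead_one: "lead 1 0 0"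
  using sl_lead[OF sl_one] .

lemma (in weight) lead_power: "lead b s j \<Longrightarrow> lead (b ^ n) (int n * s) (n * j)"
proof (induction n)
  case 0
  show ?case using lead_one by simp
next
  case (Suc n)
  from lead_times(1)[OF Suc.prems Suc.IH[OF Suc.prems]] show ?case
    by (simp add: algebra_simps)
qed

section \<open>Domination of an approximation by a valuation\<close>

context chain
begin

text \<open>
  \<open>pv g x\<close> stands for \<open>v x \<ge> g\<close>, where \<open>v\<close> takes at least the prescribed values at \<open>\<omega>\<^sub>0, \<dots>, \<omega>\<^sub>n\<close>.
\<close>

definition pv_ax :: "nat \<Rightarrow> ('g \<Rightarrow> skew \<Rightarrow> bool) \<Rightarrow> bool" where
  "pv_ax n pv \<longleftrightarrow> (\<forall>g h x. pv g x \<longrightarrow> h \<le> g \<longrightarrow> pv h x) \<and> (\<forall>g x y. pv g x \<longrightarrow> pv g y \<longrightarrow> pv g (x + y)) \<and>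
     (\<forall>g. pv g 0) \<and>
     (\<forall>g h x y. pv g x \<longrightarrow> pv h y \<longrightarrow> pv (g + h) (x * y)) \<and> (\<forall>r. pv 0 (of_real r)) \<and>
     (\<forall>s. pv (q (- of_int s)) (rho s)) \<and> (\<forall>i\<le>n. pv (nu i) (om i))"

lemma
  assumes "pv_ax n pv"
  shows pv_mono: "pv g x \<Longrightarrow> h \<le> g \<Longrightarrow> pv h x" and pv_add: "pv g x \<Longrightarrow> pv g y \<Longrightarrow> pv g (x + y)"
    and pv_0: "pv g 0"
    and pv_times: "pv g x \<Longrightarrow> pv h y \<Longrightarrow> pv (g + h) (x * y)" and pv_of_real: "pv 0 (of_real r)"
    and pv_rho: "pv (q (- of_int s)) (rho s)" and pv_om: "i \<le> n \<Longrightarrow> pv (nu i) (om i)"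
proof -
  note ax1 = assms[unfolded pv_ax_def]
  note ax2 = conjunct2[OF ax1] note ax3 = conjunct2[OF ax2] note ax4 = conjunct2[OF ax3]
  note ax5 = conjunct2[OF ax4] note ax6 = conjunct2[OF ax5] note ax7 = conjunct2[OF ax6]
  show "pv g x \<Longrightarrow> h \<le> g \<Longrightarrow> pv h x" by (rule conjunct1[OF ax1, rule_format])
  show "pv g x \<Longrightarrow> pv g y \<Longrightarrow> pv g (x + y)" by (rule conjunct1[OF ax2, rule_format])
  show "pv g 0" by (rule conjunct1[OF ax3, rule_format])
  show "pv g x \<Longrightarrow> pv h y \<Longrightarrow> pv (g + h) (x * y)" by (rule conjunct1[OF ax4, rule_format])
  show "pv 0 (of_real r)" by (rule conjunct1[OF ax5, rule_format])
  show "pv (q (- of_int s)) (rho s)" by (rule conjunct1[OF ax6, rule_format])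
  show "i \<le> n \<Longrightarrow> pv (nu i) (om i)" by (rule ax7[rule_format])
qed

lemma pv_scaleR:
  assumes "pv_ax n pv" "pv g x" shows "pv g (r *\<^sub>R x)"
proof -
  have "pv (0 + g) (of_real r * x)" by (rule pv_times[OF assms(1) pv_of_real[OF assms(1)] assms(2)])
  then show ?thesis by (simp add: of_real_def)
qed

lemma pv_power:
  assumes "pv_ax n pv" "pv g x" shows "pv (nmul i g) (x ^ i)"
proof (induction i)
  case 0
  show ?case using pv_of_real[OF assms(1), of 1] by simp
next
  case (Suc i)
  from pv_times[OF assms(1,2) Suc.IH] show ?case by simp
qed

lemma pv_pe:
  assumes "pv_ax n pv" "pv 0 x" shows "pv 0 (pe P x)"
proof (induction P)
  case 0
  show ?case using pv_0[OF assms(1)] by simp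
next
  case (pCons a P)
  have "pv 0 (x * pe P x)" using pv_times[OF assms pCons.IH] by simp
  from pv_add[OF assms(1) pv_of_real[OF assms(1)] this] show ?case by simp
qed

text \<open>The part of \<open>pv_ax\<close> that also holds for \<open>pv g x\<close> standing for \<open>v x = g\<close>.\<close>

definition wv_ax :: "nat \<Rightarrow> ('g \<Rightarrow> skew \<Rightarrow> bool) \<Rightarrow> bool" where
  "wv_ax n pv \<longleftrightarrow> (\<forall>g h x y. pv g x \<longrightarrow> pv h y \<longrightarrow> pv (g + h) (x * y)) \<and>
     (\<forall>s. pv (q (- of_int s)) (rho s)) \<and> (\<forall>i\<le>n. pv (nu i) (om i))"

lemma pv_ax_wv_ax:
  assumes "pv_ax n pv" shows "wv_ax n pv"
  unfolding wv_ax_def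
proof (intro conjI allI impI)
  show "pv (g + h) (x * y)" if "pv g x" "pv h y" for g h x y
    by (rule pv_times[OF assms that])
qed (rule pv_rho[OF assms] pv_om[OF assms]; assumption?)+

lemma
  assumes "wv_ax n pv"
  shows wv_times: "pv g x \<Longrightarrow> pv h y \<Longrightarrow> pv (g + h) (x * y)"
    and wv_rho: "pv (q (- of_int s)) (rho s)" and wv_om: "i \<le> n \<Longrightarrow> pv (nu i) (om i)"
proof -
  note ax1 = assms[unfolded wv_ax_def]
  show "pv g x \<Longrightarrow> pv h y \<Longrightarrow> pv (g + h) (x * y)" by (rule conjunct1[OF ax1, rule_format])
  show "pv (q (- of_int s)) (rho s)" by (rule conjunct1[OF conjunct2[OF ax1], rule_format])
  show "i \<le> n \<Longrightarrow> pv (nu i) (om i)" by (rule conjunct2[OF conjunct2[OF ax1], rule_format])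
qed

definition Dom :: "nat \<Rightarrow> nat \<Rightarrow> (skew \<Rightarrow> skew) \<Rightarrow> ('g \<Rightarrow> skew \<Rightarrow> bool) \<Rightarrow> bool" where
  "Dom k M h pv \<longleftrightarrow> (\<forall>g x. weight.lbd (wk k M) g (h x) \<longrightarrow> pv g x)"

lemma Lev_sl_rho:
  assumes "lv k" "Lev k M \<epsilon> h"
  shows "weight.sl (wk k M) (h (rho s)) (\<epsilon> powi s) (int M * s) 0" "wk k M (int M * s) 0 = q (- of_int s)"
proof -
  interpret weight "wk k M" using assms Lev_M by (intro weight_wk) auto
  have "sl (\<epsilon> powi s *\<^sub>R rho (int M * s)) (\<epsilon> powi s * 1) (int M * s) 0"
    using Lev_eps[OF assms(2)] by (intro sl_scaleR sl_rho) auto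
  then show "sl (h (rho s)) (\<epsilon> powi s) (int M * s) 0" using assms by (simp add: Lev_rho)
  show "wk k M (int M * s) 0 = q (- of_int s)" using Lev_M[OF assms(2)] by (simp add: wk_def)
qed

text \<open>The leading monomial is found before \<open>pv\<close> is chosen, so all extensions give
  a word the same value, namely its weight.\<close>

lemma word_sl:
  assumes k: "lv k" and Lev: "Lev k M \<epsilon> h" and w: "w \<in> Wd (Suc k)"
  shows "\<exists>y s j. weight.sl (wk k M) (h w) y s j \<and> (\<forall>pv. wv_ax k pv \<longrightarrow> pv (wk k M s j) w) \<and> (w \<in> Wd k \<longrightarrow> j = 0)"
proof -
  interpret weight "wk k M" using k Lev Lev_M by (intro weight_wk) auto
  have j0: "\<exists>y s. sl (h w) y s 0" if "w \<in> Wd k" for w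
    using that
  proof (induction rule: Wd.induct)
    case (Wd_rho s)
    then show ?case using Lev_sl_rho(1)[OF k Lev] by blast
  next
    case (Wd_om i)
    then show ?case using Lev_om[OF Lev] by blast
  next
    case (Wd_times w w')
    then obtain y u y' u' where "sl (h w) y u 0" "sl (h w') y' u' 0" by blast
    from sl_times[OF this] show ?case by (auto simp: alg_hom_mult[OF Lev_hom[OF Lev]])
  qed
  have "\<exists>y s j. sl (h w) y s j \<and> (\<forall>pv. wv_ax k pv \<longrightarrow> pv (wk k M s j) w)"
    using w
  proof (induction rule: Wd.induct)
    case (Wd_rho s)
    then show ?case using Lev_sl_rho[OF k Lev] wv_rho by metis
  next
    case (Wd_om i)
    show ?case
    proof (cases "i = k")
      case True
      then show ?thesis using Lev_omk[OF Lev] wv_om by (metis order_refl)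
    next
      case False
      with Wd_om have "i < k" by simp
      then show ?thesis using Lev_om[OF Lev, of i] wv_om by (metis less_imp_le)
    qed
  next
    case (Wd_times w w')
    then obtain y u j y' u' j' where *: "sl (h w) y u j" "\<forall>pv. wv_ax k pv \<longrightarrow> pv (wk k M u j) w"
      "sl (h w') y' u' j'" "\<forall>pv. wv_ax k pv \<longrightarrow> pv (wk k M u' j') w'" by blast
    have "sl (h (w * w')) (y * y') (u + u') (j + j')"
      using sl_times[OF *(1,3)] by (simp add: alg_hom_mult[OF Lev_hom[OF Lev]])
    moreover have "\<forall>pv. wv_ax k pv \<longrightarrow> pv (wk k M (u + u') (j + j')) (w * w')"
      unfolding wt_add using *(2,4) wv_times by blast
    ultimately show ?case by blast
  qed
  then obtain y s j where 1: "sl (h w) y s j" "\<forall>pv. wv_ax k pv \<longrightarrow> pv (wk k M s j) w" by blast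
  have "j = 0" if "w \<in> Wd k"
    using j0[OF that] 1(1) lead_unique sl_lead by blast
  with 1 show ?thesis by blast
qed

lemma word_pv:
  assumes k: "lv k" and Lev: "Lev k M \<epsilon> h" and w: "w \<in> Wd (Suc k)"
    and sl: "weight.sl (wk k M) (h w) y s j" and pv: "wv_ax k pv"
  shows "pv (wk k M s j) w"
proof -
  interpret weight "wk k M" using k Lev Lev_M by (intro weight_wk) auto
  show ?thesis using word_sl[OF k Lev w] sl lead_unique sl_lead pv by metis
qed

end

context step2
begin

lemma pv_ax_Suc:
  assumes "pv_ax (Suc k) pv" shows "pv_ax k pv"
proof -
  have "\<forall>i\<le>k. pv (nu i) (om i)" using pv_om[OF assms] by simp
  with assms show ?thesis unfolding pv_ax_def by (elim conjE) (intro conjI; assumption)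
qed

text \<open>The next monomial valuation itself takes at least the prescribed values, so statements
  about all \<open>pv\<close> apply to it; in this way \<open>lbd_kappa_B\<close> follows from the
  bound on \<open>\<kappa>\<close>.\<close>

lemma pv_ax_B: "pv_ax (Suc k) (\<lambda>g x. B.lbd g (h' x))"
  unfolding pv_ax_def
proof (intro conjI allI impI)
  show "B.lbd g (h' x) \<Longrightarrow> g' \<le> g \<Longrightarrow> B.lbd g' (h' x)" for g g' x by (rule B.lbd_mono)
  show "B.lbd g (h' (x + y))" if "B.lbd g (h' x)" "B.lbd g (h' y)" for g x y
    unfolding alg_hom_add[OF hom_h'] using that by (rule B.lbd_add)
  show "B.lbd g (h' 0)" for g by (simp add: alg_hom_0[OF hom_h'])
  show "B.lbd (g + g') (h' (x * y))" if "B.lbd g (h' x)" "B.lbd g' (h' y)" for g g' x y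
    unfolding alg_hom_mult[OF hom_h'] using that by (rule B.lbd_times)
  show "B.lbd 0 (h' (of_real r))" for r
    unfolding alg_hom_of_real[OF hom_h'] by (rule B.lbd_of_real)
  show "B.lbd (q (- of_int s)) (h' (rho s))" for s
    using B.sl_lbd[OF Lev_sl_rho(1)[OF lvS Lev'], of s] Lev_sl_rho(2)[OF lvS Lev'] by simp
  show "B.lbd (nu i) (h' (om i))" if "i \<le> Suc k" for i
  proof (cases "i = Suc k")
    case True
    obtain y where "B.sl (h' (om (Suc k))) y (- H) 1" using sl_om' by blast
    from B.sl_lbd[OF this] show ?thesis using True by (simp only: wk_om')
  next
    case False
    with that have "i < Suc k" by simp
    then obtain y s where "B.sl (h' (om i)) y s 0" and w: "wk (Suc k) M' s 0 = nu i"
      using Lev_om[OF Lev'] by blast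
    from B.sl_lbd[OF this(1)] show ?thesis by (simp only: w)
  qed
qed

text \<open>The bound for \<open>T - r\<close> that is available at once: the prescribed value of
  the next \<open>\<omega>\<close>, or the gap between consecutive integral weights if that is
  smaller.\<close>

definition \<delta> where "\<delta> = min nu' (q (1 / of_nat M'))"

lemma T_word: "T \<in> Wd (Suc k)"
  unfolding T_def by (intro Wd_times Wd_power Wd_om Wd_mono[OF W]) simp_all

lemma T_A: "\<exists>y u. A.sl (h T) y u e \<and> wk k M u e = 0"
proof -
  have "A.sl (h T) (cW * C ^ e) (a + int e * b) (0 + e * 1)"
    unfolding T_def alg_hom_mult[OF hom_h] alg_hom_power[OF hom_h]
    by (intro A.sl_times A.sl_power slW slC)
  moreover have "wk k M (a + int e * b) (0 + e * 1) = 0"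
  proof -
    have "iw H (int e * (a + int e * b)) (0 + e * 1) = 0" by (simp add: iw_def H_def algebra_simps)
    then show ?thesis unfolding wk_iw by simp
  qed
  ultimately show ?thesis by auto
qed

lemma pv_T:
  assumes "pv_ax (Suc k) pv" shows "pv 0 T"
proof -
  obtain y u where "A.sl (h T) y u e" "wk k M u e = 0" using T_A by blast
  then show ?thesis using word_pv[OF lvk Lev T_word _ pv_ax_wv_ax[OF pv_ax_Suc[OF assms]]] by metis
qed

lemma Omega_simple_root:
  obtains U where "\<Omega> = [:- r, 1:] * U" "poly U r \<noteq> 0"
proof -
  have eq: "\<epsilon> powi mm k / cW ^ f * r ^ f = be k"
    using \<xi>(2) cW_nz by (simp add: r_def power_mult_distrib)
  then have root: "poly \<Omega> r = 0" by (simp add: \<Omega>_def poly_monom)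
  then obtain U where U: "\<Omega> = [:- r, 1:] * U" unfolding poly_eq_0_iff_dvd by (elim dvdE)
  have "poly (pderiv \<Omega>) r = of_nat f * (\<epsilon> powi mm k / cW ^ f) * r ^ (f - 1)"
    by (simp add: \<Omega>_def pderiv_diff pderiv_monom poly_monom pderiv_pCons)
  also have "\<dots> \<noteq> 0" using f_pos r_nz eps cW_nz by auto
  finally have "poly (pderiv \<Omega>) r \<noteq> 0" .
  moreover have "poly (pderiv \<Omega>) r = poly U r"
    by (simp add: U pderiv_mult pderiv_pCons del: mult_pCons_left)
  ultimately have "poly U r \<noteq> 0" by simp
  with U show thesis by (rule that)
qed

text \<open>By \<open>reversion\<close>, \<open>T - r\<close> is \<open>P(\<Omega>(T))\<close> plus
  a multiple of \<open>(T - r)^J\<close>. Replacing \<open>\<Omega>(T)\<close> by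
  \<open>om (Suc k)\<close> changes only terms of integral weight at least 1, and \<open>P\<close>
  has no constant term, so the value \<open>nu'\<close> of \<open>om (Suc k)\<close> carries
  over.\<close>

lemma kappa_ex:
  "\<exists>\<kappa>. I.lbd 1 (h1 (\<kappa> - (T - of_real r))) \<and>
    (\<forall>pv. pv_ax (Suc k) pv \<longrightarrow> pv \<delta> (T - of_real r) \<longrightarrow> pv nu' \<kappa>)"
proof -
  obtain U where U: "\<Omega> = [:- r, 1:] * U" and Ur: "poly U r \<noteq> 0" by (rule Omega_simple_root)
  \<comment> \<open>With this exponent the remainder is negligible: \<open>J/M' = H/M'\<close>
    exceeds \<open>nu'\<close>.\<close>
  define J where "J = nat H"
  have J: "J \<ge> 1" using H_pos by (simp add: J_def)
  obtain P S where P: "coeff P 0 = 0" and PS: "[:- r, 1:] = pcompose P \<Omega> + [:- r, 1:] ^ J * S"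
    using reversion[OF U Ur J] by blast
  have Tr: "pe [:- r, 1:] T = T - of_real r" by simp
  have T: "T - of_real r = pe P (pe \<Omega> T) + (T - of_real r) ^ J * pe S T"
    using arg_cong[OF PS, of "\<lambda>p. pe p T"] by (simp only: pe_add pe_mult pe_power pe_pcompose Tr)
  define \<kappa> where "\<kappa> = pe P (om (Suc k)) + (T - of_real r) ^ J * pe S T"
  have "\<kappa> - (T - of_real r) = pe P (om (Suc k)) - pe P (pe \<Omega> T)"
    by (subst T) (simp add: \<kappa>_def)
  then have "h1 (\<kappa> - (T - of_real r)) = pe P (h1 (pe \<Omega> T) + h1 (om (Suc k) - pe \<Omega> T)) - pe P (h1 (pe \<Omega> T))"
    by (simp add: alg_hom_diff[OF hom_h1] alg_hom_pe[OF hom_h1])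
  also have "I.lbd 1 \<dots>" by (intro I.pe_cong lbd_peT om'_Omega)
  finally have 1: "I.lbd 1 (h1 (\<kappa> - (T - of_real r)))" .
  have "pv nu' \<kappa>" if pv: "pv_ax (Suc k) pv" and Tr: "pv \<delta> (T - of_real r)" for pv
  proof -
    obtain P' where P': "P = pCons 0 P'" using P by (cases P) auto
    have om0: "pv nu' (om (Suc k))" using pv_om[OF pv] by simp
    then have "pv 0 (om (Suc k))" using pv_mono[OF pv] nu'_pos by (meson less_imp_le)
    then have "pv (nu' + 0) (om (Suc k) * pe P' (om (Suc k)))"
      by (intro pv_times[OF pv] om0 pv_pe[OF pv])
    then have p1: "pv nu' (pe P (om (Suc k)))" by (simp add: P')
    have "nu' \<le> nmul J \<delta>"
    proof (cases "nu' \<le> q (1 / of_nat M')")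
      case True
      then have "nmul 1 nu' \<le> nmul J \<delta>"
        using nmul_mono_nat[OF less_imp_le[OF nu'_pos] J] by (simp add: \<delta>_def)
      then show ?thesis by simp
    next
      case False
      then have "nmul J \<delta> = q (of_nat J / of_nat M')" by (simp add: \<delta>_def q_nmul)
      also have "(of_nat J :: rat) = of_int H" using H_pos by (simp add: J_def)
      finally show ?thesis using nu'_less by simp
    qed
    moreover have "pv (nmul J \<delta> + 0) ((T - of_real r) ^ J * pe S T)"
      by (intro pv_times[OF pv] pv_power[OF pv] pv_pe[OF pv] Tr pv_T[OF pv])
    ultimately have "pv nu' ((T - of_real r) ^ J * pe S T)" using pv_mono[OF pv] by simp
    with p1 show ?thesis unfolding \<kappa>_def by (rule pv_add[OF pv])
  qed
  with 1 show ?thesis by blast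
qed

text \<open>
  An element with the same leading terms as \<open>T - r\<close>, but built from \<open>\<omega>\<^sub>k\<^sub>+\<^sub>1\<close>, so that its value is known. Powers of
  \<open>\<kappa>\<close> times words serve as a basis in which elements are expanded in the lemmas \<open>lead_coeff_B\<close> and \<open>jump\<close>.
\<close>

definition \<kappa> :: skew where
  "\<kappa> = (SOME \<kappa>. I.lbd 1 (h1 (\<kappa> - (T - of_real r))) \<and>
    (\<forall>pv. pv_ax (Suc k) pv \<longrightarrow> pv \<delta> (T - of_real r) \<longrightarrow> pv nu' \<kappa>))"

lemma kappa_T: "I.lbd 1 (h1 (\<kappa> - (T - of_real r)))"
  and kappa_pv: "pv_ax (Suc k) pv \<Longrightarrow> pv \<delta> (T - of_real r) \<Longrightarrow> pv nu' \<kappa>"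
  using someI_ex[OF kappa_ex] unfolding \<kappa>_def by blast+

lemma h1_kappa: "h1 \<kappa> = h1 T - of_real r + h1 (\<kappa> - (T - of_real r))"
  by (simp add: alg_hom_diff[OF hom_h1] alg_hom_of_real[OF hom_h1])

lemma lead_kappa: "I.lead (h1 \<kappa>) (- int e * H) e"
proof -
  let ?z = "h1 (\<kappa> - (T - of_real r))"
  have w0: "iw H (- int e * H) e = 0" by (simp add: iw_def)
  have z: "0 < iw H t i" if "cf ?z t i \<noteq> 0" for t i
    using kappa_T that by (force simp: I.lbd_def)
  show ?thesis
    unfolding I.lead_def
  proof (intro conjI allI impI)
    have "cf ?z (- int e * H) e = 0" using z w0 by force
    then show "cf (h1 \<kappa>) (- int e * H) e \<noteq> 0"
      using sl_T e_pos unfolding h1_kappa by (simp add: I.sl_def cf_of_real)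
    fix t i assume "cf (h1 \<kappa>) t i \<noteq> 0"
    then consider "cf (h1 T) t i \<noteq> 0" | "cf (of_real r) t i \<noteq> 0" | "cf ?z t i \<noteq> 0"
      unfolding h1_kappa by (metis (no_types) add_0 cf_simps(2,3) diff_0_right)
    then show "iw H (- int e * H) e < iw H t i \<or> iw H (- int e * H) e = iw H t i \<and> i \<le> e"
    proof cases
      case 1
      then show ?thesis using sl_T unfolding I.sl_def by (metis order_refl prod.inject)
    next
      case 2
      then show ?thesis using w0 by (auto simp: cf_of_real iw_def split: if_splits)
    next
      case 3
      then show ?thesis using z w0 by simp
    qed
  qed
qed

lemma lbd_kappa: "I.lbd 0 (h1 \<kappa>)"
  using I.lead_lbd[OF lead_kappa] by (simp add: iw_def)

lemma inp_kappa: "I.inp 0 (h1 \<kappa>) = monom (cW * d powi a * C' ^ e) e - [:r:]"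
  unfolding h1_kappa I.inp_add I.inp_diff I.inp_of_real inp_T
  using kappa_T I.lbd_Suc_iff[of 0] by simp

text \<open>The constant term of weight 0 is the initial form of \<open>T\<close> at
  \<open>c\<close>, which is \<open>r\<close>, and cancels. What remains has integral weight at
  least 1 or positive degree in \<open>E\<close>.\<close>

lemma T_r_B: "B.lbd \<delta> (h' (T - of_real r))"
  unfolding B.lbd_def
proof (intro allI impI)
  fix s j assume nz: "cf (h' (T - of_real r)) s j \<noteq> 0"
  have l: "I.lbd 0 (h1 (T - of_real r))"
    by (simp add: alg_hom_diff[OF hom_h1] alg_hom_of_real[OF hom_h1] I.lbd_diff lbd_T I.lbd_of_real)
  then have "I.lbd 0 (h' (T - of_real r))" unfolding h'_def by (rule \<Psi>_lbd)
  with nz have w: "0 \<le> iw H s j" by (simp add: I.lbd_def)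
  show "\<delta> \<le> wk (Suc k) M' s j"
  proof (cases "j = 0")
    case True
    have "cf (h' (T - of_real r)) 0 0 = coeff (I.inp 0 (h' (T - of_real r))) 0"
      by (simp add: I.coeff_inp)
    also have "\<dots> = poly (I.inp 0 (h1 (T - of_real r))) c" by (rule inp_h'[OF l])
    also have "\<dots> = cW * d powi a * (C' * c) ^ e - r"
      by (simp add: alg_hom_diff[OF hom_h1] alg_hom_of_real[OF hom_h1] I.inp_diff I.inp_of_real inp_T
          poly_monom power_mult_distrib)
    also have "\<dots> = 0"
      using d_powi_sq[of a] by (simp add: c' r_def)
    finally have "s \<noteq> 0" using nz True by auto
    with w True have "1 \<le> iw H s j" by (simp add: iw_def)
    then have "q (of_int 1 / of_nat M') \<le> q (of_int (iw H s j) / of_nat M')"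
      by (simp only: q_le_iff rat_div_le)
    then show ?thesis using True by (simp add: wkS_iw \<delta>_def min.coboundedI2)
  next
    case False
    then have "nmul 1 nu' \<le> nmul j nu'" using nmul_mono_nat[OF less_imp_le[OF nu'_pos], of 1 j] by simp
    moreover have "0 \<le> q (of_int (iw H s j) / of_nat M')" using w q_le_iff[of 0] by simp
    ultimately have "0 + nmul 1 nu' \<le> wk (Suc k) M' s j" unfolding wkS_iw by (intro add_mono)
    then have "nu' \<le> wk (Suc k) M' s j" by simp
    then show ?thesis by (simp add: \<delta>_def min.coboundedI1)
  qed
qed

lemma lbd_kappa_B: "B.lbd nu' (h' \<kappa>)"
  using kappa_pv[OF pv_ax_B] T_r_B by simp

text \<open>\<open>\<kappa>\<close> has degree \<open>e\<close> before the translation and degree 1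
  after it, because its initial form is a multiple of \<open>X^e\<close> minus \<open>r\<close> and
  has the simple root \<open>c\<close>.\<close>

lemma lead_kappa_B: "B.lead (h' \<kappa>) (- H) 1"
  unfolding B.lead_def wk_om'
proof (intro conjI allI impI)
  have "cf (h' \<kappa>) (- H) 1 = coeff (I.inp 0 (h' \<kappa>)) 1" by (simp add: I.coeff_inp)
  also have "\<dots> = poly (pderiv (I.inp 0 (h1 \<kappa>))) c"
    unfolding h'_def by (subst \<Psi>_inp[OF lbd_kappa]) (rule coeff_pcompose_shift(2))
  also have "\<dots> = of_nat e * (cW * d powi a * C' ^ e) * c ^ (e - 1)"
    by (simp add: inp_kappa pderiv_diff pderiv_monom poly_monom pderiv_pCons)
  also have "\<dots> \<noteq> 0" using e_pos cW_nz d_nz C'_nz c_nz by simp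
  finally show "cf (h' \<kappa>) (- H) 1 \<noteq> 0" .
  fix t i assume nz: "cf (h' \<kappa>) t i \<noteq> 0"
  have "I.lbd 0 (h' \<kappa>)" unfolding h'_def by (intro \<Psi>_lbd lbd_kappa)
  with nz have w: "0 \<le> iw H t i" by (simp add: I.lbd_def)
  have ge: "nu' \<le> wk (Suc k) M' t i" using lbd_kappa_B nz by (simp add: B.lbd_def)
  show "nu' < wk (Suc k) M' t i \<or> nu' = wk (Suc k) M' t i \<and> i \<le> 1"
  proof (cases "i \<le> 1")
    case True
    with ge show ?thesis by auto
  next
    case False
    then have "nmul i nu' = nu' + nmul (i - 1) nu'" by (cases i) auto
    moreover have "0 < nmul (i - 1) nu'" using False by (intro nmul_pos nu'_pos) simp
    ultimately have "nu' < nmul i nu'" by simp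
    moreover have "0 \<le> q (of_int (iw H t i) / of_nat M')" using w q_le_iff[of 0] by simp
    ultimately have "0 + nu' < wk (Suc k) M' t i" unfolding wkS_iw by (intro add_le_less_mono)
    then have "nu' < wk (Suc k) M' t i" by simp
    then show ?thesis ..
  qed
qed

text \<open>Division with remainder of the degree in \<open>E\<close> by \<open>e\<close>: powers of
  \<open>\<kappa>\<close> realize the quotient and a word the remainder.\<close>

lemma lift_ex:
  assumes l: "I.lead (h1 x) s j"
  shows "\<exists>w\<in>Wd (Suc k). \<exists>y u l'. A.sl (h w) y u l' \<and> iw H (int e * u) l' = iw H s j \<and>
    I.lead (h1 (w * \<kappa> ^ (j div e))) s j"
proof -
  define i where "i = j div e"
  define l where "l = j mod e"
  have j: "j = i * e + l" by (simp add: i_def l_def)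
  have "cf (h1 x) s j \<noteq> 0" using assms by (simp add: I.lead_def)
  then obtain u where u: "s = int e * u" using cf_h1_dvd by blast
  obtain w y where w: "w \<in> Wd (Suc k)" "A.sl (h w) y (u + int i * H) l" using Lev_word_ex[OF lvk Lev] by blast
  have "I.lead (h1 w * h1 \<kappa> ^ i) (int e * (u + int i * H) + int i * (- int e * H)) (l + i * e)"
    by (intro I.lead_times(1) I.lead_power lead_kappa I.sl_lead[OF sl_h1[OF w(2)]])
  then have "I.lead (h1 (w * \<kappa> ^ i)) s j"
    by (simp add: alg_hom_mult[OF hom_h1] alg_hom_power[OF hom_h1] u j algebra_simps)
  moreover have "iw H (int e * (u + int i * H)) l = iw H s j"
    by (simp add: iw_def u j algebra_simps)
  ultimately show ?thesis using w i_def by blast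
qed

lemma lift_B:
  assumes w: "A.sl (h w) y u l'" and g: "iw H (int e * u) l' = g"
  shows "B.lead (h' (w * \<kappa> ^ i)) (- g - int i * H) i"
    "wk (Suc k) M' (- g - int i * H) i = q (of_int g / of_nat M') + nmul i nu'"
proof -
  obtain y' where "B.sl (h' w) y' (- g) 0" using sl_h'[OF sl_h1[OF w]] g by auto
  from B.lead_times(1)[OF B.sl_lead[OF this] B.lead_power[OF lead_kappa_B, of i]]
  show "B.lead (h' (w * \<kappa> ^ i)) (- g - int i * H) i"
    by (simp add: alg_hom_mult[OF hom_h'] alg_hom_power[OF hom_h'])
  show "wk (Suc k) M' (- g - int i * H) i = q (of_int g / of_nat M') + nmul i nu'"
    by (simp add: wkS_iw iw_def)
qed

lemma cancel_lead:
  assumes "I.lead (h1 x) s j" "I.lead (h1 z) s j" "cf (h1 x) s j = y * cf (h1 z) s j"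
  shows "I.lbd (iw H s j) (h1 (x - y *\<^sub>R z))"
    and "I.lead (h1 (x - y *\<^sub>R z)) t i \<Longrightarrow> iw H s j < iw H t i \<or> (iw H t i = iw H s j \<and> i < j)"
proof -
  have h: "h1 (x - y *\<^sub>R z) = h1 x - y *\<^sub>R h1 z"
    by (simp add: alg_hom_diff[OF hom_h1] alg_hom_scaleR[OF hom_h1])
  show l: "I.lbd (iw H s j) (h1 (x - y *\<^sub>R z))"
    unfolding h by (intro I.lbd_diff I.lbd_scaleR I.lead_lbd assms)
  assume ti: "I.lead (h1 (x - y *\<^sub>R z)) t i"
  then have nz: "cf (h1 (x - y *\<^sub>R z)) t i \<noteq> 0" by (simp add: I.lead_def)
  then have "cf (h1 x) t i \<noteq> 0 \<or> cf (h1 z) t i \<noteq> 0" unfolding h by auto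
  then have "iw H s j < iw H t i \<or> iw H s j = iw H t i \<and> i \<le> j"
    using assms(1,2) by (auto simp: I.lead_def)
  moreover have "\<not> (iw H s j = iw H t i \<and> i = j)"
  proof
    assume "iw H s j = iw H t i \<and> i = j"
    then have "t = s" "i = j" using I.wt_eq_int_iff by auto
    with nz assms(3) show False unfolding h by simp
  qed
  ultimately show "iw H s j < iw H t i \<or> (iw H t i = iw H s j \<and> i < j)" by auto
qed

text \<open>The initial form of \<open>h1 x\<close> is a power of \<open>X\<close> times a
  polynomial in \<open>X^e\<close> of degree \<open>j div e\<close>, so it vanishes at the nonzero
  number \<open>c\<close> to order at most \<open>j div e\<close>. The induction subtracts one term
  of the expansion in powers of \<open>\<kappa>\<close> at a time.\<close>

lemma lead_coeff_B:
  "I.lead (h1 x) s j \<Longrightarrow> \<exists>i\<le>j div e. cf (h' x) (- iw H s j - int i * H) i \<noteq> 0"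
proof (induction "j div e" arbitrary: x s j rule: less_induct)
  case less
  define g where "g = iw H s j"
  define i where "i = j div e"
  obtain w y u l' where w: "w \<in> Wd (Suc k)" "A.sl (h w) y u l'" "iw H (int e * u) l' = g"
    "I.lead (h1 (w * \<kappa> ^ i)) s j"
    using lift_ex[OF less.prems] by (auto simp: g_def i_def)
  define z where "z = w * \<kappa> ^ i"
  define y0 where "y0 = cf (h1 x) s j / cf (h1 z) s j"
  have znz: "cf (h1 z) s j \<noteq> 0" using w(4) by (simp add: I.lead_def z_def)
  then have y0: "cf (h1 x) s j = y0 * cf (h1 z) s j" by (simp add: y0_def)
  then have y0_nz: "y0 \<noteq> 0" using less.prems by (auto simp: I.lead_def)
  note zl = w(4)[folded z_def]
  define x1 where "x1 = x - y0 *\<^sub>R z"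
  have hx: "cf (h' x) t m = cf (h' x1) t m + y0 * cf (h' z) t m" for t m
    by (simp add: x1_def alg_hom_diff[OF hom_h'] alg_hom_scaleR[OF hom_h'])
  note zB = lift_B[OF w(2,3), of i, folded z_def]
  have lb: "I.lbd g (h1 x1)" using cancel_lead(1)[OF less.prems zl y0] by (simp add: x1_def g_def)
  show ?case
  proof (cases "I.lbd (g + 1) (h1 x1)")
    case True
    then have "I.lbd (g + 1) (h' x1)" unfolding h'_def by (rule \<Psi>_lbd)
    then have "cf (h' x1) (- g - int i * H) i = 0" by (force simp: I.lbd_def iw_def)
    moreover have "cf (h' z) (- g - int i * H) i \<noteq> 0" using zB(1) by (simp add: B.lead_def)
    ultimately have "cf (h' x) (- g - int i * H) i \<noteq> 0" using hx y0_nz by simp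
    then show ?thesis by (intro exI[of _ i]) (simp add: g_def i_def)
  next
    case False
    then have "h1 x1 \<noteq> 0" by auto
    then obtain t m where tm: "I.lead (h1 x1) t m" using I.lead_ex by blast
    have "\<not> g + 1 \<le> iw H t m" using False I.lead_lbd[OF tm] I.lbd_mono by blast
    then have g1: "iw H t m = g" and m: "m < j"
      using cancel_lead(2)[OF less.prems zl y0, folded x1_def, OF tm] by (auto simp: g_def)
    \<comment> \<open>The exponents of \<open>\<rho>\<close> are multiples of \<open>e\<close> and
      \<open>H\<close> is prime to \<open>e\<close>, so the degrees differ by a multiple of
      \<open>e\<close> and the quotient \<open>j div e\<close> really drops.\<close>
    have "int e dvd s" "int e dvd t"
      using less.prems tm cf_h1_dvd by (auto simp: I.lead_def)
    then have "int e dvd t - s" by simp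
    also have "t - s = int (j - m) * H" using g1 m by (simp add: iw_def g_def of_nat_diff algebra_simps)
    finally have "int e dvd int (j - m)" using cop_He
      by (simp add: coprime_commute coprime_dvd_mult_left_iff)
    then have "e dvd j - m" by simp
    then obtain p where "j - m = e * p" by blast
    with m have "j = m + e * p" "p > 0" by (auto intro: gr0I)
    then have dv: "m div e < j div e" using e_pos by simp
    from less.hyps[OF dv tm] obtain i' where i': "i' \<le> m div e" "cf (h' x1) (- g - int i' * H) i' \<noteq> 0"
      by (auto simp: g1)
    \<comment> \<open>At the next level a monomial of the same integral weight but degree
      \<open>i' < i\<close> would weigh less than the leading monomial of \<open>z\<close>.\<close>
    have "cf (h' z) (- g - int i' * H) i' = 0"
    proof (rule ccontr)
      assume "cf (h' z) (- g - int i' * H) i' \<noteq> 0"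
      then have "wk (Suc k) M' (- g - int i * H) i \<le> wk (Suc k) M' (- g - int i' * H) i'"
        using B.lead_lbd[OF zB(1)] by (simp add: B.lbd_def)
      then have "nmul i nu' \<le> nmul i' nu'" by (simp add: wkS_iw iw_def)
      moreover have "nmul i nu' = nmul i' nu' + nmul (i - i') nu'"
        using nmul_add[of i' "i - i'" nu'] i' dv by (simp add: i_def)
      moreover have "0 < nmul (i - i') nu'" using i' dv by (intro nmul_pos nu'_pos) (simp add: i_def)
      ultimately show False by simp
    qed
    with i' hx have "cf (h' x) (- g - int i' * H) i' \<noteq> 0" by simp
    moreover have "i' \<le> j div e" using i' dv by simp
    ultimately show ?thesis by (auto simp: g_def)
  qed
qed

lemma h'_nz: "h x \<noteq> 0 \<Longrightarrow> h' x \<noteq> 0"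
proof -
  assume "h x \<noteq> 0"
  then obtain u j where "A.lead (h x) u j" using A.lead_ex by blast
  from lead_coeff_B[OF lead_h1[OF this]] show ?thesis by auto
qed

lemma lbd_A_B:
  assumes "A.lbd g (h x)" shows "B.lbd g (h' x)"
proof (cases "h x = 0")
  case True
  then show ?thesis
    by (simp add: h'_def h1_def alg_hom_0[OF alg_hom_reembed[OF d_nz e_pos]] alg_hom_0[OF hom\<Psi>])
next
  case False
  then obtain u j where uj: "A.lead (h x) u j" using A.lead_ex by blast
  have "A.lbd (q (of_int (iw H (int e * u) j) / of_nat M')) (h x)"
    using A.lead_lbd[OF uj] by (simp add: wk_iw)
  then have "B.lbd (wk k M u j) (h' x)" using lbd_h' B_lbd by (simp add: wk_iw)
  moreover have "g \<le> wk k M u j" using A.lbd_leadD[OF assms uj] .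
  ultimately show ?thesis by (rule B.lbd_mono)
qed

text \<open>Terms \<open>w * \<kappa>^i\<close>, whose values are under control, are subtracted
  until the integral weight reaches \<open>G\<close>; from there domination at level
  \<open>k\<close> suffices.\<close>

lemma jump:
  assumes pv: "pv_ax (Suc k) pv" and dom: "Dom k M h pv" and Tr: "pv \<delta> (T - of_real r)"
    and hinj: "\<And>x. x \<noteq> 0 \<Longrightarrow> h x \<noteq> 0"
  shows "Dom (Suc k) M' h' pv"
  unfolding Dom_def
proof (intro allI impI)
  fix G x assume G: "B.lbd G (h' x)"
  show "pv G x"
  proof (cases "x = 0")
    case True
    then show ?thesis using pv_0[OF pv] by simp
  next
    case False
    then obtain t i where "B.lead (h' x) t i" using hinj h'_nz B.lead_ex by metis
    then have "G \<le> wk (Suc k) M' t i" using B.lbd_leadD[OF G] by blast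
    also have "\<dots> \<le> q (of_int (- t) / of_nat M')"
    proof -
      have "nmul i (mu (Suc k) - q 1) \<le> nmul i 0"
        using mu_less[OF lvS] by (intro nmul_mono) (simp add: mu_def)
      then show ?thesis unfolding wk_def by simp
    qed
    \<comment> \<open>An integral ceiling for \<open>G\<close>, below which only finitely many
      weights remain to be passed.\<close>
    finally obtain K where K: "G \<le> q (of_int K / of_nat M')" by blast
    \<comment> \<open>Each subtraction raises the weight, or keeps it and lowers the degree.
      \<open>Suc j\<close> places the zero element strictly below all others.\<close>
    define meas where "meas = (\<lambda>x. if x = 0 then (0, 0) else
      (let (s, j) = (SOME (s, j). I.lead (h1 x) s j) in (nat (K - iw H s j), Suc j)))"
    have meas: "meas x = (nat (K - iw H s j), Suc j)" if "I.lead (h1 x) s j" for x s j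
    proof -
      have "x \<noteq> 0" using that I.lead_not_0 alg_hom_0[OF hom_h1] by blast
      moreover have "(SOME (s, j). I.lead (h1 x) s j) = (s, j)"
      proof (rule some_equality)
        show "case (s, j) of (s, j) \<Rightarrow> I.lead (h1 x) s j" using that by simp
        show "p = (s, j)" if "case p of (s, j) \<Rightarrow> I.lead (h1 x) s j" for p
          using that \<open>I.lead (h1 x) s j\<close> I.lead_unique by (auto split: prod.splits)
      qed
      ultimately show ?thesis by (simp add: meas_def)
    qed
    have wf: "wf (inv_image (less_than <*lex*> less_than) meas)" by (intro wf_inv_image wf_lex_prod) auto
    show ?thesis using G
    proof (induction x rule: wf_induct_rule[OF wf])
      case (1 x)
      show ?case
      proof (cases "x = 0")
        case True
        then show ?thesis using pv_0[OF pv] by simp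
      next
        case False
        then obtain u j where uj: "A.lead (h x) u j" using hinj A.lead_ex by metis
        define s where "s = int e * u"
        have sj: "I.lead (h1 x) s j" using lead_h1[OF uj] by (simp add: s_def)
        define g where "g = iw H s j"
        show ?thesis
        proof (cases "G \<le> q (of_int g / of_nat M')")
          case True
          have "A.lbd (q (of_int g / of_nat M')) (h x)"
            unfolding lbd_h1 using I.lead_lbd[OF sj] by (simp add: g_def)
          then have "pv (q (of_int g / of_nat M')) x" using dom by (simp add: Dom_def)
          then show ?thesis using True pv_mono[OF pv] by blast
        next
          case gG: False
          then have gK: "g < K" using K by (meson linorder_not_le order.trans q_le_iff rat_div_le)
          define i where "i = j div e"
          obtain w y u' l' where w: "w \<in> Wd (Suc k)" "A.sl (h w) y u' l'" "iw H (int e * u') l' = g"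
            "I.lead (h1 (w * \<kappa> ^ i)) s j"
            using lift_ex[OF sj] by (auto simp: g_def i_def)
          define z where "z = w * \<kappa> ^ i"
          define y0 where "y0 = cf (h1 x) s j / cf (h1 z) s j"
          have "cf (h1 z) s j \<noteq> 0" using w(4) by (simp add: I.lead_def z_def)
          then have y0: "cf (h1 x) s j = y0 * cf (h1 z) s j" by (simp add: y0_def)
          note zl = w(4)[folded z_def]
          \<comment> \<open>\<open>lead_coeff_B\<close> limits what \<open>x\<close> can gain at the
            next level to \<open>i\<close> times \<open>nu'\<close>, so the subtracted term, which
            gains exactly this much, reaches \<open>G\<close> as well.\<close>
          obtain i' where i': "i' \<le> i" "cf (h' x) (- g - int i' * H) i' \<noteq> 0"
            using lead_coeff_B[OF sj] by (auto simp: g_def i_def)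
          then have "G \<le> wk (Suc k) M' (- g - int i' * H) i'" using 1(2) by (simp add: B.lbd_def)
          also have "\<dots> = q (of_int g / of_nat M') + nmul i' nu'" by (simp add: wkS_iw iw_def)
          also have "\<dots> \<le> q (of_int g / of_nat M') + nmul i nu'"
            using nmul_mono_nat[OF less_imp_le[OF nu'_pos] i'(1)] by simp
          finally have Gle: "G \<le> q (of_int g / of_nat M') + nmul i nu'" .
          have "pv (q (of_int g / of_nat M')) w"
            using word_pv[OF lvk Lev w(1,2) pv_ax_wv_ax[OF pv_ax_Suc[OF pv]]] w(3) by (simp add: wk_iw)
          then have "pv (q (of_int g / of_nat M') + nmul i nu') z"
            unfolding z_def using kappa_pv[OF pv Tr] by (intro pv_times[OF pv] pv_power[OF pv])
          then have z1: "pv G (y0 *\<^sub>R z)" using Gle pv_mono[OF pv] pv_scaleR[OF pv] by blast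
          have "B.lbd (q (of_int g / of_nat M') + nmul i nu') (h' z)"
            using B.lead_lbd[OF lift_B(1)[OF w(2,3), of i]] lift_B(2)[OF w(2,3), of i] by (simp add: z_def)
          then have "B.lbd G (h' (x - y0 *\<^sub>R z))"
            using 1(2) Gle by (auto simp: alg_hom_diff[OF hom_h'] alg_hom_scaleR[OF hom_h']
                intro!: B.lbd_diff B.lbd_scaleR intro: B.lbd_mono)
          moreover have "(x - y0 *\<^sub>R z, x) \<in> inv_image (less_than <*lex*> less_than) meas"
          proof (cases "x - y0 *\<^sub>R z = 0")
            case True
            have "meas 0 = (0, 0)" by (simp add: meas_def)
            then show ?thesis unfolding in_inv_image True meas[OF sj] by auto
          next
            case False
            then obtain t0 m where "A.lead (h (x - y0 *\<^sub>R z)) t0 m" using hinj A.lead_ex by metis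
            from lead_h1[OF this] obtain t where tm: "I.lead (h1 (x - y0 *\<^sub>R z)) t m" by blast
            from cancel_lead(2)[OF sj zl y0 tm] gK show ?thesis
              using meas[OF sj] meas[OF tm] by (auto simp: g_def)
          qed
          ultimately have "pv G (x - y0 *\<^sub>R z)" using 1(1) by blast
          from pv_add[OF pv this z1] show ?thesis by simp
        qed
      qed
    qed
  qed
qed

text \<open>With \<open>j div e = 0\<close> the initial form cannot vanish at \<open>c\<close>, so a
  constant term survives the translation and the value is final.\<close>

lemma stable_next:
  assumes l: "A.lead (h x) u j" and j: "j < e \<or> j = 0"
  shows "\<exists>y s. B.sl (h' x) y s 0 \<and> wk (Suc k) M' s 0 = wk k M u j"
proof -
  define g where "g = iw H (int e * u) j"
  have sj: "I.lead (h1 x) (int e * u) j" by (rule lead_h1[OF l])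
  have "j div e = 0" using j by auto
  with lead_coeff_B[OF sj] have nz: "cf (h' x) (- g) 0 \<noteq> 0" by (auto simp: g_def)
  have "I.lbd g (h1 x)" using I.lead_lbd[OF sj] by (simp add: g_def)
  then have lb: "I.lbd g (h' x)" unfolding h'_def by (rule \<Psi>_lbd)
  have "coeff (I.inp g (h' x)) 0 \<noteq> 0" using nz by (simp add: I.coeff_inp)
  from B_sl[OF lb this] show ?thesis by (auto simp: wk_iw g_def)
qed

end

section \<open>Commutators with powers of \<open>\<rho>\<close>\<close>

lemma coeff_linear_power:
  "coeff ([:t, 1:] ^ n) n = (1::real)" "coeff ([:t, 1:] ^ Suc n) n = of_nat (Suc n) * (t::real)"
proof -
  have deg: "degree ([:t, 1:] ^ n) = n" for n by (simp add: degree_power_eq)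
  show 1: "coeff ([:t, 1:] ^ n) n = 1" for n
    using deg[of n] lead_coeff_power[of "[:t, 1:]" n] by simp
  show "coeff ([:t, 1:] ^ Suc n) n = of_nat (Suc n) * t"
  proof (induction n)
    case (Suc n)
    have "coeff ([:t, 1:] ^ Suc (Suc n)) (Suc n) = t * coeff ([:t, 1:] ^ Suc n) (Suc n) + coeff ([:t, 1:] ^ Suc n) n"
      by (subst power_Suc) (simp del: power_Suc)
    then show ?case using Suc 1[of "Suc n"] by (simp add: algebra_simps)
  qed simp
qed

lemma coeff_pshift_Suc:
  assumes "\<And>i'. i' > Suc i \<Longrightarrow> coeff P i' = 0"
  shows "coeff (pshift t P) i = coeff P i + of_nat (Suc i) * of_int t * coeff P (Suc i)"
proof -
  define R where "R = P - monom (coeff P (Suc i)) (Suc i)"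
  have R: "coeff R i' = 0" if "i' > i" for i'
    using assms[of i'] that by (cases "i' = Suc i") (auto simp: R_def)
  have P: "P = R + monom (coeff P (Suc i)) (Suc i)" by (simp add: R_def)
  have "pshift t (monom c (Suc i)) = smult c ([:of_int t, 1:] ^ Suc i)" for c
    by (simp only: pshift_def monom_altdef pcompose_smult pcompose_power) (simp add: pcompose_pCons)
  then have "coeff (pshift t P) i = coeff (pshift t R) i + coeff P (Suc i) * coeff ([:of_int t, 1:] ^ Suc i) i"
    by (subst P) (simp del: power_Suc)
  also have "coeff (pshift t R) i = coeff R i" by (rule coeff_pshift) (rule R)
  finally show ?thesis unfolding coeff_linear_power by (simp add: R_def)
qed

definition comm :: "skew \<Rightarrow> int \<Rightarrow> skew" where
  "comm b t = b * rho t - rho t * b"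

lemma part_comm: "part (comm b t) u = pshift t (part b (u - t)) - part b (u - t)"
proof -
  have "part (b * rho t) u = pshift t (part b (u - t))"
  proof (induction b rule: skew_induct)
    case (sm s P)
    show ?case by (auto simp: rho_def sm_mult part_sm)
  qed (simp add: distrib_right)
  moreover have "part (rho t * b) u = part b (u - t)"
  proof (induction b rule: skew_induct)
    case (sm s P)
    show ?case by (auto simp: rho_def sm_mult part_sm)
  qed (simp add: distrib_left)
  ultimately show ?thesis by (simp add: comm_def)
qed

lemma degree_comm:
  assumes "\<And>s. part b s \<noteq> 0 \<Longrightarrow> degree (part b s) < Suc n" and "part (comm b t) s \<noteq> 0"
  shows "degree (part (comm b t) s) < n"
proof -
  define P where "P = part b (s - t)"
  have c: "part (comm b t) s = pshift t P - P" by (simp add: part_comm P_def)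
  with assms(2) have "P \<noteq> 0" by auto
  with assms(1) have dP: "degree P \<le> n" by (force simp: P_def)
  have "coeff (pshift t P - P) i = 0" if "i \<ge> n" for i
  proof -
    have "coeff P i' = 0" if "i' > i" for i' using dP that \<open>i \<ge> n\<close> by (simp add: coeff_eq_0)
    then show ?thesis using coeff_pshift[of i P t] by simp
  qed
  then have "degree (pshift t P - P) < n \<or> pshift t P - P = 0"
    by (metis leading_coeff_0_iff linorder_not_le)
  with assms(2) c show ?thesis by auto
qed

text \<open>To leading order the commutator with \<open>\<rho>^t\<close> is
  \<open>t \<rho>^t\<close> times the derivative with respect to \<open>E\<close>; in characteristic
  0 a leading monomial of positive degree survives.\<close>

lemma (in weight) lead_comm:
  assumes b: "lead b s (Suc j)" and t: "t > 0"
  shows "lead (comm b t) (s + t) j"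
  unfolding lead_def
proof (intro conjI allI impI)
  have cf: "cf (comm b t) u i = coeff (pshift t (part b (u - t))) i - cf b (u - t) i" for u i
    by (simp add: cf_def part_comm)
  have z: "coeff (part b s) i = 0" if "i > Suc j" for i
  proof (rule ccontr)
    assume "coeff (part b s) i \<noteq> 0"
    then have "wt s (Suc j) < wt s i \<or> wt s (Suc j) = wt s i \<and> i \<le> Suc j"
      using b by (simp add: lead_def cf_def)
    with wt_less_nat[OF that, of s] that show False by auto
  qed
  have "cf (comm b t) (s + t) j = of_nat (Suc j) * of_int t * cf b s (Suc j)"
    using coeff_pshift_Suc[OF z, of j t] by (simp add: cf_def part_comm)
  then show "cf (comm b t) (s + t) j \<noteq> 0" using b t by (simp add: lead_def)
  fix u i assume nz: "cf (comm b t) u i \<noteq> 0"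
  have "\<exists>i'>i. coeff (part b (u - t)) i' \<noteq> 0"
  proof (rule ccontr)
    assume "\<not> (\<exists>i'>i. coeff (part b (u - t)) i' \<noteq> 0)"
    then have "coeff (pshift t (part b (u - t))) i = coeff (part b (u - t)) i"
      by (intro coeff_pshift) auto
    with nz show False by (simp add: cf_def part_comm)
  qed
  then obtain i' where i': "i' > i" "cf b (u - t) i' \<noteq> 0" by (auto simp: cf_def)
  then have le: "wt s (Suc j) < wt (u - t) i' \<or> wt s (Suc j) = wt (u - t) i' \<and> i' \<le> Suc j"
    using b by (simp add: lead_def)
  have eq1: "wt (s + t) j + wt 0 1 = wt s (Suc j) + wt t 0"
    using wt_add[of "s + t" 0 j 1] wt_add[of s t "Suc j" 0] by simp
  have eq2: "wt u i + wt 0 1 = wt (u - t) (Suc i) + wt t 0"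
    using wt_add[of u 0 i 1] wt_add[of "u - t" t "Suc i" 0] by simp
  have ge: "wt (u - t) i' \<le> wt (u - t) (Suc i)"
    using i' wt_less_nat[of "Suc i" i' "u - t"] by (cases "i' = Suc i") auto
  show "wt (s + t) j < wt u i \<or> wt (s + t) j = wt u i \<and> i \<le> j"
  proof (cases "wt s (Suc j) < wt (u - t) (Suc i)")
    case True
    then have "wt (s + t) j + wt 0 1 < wt u i + wt 0 1" unfolding eq1 eq2 by simp
    then show ?thesis by simp
  next
    case False
    with le ge have "wt s (Suc j) = wt (u - t) (Suc i)" "wt s (Suc j) = wt (u - t) i'" "i' \<le> Suc j" by auto
    then have "wt (s + t) j + wt 0 1 = wt u i + wt 0 1" unfolding eq1 eq2 by simp
    with i' \<open>i' \<le> Suc j\<close> show ?thesis by simp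
  qed
qed

lemma (in weight) lead_0_sl: "lead b s 0 \<Longrightarrow> sl b (cf b s 0) s 0"
  unfolding lead_def sl_def using wt_eq_int_iff by (metis le_zero_eq)

section \<open>Roots and signs for one step, and the chain of all steps\<close>

context chain
begin

text \<open>In units of \<open>1/M\<close> the value of \<open>om k\<close> is
  \<open>M * mm k / nn k\<close>. Cancelling \<open>f = gcd (nn k) M\<close> leaves the reduced
  fraction \<open>a/e\<close>, so \<open>e\<close> is the new ramification.\<close>

lemma step_data:
  assumes lvS: "lv (Suc k)" and Lev: "Lev k M \<epsilon> h"
  shows "\<exists>e f a W cW C b. e > 0 \<and> nn k = e * f \<and> a * int f = int M * mm k \<and> coprime a (int e) \<and>
    W \<in> Wd k \<and> weight.sl (wk k M) (h W) cW a 0 \<and> weight.sl (wk k M) (h (om k)) C b 1 \<and>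
    wk k M b 1 = nu k \<and> (even f \<longrightarrow> even M \<and> even (nn k) \<and> odd (mm k))"
proof -
  define f where "f = gcd (nn k) M"
  define e where "e = nn k div f"
  define a where "a = int (M div f) * mm k"
  have n: "nn k > 0" by (rule nn_pos[OF lvS])
  then have f: "f > 0" by (simp add: f_def)
  have nef: "nn k = e * f" "M = (M div f) * f" by (auto simp: e_def f_def)
  then have e: "e > 0" using n by (cases e) auto
  have aM: "a * int f = int M * mm k"
  proof -
    have "int M = int (M div f) * int f" using nef(2) by (metis of_nat_mult)
    then show ?thesis by (simp add: a_def algebra_simps)
  qed
  have "coprime e (M div f)" unfolding e_def f_def using n by (intro div_gcd_coprime) auto
  then have "coprime (int (M div f)) (int e)" by (simp add: coprime_commute)
  moreover have "coprime (mm k) (int e)"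
    using cop[OF lvS] nef(1) by simp
  ultimately have cp: "coprime a (int e)" by (simp add: a_def)
  have par: "even f \<longrightarrow> even M \<and> even (nn k) \<and> odd (mm k)"
  proof
    assume ev: "even f"
    then have "even M" "even (nn k)" by (auto simp: f_def)
    moreover from this(2) cop[OF lvS] have "odd (mm k)"
      by (metis coprime_common_divisor even_of_nat_iff odd_one)
    ultimately show "even M \<and> even (nn k) \<and> odd (mm k)" by simp
  qed
  show ?thesis using Lev_word[OF Lev, of a] Lev_omk[OF Lev] e nef(1) aM cp par by blast
qed

text \<open>For even \<open>e\<close> the coprime number \<open>a\<close> is odd, so
  \<open>d powi a = d\<close> and the choice \<open>d = sgn \<xi>\<close> leaves an even root of a
  positive number.\<close>

lemma dc_ex:
  assumes e: "e > 0" and cp: "coprime a (int e)" and \<xi>: "\<xi> \<noteq> 0" and C: "C \<noteq> 0"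
  shows "\<exists>d c. (d = 1 \<or> d = - 1) \<and> d powi a * (C * (d powi b) / real e * c) ^ e = (\<xi>::real)"
proof -
  have "\<exists>d y. (d = 1 \<or> d = - 1) \<and> d powi a * y ^ e = \<xi>"
  proof (cases "even e")
    case True
    with cp have "odd a" by (metis coprime_common_divisor even_of_nat_iff odd_one)
    then have "sgn \<xi> powi a = sgn \<xi>" using \<xi> by (auto simp: sgn_if power_int_minus_left_odd)
    moreover have "root e \<bar>\<xi>\<bar> ^ e = \<bar>\<xi>\<bar>" using e by simp
    ultimately show ?thesis using \<xi>
      by (intro exI[of _ "sgn \<xi>"] exI[of _ "root e \<bar>\<xi>\<bar>"]) (auto simp: sgn_if)
  next
    case False
    then show ?thesis by (intro exI[of _ 1] exI[of _ "root e \<xi>"]) (simp add: odd_real_root_pow)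
  qed
  then obtain d y where d: "d = 1 \<or> d = - 1" and y: "d powi a * y ^ e = \<xi>" by blast
  have "C * (d powi b) / real e \<noteq> 0" using d C e by auto
  then show ?thesis using d y
    by (intro exI[of _ d] exI[of _ "y / (C * (d powi b) / real e)"]) simp
qed

text \<open>For even \<open>f\<close> the ramification \<open>M\<close> is already even, so an
  earlier even exponent has fixed \<open>\<epsilon>\<close>. The sign hypothesis, which is condition
  (e), gives \<open>be k\<close> the same sign and makes the radicand positive.\<close>

lemma xi_ex:
  assumes lvS: "lv (Suc k)" and Lev: "Lev k M \<epsilon> h"
    and sg: "\<And>i. i < k \<Longrightarrow> even (nn i) \<Longrightarrow> even (nn k) \<Longrightarrow> sgn (be i) = sgn (be k)"
    and f: "f > 0" "even f \<Longrightarrow> even M \<and> even (nn k) \<and> odd (mm k)"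
  shows "\<exists>\<xi>. \<xi> \<noteq> 0 \<and> \<epsilon> powi mm k * \<xi> ^ f = be k"
proof -
  have eps: "\<epsilon> = 1 \<or> \<epsilon> = - 1" by (rule Lev_eps[OF Lev])
  then have "(\<epsilon> * \<epsilon>) powi mm k = 1" by auto
  then have sq: "\<epsilon> powi mm k * \<epsilon> powi mm k = 1" by (simp add: power_int_mult_distrib)
  have "\<exists>\<xi>. \<xi> ^ f = \<epsilon> powi mm k * be k"
  proof (cases "even f")
    case True
    with f have ev: "even M" "even (nn k)" "odd (mm k)" by auto
    then obtain i where "i < k" "even (nn i)" "sgn (be i) = \<epsilon>"
      using Lev unfolding Lev_def by blast
    with sg ev have "sgn (be k) = \<epsilon>" by auto
    moreover have "\<epsilon> powi mm k = \<epsilon>" using eps ev by (auto simp: power_int_minus_left_odd)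
    ultimately have "\<epsilon> powi mm k * be k > 0" using eps be_nz[OF lvS]
      by (auto simp: sgn_if split: if_splits)
    then show ?thesis using f by (intro exI[of _ "root f (\<epsilon> powi mm k * be k)"]) simp
  next
    case False
    then show ?thesis by (intro exI[of _ "root f (\<epsilon> powi mm k * be k)"]) (simp add: odd_real_root_pow)
  qed
  then obtain \<xi> where \<xi>: "\<xi> ^ f = \<epsilon> powi mm k * be k" by blast
  then have eq: "\<epsilon> powi mm k * \<xi> ^ f = be k" using sq by (simp add: mult.assoc[symmetric])
  then have "\<xi> \<noteq> 0" using be_nz[OF lvS] f by (auto simp: power_0_left)
  with eq show ?thesis by blast
qed

lemma step2_ex:
  assumes "lv (Suc k)" "Lev k M \<epsilon> h" "e > 0" "nn k = e * f" "a * int f = int M * mm k" "coprime a (int e)"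
    "W \<in> Wd k" "weight.sl (wk k M) (h W) cW a 0" "weight.sl (wk k M) (h (om k)) C b 1" "wk k M b 1 = nu k"
    and \<xi>: "\<xi> \<noteq> 0" "\<epsilon> powi mm k * \<xi> ^ f = be k"
  shows "\<exists>d c \<Psi> K. step2 q lv nu mm nn be k M \<epsilon> h e f a W cW C b \<xi> d c \<Psi> K"
proof -
  interpret weight "wk k M" using assms(1,2) lv_Suc Lev_M by (intro weight_wk) auto
  have "C \<noteq> 0" using assms(9) by (simp add: sl_def)
  from dc_ex[OF assms(3,6) \<xi>(1) this, of b] obtain d c
    where d: "d = 1 \<or> d = - 1" "d powi a * (C * (d powi b) / real e * c) ^ e = \<xi>" by blast
  interpret S: step q lv nu mm nn be k M \<epsilon> h e f a W cW C b \<xi> d c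
    by unfold_locales (use assms d in auto)
  from S.ex_Psi obtain \<Psi> K where "alg_hom \<Psi>" "\<And>s. \<Psi> (rho s) = rho s"
    "\<And>g x. S.I.lbd g x \<Longrightarrow> S.I.lbd g (\<Psi> x) \<and> S.I.inp g (\<Psi> x) = pcompose (S.I.inp g x) [:c, 1:]"
    "\<And>s. s \<ge> - int K \<Longrightarrow> cf (\<Psi> (S.h1 (om (Suc k)))) s 0 = 0"
    "nu (Suc k) < q (of_int (int K + 1) / of_nat S.M')" by blast
  then have "step2 q lv nu mm nn be k M \<epsilon> h e f a W cW C b \<xi> d c \<Psi> K"
    by unfold_locales auto
  then show ?thesis by blast
qed

definition Nxt :: "nat \<Rightarrow> nat \<Rightarrow> (skew \<Rightarrow> skew) \<Rightarrow> nat \<Rightarrow> (skew \<Rightarrow> skew) \<Rightarrow> bool" where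
  "Nxt k M h M' h' \<longleftrightarrow>
     (\<forall>g x. weight.lbd (wk k M) g (h x) \<longrightarrow> weight.lbd (wk (Suc k) M') g (h' x)) \<and>
     (\<forall>x. h x \<noteq> 0 \<longrightarrow> h' x \<noteq> 0) \<and>
     (\<exists>e>0. M' = e * M \<and> (\<forall>x u j. weight.lead (wk k M) (h x) u j \<longrightarrow> j < e \<or> j = 0 \<longrightarrow>
        (\<exists>y s. weight.sl (wk (Suc k) M') (h' x) y s 0 \<and> wk (Suc k) M' s 0 = wk k M u j)))"

lemma (in step2) Nxt: "Nxt k M h M' h'"
  unfolding Nxt_def using lbd_A_B h'_nz stable_next e_pos M'_def by blast

definition inj0 :: "(skew \<Rightarrow> skew) \<Rightarrow> bool" where
  "inj0 h \<longleftrightarrow> (\<forall>x. x \<noteq> 0 \<longrightarrow> h x \<noteq> 0)"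

text \<open>Dependent choice with an extra invariant \<open>Q\<close>. For existence any roots will
  do and \<open>Q\<close> is trivial; for uniqueness the roots must be the residues under two given
  valuations, and \<open>Q\<close> is domination by both.\<close>

lemma chain_gen:
  fixes Q :: "nat \<Rightarrow> nat \<Rightarrow> (skew \<Rightarrow> skew) \<Rightarrow> bool"
  assumes Q0: "Q 0 1 (\<lambda>b. b)"
    and step: "\<And>k M \<epsilon> h. lv (Suc k) \<Longrightarrow> Lev k M \<epsilon> h \<Longrightarrow> inj0 h \<Longrightarrow> Q k M h \<Longrightarrow>
      \<exists>M' \<epsilon>' h'. Lev (Suc k) M' \<epsilon>' h' \<and> Nxt k M h M' h' \<and> Q (Suc k) M' h'"
  shows "\<exists>Mf \<epsilon>f hf. (\<forall>k. lv k \<longrightarrow> Lev k (Mf k) (\<epsilon>f k) (hf k) \<and> inj0 (hf k) \<and> Q k (Mf k) (hf k)) \<and>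
    (\<forall>k. lv (Suc k) \<longrightarrow> Nxt k (Mf k) (hf k) (Mf (Suc k)) (hf (Suc k)))"
proof -
  define P where "P = (\<lambda>k (M, \<epsilon>, h). lv k \<longrightarrow> Lev k M \<epsilon> h \<and> inj0 h \<and> Q k M h)"
  define R where "R = (\<lambda>k (M :: nat, \<epsilon> :: real, h) (M', \<epsilon>' :: real, h'). lv (Suc k) \<longrightarrow> Nxt k M h M' h')"
  have "\<exists>F. \<forall>k. P k (F k) \<and> R k (F k) (F (Suc k))"
  proof (rule dependent_nat_choice)
    show "\<exists>x. P 0 x" using Lev_0 Q0 by (intro exI[of _ "(1, 1, \<lambda>b. b)"]) (auto simp: P_def inj0_def)
    show "\<exists>y. P (Suc k) y \<and> R k x y" if "P k x" for x k
    proof (cases "lv (Suc k)")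
      case True
      obtain M \<epsilon> h where x: "x = (M, \<epsilon>, h)" by (cases x) auto
      with that True lv_Suc have *: "Lev k M \<epsilon> h" "inj0 h" "Q k M h" by (auto simp: P_def)
      from step[OF True this] obtain M' \<epsilon>' h' where
        "Lev (Suc k) M' \<epsilon>' h'" "Nxt k M h M' h'" "Q (Suc k) M' h'" by blast
      with * show ?thesis by (intro exI[of _ "(M', \<epsilon>', h')"]) (auto simp: P_def R_def x inj0_def Nxt_def)
    next
      case False
      then show ?thesis by (auto simp: P_def R_def)
    qed
  qed
  then obtain F where F: "\<And>k. P k (F k)" "\<And>k. R k (F k) (F (Suc k))" by blast
  show ?thesis
    using F by (intro exI[of _ "\<lambda>k. fst (F k)"] exI[of _ "\<lambda>k. fst (snd (F k))"] exI[of _ "\<lambda>k. snd (snd (F k))"])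
      (auto simp: P_def R_def case_prod_beta)
qed

lemma chain_ex:
  assumes "\<And>i j. lv (Suc i) \<Longrightarrow> lv (Suc j) \<Longrightarrow> even (nn i) \<Longrightarrow> even (nn j) \<Longrightarrow> sgn (be i) = sgn (be j)"
  shows "\<exists>Mf \<epsilon>f hf. (\<forall>k. lv k \<longrightarrow> Lev k (Mf k) (\<epsilon>f k) (hf k) \<and> inj0 (hf k)) \<and>
    (\<forall>k. lv (Suc k) \<longrightarrow> Nxt k (Mf k) (hf k) (Mf (Suc k)) (hf (Suc k)))"
proof -
  have "\<exists>M' \<epsilon>' h'. Lev (Suc k) M' \<epsilon>' h' \<and> Nxt k M h M' h' \<and> True"
    if lvS: "lv (Suc k)" and Lev: "Lev k M \<epsilon> h" for k M \<epsilon> h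
  proof -
    from step_data[OF lvS Lev] obtain e f a W cW C b where D: "e > 0" "nn k = e * f"
      "a * int f = int M * mm k" "coprime a (int e)" "W \<in> Wd k" "weight.sl (wk k M) (h W) cW a 0"
      "weight.sl (wk k M) (h (om k)) C b 1" "wk k M b 1 = nu k"
      and f: "even f \<longrightarrow> even M \<and> even (nn k) \<and> odd (mm k)" by blast
    have "f > 0" using nn_pos[OF lvS] D(2) by (cases f) auto
    have "sgn (be i) = sgn (be k)" if "i < k" "even (nn i)" "even (nn k)" for i
      using assms[of i k] that lvS lv_le[OF lvS, of "Suc i"] by auto
    from xi_ex[OF lvS Lev this \<open>f > 0\<close>] f obtain \<xi> where "\<xi> \<noteq> 0" "\<epsilon> powi mm k * \<xi> ^ f = be k" by blast
    from step2_ex[OF lvS Lev D this] obtain d c \<Psi> K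
      where "step2 q lv nu mm nn be k M \<epsilon> h e f a W cW C b \<xi> d c \<Psi> K" by blast
    then interpret step2 q lv nu mm nn be k M \<epsilon> h e f a W cW C b \<xi> d c \<Psi> K .
    show ?thesis using Lev' Nxt by blast
  qed
  from chain_gen[of "\<lambda>_ _ _. True", OF _ this] show ?thesis by auto
qed

end

section \<open>Stabilization of the approximations\<close>

locale levels = chain +
  fixes Mf :: "nat \<Rightarrow> nat" and \<epsilon>f :: "nat \<Rightarrow> real" and hf :: "nat \<Rightarrow> skew \<Rightarrow> skew"
  assumes Levf: "lv k \<Longrightarrow> Lev k (Mf k) (\<epsilon>f k) (hf k)" and injf: "lv k \<Longrightarrow> inj0 (hf k)"
    and Nxtf: "lv (Suc k) \<Longrightarrow> Nxt k (Mf k) (hf k) (Mf (Suc k)) (hf (Suc k))"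
begin

abbreviation wl :: "nat \<Rightarrow> int \<Rightarrow> nat \<Rightarrow> _" where "wl k \<equiv> wk k (Mf k)"

lemma weight_wl: "lv k \<Longrightarrow> weight (wl k)"
  using weight_wk Levf Lev_M by blast

text \<open>A monomial without \<open>E\<close> keeps its weight at all later levels, so \<open>g\<close> is the final value of \<open>x\<close>; nothing follows the last level.\<close>

definition Str :: "nat \<Rightarrow> skew \<Rightarrow> _ \<Rightarrow> bool" where
  "Str k x g \<longleftrightarrow> (\<exists>y s j. weight.sl (wl k) (hf k x) y s j \<and> wl k s j = g \<and> (j = 0 \<or> \<not> lv (Suc k)))"

lemma lead_hf: "lv k \<Longrightarrow> x \<noteq> 0 \<Longrightarrow> \<exists>s j. weight.lead (wl k) (hf k x) s j"
  using weight.lead_ex[OF weight_wl] injf by (simp add: inj0_def)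

lemma Str_Suc:
  assumes "Str k x g" "lv (Suc k)" shows "Str (Suc k) x g"
proof -
  interpret weight "wl k" using assms lv_Suc by (intro weight_wl) auto
  from assms obtain y s where "sl (hf k x) y s 0" "wl k s 0 = g" by (auto simp: Str_def)
  then have "lead (hf k x) s 0" "wl k s 0 = g" by (auto simp: sl_lead)
  with Nxtf[OF assms(2)] show ?thesis unfolding Nxt_def Str_def by metis
qed

lemma Str_mono:
  assumes "Str k x g" "k \<le> l" "lv l" shows "Str l x g"
  using assms(2,3)
proof (induction l rule: dec_induct)
  case (step n)
  then show ?case using Str_Suc lv_Suc by blast
qed (use assms in simp)

text \<open>
  Otherwise, since the commutator of \<open>x\<close> with \<open>\<rho>\<close> has lower degree in \<open>E\<close> and by induction is eventually stable,
  the leading monomials of \<open>x\<close> eventually have \<open>j = 1\<close>. Then \<open>e = 1\<close> in all later steps, \<open>M\<close> stays constant, and the multiples by \<open>M\<close> of the partial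
  sums \<open>mu k\<close> are increasing integers below \<open>M\<close>.
\<close>

lemma Str_infinite:
  assumes inf: "\<And>k. lv k" and x: "x \<noteq> 0"
  shows "\<exists>k g. Str k x g"
proof -
  have "\<exists>n. \<forall>s. part x s \<noteq> 0 \<longrightarrow> degree (part x s) < n"
  proof (intro exI allI impI)
    fix s assume "part x s \<noteq> 0"
    then have "degree (part x s) \<le> Max ((\<lambda>s. degree (part x s)) ` {s. part x s \<noteq> 0})"
      by (intro Max_ge) auto
    then show "degree (part x s) < Suc (Max ((\<lambda>s. degree (part x s)) ` {s. part x s \<noteq> 0}))" by simp
  qed
  then obtain n where "\<forall>s. part x s \<noteq> 0 \<longrightarrow> degree (part x s) < n" by blast
  then show ?thesis using x
  proof (induction n arbitrary: x)
    case 0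
    then show ?case by (auto intro: skew_eqI)
  next
    case (Suc n)
    show ?case
    proof (rule ccontr)
      assume no: "\<not> (\<exists>k g. Str k x g)"
      define x' where "x' = comm x 1"
      \<comment> \<open>\<open>hf k\<close> sends \<open>\<rho>\<close> to a signed power of itself,
        so the commutator with \<open>\<rho>\<close> becomes one with
        \<open>\<rho>^(Mf k)\<close>.\<close>
      have hx': "hf k x' = \<epsilon>f k *\<^sub>R comm (hf k x) (int (Mf k))" for k
        using Lev_hom[OF Levf[OF inf]] Lev_rho[OF Levf[OF inf], of k 1]
        by (simp add: x'_def comm_def alg_hom_diff alg_hom_mult scaleR_diff_right)
      have lead: "\<exists>s j. weight.lead (wl k) (hf k x) s (Suc j) \<and> weight.lead (wl k) (hf k x') (s + int (Mf k)) j" for k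
      proof -
        interpret weight "wl k" by (rule weight_wl[OF inf])
        obtain s j where sj: "lead (hf k x) s j" using lead_hf[OF inf Suc.prems(2)] by blast
        have "j \<noteq> 0"
        proof
          assume j0: "j = 0"
          from lead_0_sl[OF sj[unfolded j0]] have "Str k x (wl k s 0)" unfolding Str_def by blast
          with no show False by blast
        qed
        then obtain i where j: "j = Suc i" by (cases j) auto
        have "lead (comm (hf k x) (int (Mf k))) (s + int (Mf k)) i"
          using sj Lev_M[OF Levf[OF inf]] unfolding j by (intro lead_comm) auto
        then have "lead (hf k x') (s + int (Mf k)) i"
          using Lev_eps[OF Levf[OF inf], of k] unfolding hx' by (auto simp: lead_def)
        with sj j show ?thesis by blast
      qed
      have "x' \<noteq> 0"
      proof
        assume "x' = 0"
        then have "hf 0 x' = 0" using alg_hom_0[OF Lev_hom[OF Levf[OF inf]]] by simp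
        moreover obtain s j where "weight.lead (wl 0) (hf 0 x') s j" using lead[of 0] by blast
        ultimately show False using weight.lead_not_0[OF weight_wl[OF inf[of 0]]] by simp
      qed
      moreover have "\<forall>s. part x' s \<noteq> 0 \<longrightarrow> degree (part x' s) < n"
        using degree_comm[of x n] Suc.prems(1) by (auto simp: x'_def)
      ultimately obtain k0 g0 where "Str k0 x' g0" using Suc.IH by blast
      then have St: "Str k x' g0" if "k \<ge> k0" for k using Str_mono that inf by blast
      have lead1: "\<exists>s. weight.lead (wl k) (hf k x) s 1" if k: "k \<ge> k0" for k
      proof -
        interpret weight "wl k" by (rule weight_wl[OF inf])
        obtain y s where "sl (hf k x') y s 0" using St[OF k] inf by (auto simp: Str_def)
        moreover obtain t j where "lead (hf k x) t (Suc j)" "lead (hf k x') (t + int (Mf k)) j"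
          using lead[of k] by blast
        ultimately have "lead (hf k x) t (Suc j)" "j = 0" using lead_unique sl_lead by blast+
        then show ?thesis by auto
      qed
      have MS: "Mf (Suc k) = Mf k" if k: "k \<ge> k0" for k
      proof -
        obtain e where e: "e > 0" "Mf (Suc k) = e * Mf k"
          and st: "\<forall>x u j. weight.lead (wl k) (hf k x) u j \<longrightarrow> j < e \<or> j = 0 \<longrightarrow>
            (\<exists>y s. weight.sl (wl (Suc k)) (hf (Suc k) x) y s 0 \<and> wl (Suc k) s 0 = wl k u j)"
          using Nxtf[OF inf, of k] unfolding Nxt_def by (elim conjE exE)
        have "\<not> 1 < e"
        proof
          assume "1 < e"
          obtain u where "weight.lead (wl k) (hf k x) u 1" using lead1[OF k] by blast
          with st \<open>1 < e\<close> obtain y s where "weight.sl (wl (Suc k)) (hf (Suc k) x) y s 0" by blast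
          then have "Str (Suc k) x (wl (Suc k) s 0)" unfolding Str_def by blast
          with no show False by blast
        qed
        with e show ?thesis by simp
      qed
      define M where "M = Mf k0"
      have M: "Mf k = M" if "k \<ge> k0" for k
        using that by (induction k rule: dec_induct) (auto simp: MS M_def)
      have M_pos: "M > 0" using Lev_M[OF Levf[OF inf]] by (simp add: M_def)
      \<comment> \<open>The weight of the leading monomial of \<open>om (Suc k)\<close> contains
        \<open>nu (Suc k)\<close> exactly once; equating it with its value cancels that term and
        leaves \<open>mu k\<close>.\<close>
      have "\<exists>i. mu k = q (of_int i / of_nat M)" if k: "k \<ge> k0" for k
      proof -
        obtain s where s: "wl (Suc k) s 1 = nu (Suc k)"
          using Lev_omk[OF Levf[OF inf], of "Suc k"] by blast
        then have "q (of_int (- s) / of_nat M) + (mu k + nu (Suc k) - q 1) = nu (Suc k)"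
          using M[of "Suc k"] k by (simp add: wk_def mu_Suc)
        then have "mu k = q 1 - q (of_int (- s) / of_nat M)" by (simp add: algebra_simps)
        then have "mu k = q (1 - of_int (- s) / of_nat M)" by (simp only: q_diff)
        also have "1 - of_int (- s) / of_nat M = of_int (int M + s) / (of_nat M :: rat)"
          using M_pos by (simp add: field_simps)
        finally show ?thesis by blast
      qed
      then obtain i where i: "\<And>k. k \<ge> k0 \<Longrightarrow> mu k = q (of_int (i k) / of_nat M)" by metis
      have up: "i k < i (Suc k)" if "k \<ge> k0" for k
      proof -
        have "mu k < mu (Suc k)" using nu_pos[OF inf] by (simp add: mu_Suc)
        then show ?thesis using i[of k] i[of "Suc k"] that M_pos by (simp add: divide_less_cancel)
      qed
      have "i k0 + int p \<le> i (k0 + p)" for p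
      proof (induction p)
        case (Suc p)
        have "i (k0 + p) < i (Suc (k0 + p))" by (rule up) simp
        with Suc show ?case by simp
      qed simp
      moreover have "i k < int M" if "k \<ge> k0" for k
      proof -
        have "mu k < q 1" using mu_less[OF inf] by (simp add: mu_def)
        then have "(of_int (i k) :: rat) < of_int (int M)" using i[OF that] M_pos by simp
        then show ?thesis by (simp only: of_int_less_iff)
      qed
      ultimately have "i k0 + int p < int M" for p using le_add1[of k0 p] order.strict_trans1 by blast
      from this[of "nat (int M - i k0)"] show False by (simp split: if_splits)
    qed
  qed
qed

text \<open>\<open>mu N - q 1\<close> differs from the irrational \<open>nu N\<close> by a rational
  number, so equal weights in different degrees would make a multiple of \<open>nu N\<close>, hence
  \<open>nu N\<close> itself, rational.\<close>

lemma wl_inj: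
  assumes N: "lv N" "\<not> lv (Suc N)" and eq: "wl N s j = wl N t i"
  shows "j = i"
proof (rule ccontr)
  have gen: False if eq: "wl N s j = wl N t i" and ij: "i < j" for s t i j
  proof -
    have "nmul j (mu N - q 1) = nmul i (mu N - q 1) + nmul (j - i) (mu N - q 1)"
      using nmul_add[of i "j - i" "mu N - q 1"] ij by simp
    with eq have "nmul (j - i) (mu N - q 1) = q (of_int (- t) / of_nat (Mf N) - of_int (- s) / of_nat (Mf N))"
      by (simp only: wk_def q_diff) (simp add: algebra_simps)
    moreover obtain b where "wl N b 1 = nu N" using Lev_omk[OF Levf[OF N(1)]] by blast
    then have "mu N - q 1 = nu N - q (of_int (- b) / of_nat (Mf N))"
      by (simp add: wk_def algebra_simps)
    ultimately obtain z where z: "nmul (j - i) (nu N) = q z"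
      by (simp only: nmul_diff q_nmul) (metis q_add add_diff_cancel diff_add_cancel)
    define n where "n = j - i"
    define d where "d = nu N - q (z / of_nat n)"
    have n: "n > 0" using ij by (simp add: n_def)
    have "nmul n d = 0" using n z by (simp add: d_def nmul_diff q_nmul n_def[symmetric])
    moreover have "nmul n (- d) = - nmul n d" by (induction n) auto
    ultimately have "d = 0"
      using nmul_pos[of d n] nmul_pos[of "- d" n] n
      by (cases d "0 :: 'a" rule: linorder_cases) auto
    then show False using irr[OF N] by (simp add: d_def)
  qed
  assume "j \<noteq> i"
  then show False using gen[OF eq] gen[OF eq[symmetric]] by (cases "i < j") auto
qed

lemma Str_finite:
  assumes N: "lv N" "\<not> lv (Suc N)" and x: "x \<noteq> 0"
  shows "\<exists>g. Str N x g"
proof -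
  interpret weight "wl N" by (rule weight_wl[OF N(1)])
  obtain s j where sj: "lead (hf N x) s j" using lead_hf[OF N(1) x] by blast
  have "sl (hf N x) (cf (hf N x) s j) s j"
    unfolding sl_def
  proof (intro conjI allI impI)
    fix t i assume nz: "cf (hf N x) t i \<noteq> 0" and ne: "(t, i) \<noteq> (s, j)"
    then have "wl N s j < wl N t i \<or> wl N s j = wl N t i" using sj by (auto simp: lead_def)
    moreover have "wl N s j \<noteq> wl N t i" using wl_inj[OF N, of s j t i] ne wt_eq_int_iff by auto
    ultimately show "wl N s j < wl N t i" by simp
  qed (use sj in \<open>auto simp: lead_def\<close>)
  then show ?thesis using N unfolding Str_def by blast
qed

lemma Str_ex: "x \<noteq> 0 \<Longrightarrow> \<exists>k g. lv k \<and> Str k x g"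
proof (cases "\<forall>k. lv k")
  case True
  then show "x \<noteq> 0 \<Longrightarrow> ?thesis" using Str_infinite by blast
next
  case False
  \<comment> \<open>The last existing index, as the least one without a successor;
    \<open>lv N\<close> holds because either \<open>N = 0\<close> or its predecessor has a
    successor.\<close>
  define N where "N = (LEAST k. \<not> lv (Suc k))"
  from False obtain k where "\<not> lv k" by blast
  with lv_0 obtain k' where k': "\<not> lv (Suc k')" by (cases k) auto
  then have "\<not> lv (Suc N)" unfolding N_def by (rule LeastI)
  moreover have "lv N"
  proof (cases N)
    case (Suc n)
    then show ?thesis using not_less_Least[of n "\<lambda>k. \<not> lv (Suc k)"] by (auto simp: N_def)
  qed (use lv_0 in simp)
  ultimately show "x \<noteq> 0 \<Longrightarrow> ?thesis" using Str_finite by blast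
qed

end

section \<open>Valuations of the division ring\<close>

text \<open>Conjugation by \<open>x\<close> replaces \<open>F\<close> by \<open>F + 1\<close>. A
  polynomial relation for \<open>F\<close> therefore implies one of lower degree, by differences,
  and finally a nonzero constant would vanish.\<close>

lemma pe_nonzero_aux:
  fixes F x :: "'d::real_div_algebra"
  assumes Fx: "F * x = x * (F + 1)" and x: "x \<noteq> 0"
  shows "P \<noteq> 0 \<Longrightarrow> pe P F \<noteq> 0"
proof (induction "degree P" arbitrary: P rule: less_induct)
  case less
  have comm: "pe P F * x = x * pe (pshift 1 P) F" for P
  proof (induction P)
    case (pCons a P)
    have "pshift 1 (pCons a P) = [:a:] + [:1, 1:] * pshift 1 P"
      by (simp add: pshift_def pcompose_pCons)
    then have "pe (pshift 1 (pCons a P)) F = of_real a + (1 + F) * pe (pshift 1 P) F"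
      by (simp only: pe_add pe_mult) simp
    then have "x * pe (pshift 1 (pCons a P)) F = x * of_real a + x * (F + 1) * pe (pshift 1 P) F"
      by (simp add: algebra_simps mult.assoc)
    also have "\<dots> = of_real a * x + F * (x * pe (pshift 1 P) F)"
      by (simp add: Fx[symmetric] of_real_commute mult.assoc)
    also have "\<dots> = pe (pCons a P) F * x"
      by (simp add: pCons.IH[symmetric] algebra_simps mult.assoc)
    finally show ?case by simp
  qed simp
  show ?case
  proof (cases "degree P")
    case 0
    then obtain c where "P = [:c:]" by (elim degree_eq_zeroE)
    with less.prems show ?thesis by simp
  next
    case (Suc n)
    define R where "R = pshift 1 P - P"
    have cn: "coeff P i = 0" if "i > Suc n" for i using Suc that by (simp add: coeff_eq_0)
    have "coeff R n = of_nat (Suc n) * coeff P (Suc n)"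
      using coeff_pshift_Suc[of n P 1] cn by (simp add: R_def)
    moreover have "coeff P (Suc n) \<noteq> 0" using Suc less.prems by (metis leading_coeff_0_iff)
    ultimately have R0: "R \<noteq> 0" by (auto simp del: of_nat_Suc)
    have "coeff R i = 0" if "i > n" for i
      using coeff_pshift[of i P 1] cn that by (simp add: R_def)
    then have "degree R < degree P" using Suc by (simp add: degree_le less_Suc_eq_le)
    with R0 less.hyps have R1: "pe R F \<noteq> 0" by blast
    show ?thesis
    proof
      assume *: "pe P F = 0"
      with comm[of P] x have "pe (pshift 1 P) F = 0" by simp
      with * R1 show False by (simp add: R_def pe_diff)
    qed
  qed
qed

locale weyl_div =
  fixes x y :: "'d::real_div_algebra"
  assumes rel: "y * x - x * y = 1"
begin

lemma x_nz: "x \<noteq> 0"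
  using rel by auto

lemma Fx: "x * y * x = x * (x * y + 1)"
  using rel by (simp add: algebra_simps mult.assoc)

lemma F_powi: "x * y * (x powi t) = x powi t * (x * y + of_int t)"
proof -
  have nat: "x * y * x ^ n = x ^ n * (x * y + of_nat n)" for n
  proof (induction n)
    case (Suc n)
    have "x * y * x ^ Suc n = x * (x * y + 1) * x ^ n"
      by (simp only: power_Suc mult.assoc[symmetric] Fx)
    also have "\<dots> = x * (x * y * x ^ n) + x * x ^ n" by (simp add: algebra_simps mult.assoc)
    also have "\<dots> = x ^ Suc n * (x * y + of_nat (Suc n))"
      unfolding Suc by (simp add: algebra_simps mult.assoc)
    finally show ?case .
  qed simp
  show ?thesis
  proof (cases "t \<ge> 0")
    case True
    then show ?thesis using nat[of "nat t"] by (simp add: power_int_def)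
  next
    case False
    define n where "n = nat (- t)"
    define z where "z = inverse (x ^ n)"
    have z: "z * x ^ n = 1" "x ^ n * z = 1" using x_nz by (simp_all add: z_def)
    have "z * (x * y) = z * (x * y * x ^ n) * z"
      using z by (simp add: mult.assoc)
    also have "\<dots> = (x * y + of_nat n) * z"
      unfolding nat using z by (simp add: mult.assoc[symmetric])
    finally have "x * y * z = z * (x * y - of_nat n)"
      by (simp add: algebra_simps mult_of_nat_commute)
    moreover have "x powi t = z" using False by (simp add: power_int_def z_def n_def power_inverse)
    moreover have "of_int t = - (of_nat n :: 'd)" using False by (simp add: n_def)
    ultimately show ?thesis by simp
  qed
qed

definition emb :: "skew \<Rightarrow> 'd" where
  "emb = hm (\<lambda>s. x powi s) (x * y)"

lemma hom_emb: "alg_hom emb"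
  unfolding emb_def by (rule alg_hom_hm) (simp_all add: power_int_add x_nz F_powi)

lemma emb_rho: "emb (rho s) = x powi s"
  by (simp add: emb_def rho_def)

lemma emb_En: "emb En = x * y"
  by (simp add: emb_def En_def)

text \<open>The parts of \<open>b\<close> are eigenvectors of the commutator with \<open>E\<close>,
  with distinct eigenvalues \<open>s\<close>. Subtracting \<open>s0\<close> removes one part, so the
  number of parts decreases until a single one is left for \<open>pe_nonzero_aux\<close>.\<close>

lemma emb_nonzero: "b \<noteq> 0 \<Longrightarrow> emb b \<noteq> 0"
proof (induction "card {s. part b s \<noteq> 0}" arbitrary: b rule: less_induct)
  case less
  then obtain s0 where s0: "part b s0 \<noteq> 0" using skew_eqI[of b 0] by auto
  define b' where "b' = En * b - b * En - of_int s0 * b"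
  have pb': "part b' s = smult (of_int (s - s0)) (part b s)" for s
  proof -
    have "part (En * b) s - part (b * En) s = smult (of_int s) (part b s)"
    proof (induction b rule: skew_induct)
      case (sm t P)
      show ?case by (auto simp: En_def sm_mult part_sm)
    next
      case (add a b)
      then show ?case by (simp add: algebra_simps smult_add_right)
    qed
    moreover have "(of_int s0 :: skew) * b = of_int s0 *\<^sub>R b"
      by (simp add: scaleR_conv_of_real)
    ultimately show ?thesis by (simp add: b'_def algebra_simps smult_diff_left)
  qed
  show ?case
  proof (cases "b' = 0")
    case True
    have "part b s = 0" if "s \<noteq> s0" for s
      using pb'[of s] True that by auto
    then have "b = sm s0 (part b s0)" by (auto intro!: skew_eqI simp: part_sm)
    then have "emb b = x powi s0 * pe (part b s0) (x * y)"
      using hm_sm unfolding emb_def by metis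
    moreover have "pe (part b s0) (x * y) \<noteq> 0"
      using s0 by (intro pe_nonzero_aux[OF Fx x_nz])
    ultimately show ?thesis using x_nz by (simp add: power_int_not_zero)
  next
    case False
    have "{s. part b' s \<noteq> 0} \<subset> {s. part b s \<noteq> 0}"
      using s0 pb' by auto
    then have "card {s. part b' s \<noteq> 0} < card {s. part b s \<noteq> 0}"
      by (intro psubset_card_mono) auto
    from less.hyps[OF this False] have "emb b' \<noteq> 0" .
    then show ?thesis by (auto simp: b'_def alg_hom_diff[OF hom_emb] alg_hom_mult[OF hom_emb])
  qed
qed

end

section \<open>Values in a noncommutative ordered group, and elements with equal leading
  terms\<close>

lemma add_mono_lo: "a \<le> b \<Longrightarrow> c \<le> d \<Longrightarrow> a + c \<le> b + (d::'a::linordered_group_add)"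
  by (meson order.trans translate_left_mono translate_right_mono)

lemma add_strict_mono_lo1:
  assumes "a < b" "c \<le> d" shows "a + c < b + (d::'a::linordered_group_add)"
proof -
  have "a + c \<le> b + c" using assms(1) by (intro translate_right_mono) simp
  then have "a + c < b + c" using assms(1) by (simp add: order_less_le)
  also have "\<dots> \<le> b + d" using assms(2) by (rule translate_left_mono)
  finally show ?thesis .
qed

lemma add_strict_mono_lo2:
  assumes "a \<le> b" "c < d" shows "a + c < b + (d::'a::linordered_group_add)"
proof -
  have "b + c \<le> b + d" using assms(2) by (intro translate_left_mono) simp
  then have "b + c < b + d" using assms(2) by (simp add: order_less_le)
  moreover have "a + c \<le> b + c" using assms(1) by (rule translate_right_mono)
  ultimately show ?thesis by (rule order.strict_trans1[rotated])
qed

lemma Fin_less [simp]: "Fin a < Fin b \<longleftrightarrow> a < b"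
  by (auto simp: less_with_infinity_def)

lemma Fin_less_Infinity [simp]: "Fin a < Infinity"
  by (simp add: less_with_infinity_def)

lemma Infinity_le [simp]: "Infinity \<le> a \<longleftrightarrow> a = Infinity"
  by (cases a) auto

lemma plus_Infinity [simp]: "a + Infinity = Infinity" "Infinity + a = Infinity"
  by (cases a; simp)+

lemma winf_mono: "a \<le> b \<Longrightarrow> c \<le> d \<Longrightarrow> a + c \<le> b + (d::'a::linordered_group_add with_infinity)"
  by (cases a; cases b; cases c; cases d) (auto intro: add_mono_lo)

locale val =
  fixes v :: "'d::real_div_algebra \<Rightarrow> 'h::linordered_group_add with_infinity"
  assumes val: "valuation v" and triv: "trivial_on_reals v"
begin

lemma v_0 [simp]: "v 0 = Infinity" and v_Inf: "v a = Infinity \<longleftrightarrow> a = 0"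
  and v_mult: "v (a * b) = v a + v b" and v_add: "min (v a) (v b) \<le> v (a + b)"
  using val by (auto simp: valuation_def)

lemma v_of_real: "r \<noteq> 0 \<Longrightarrow> v (of_real r) = Fin 0"
  using triv by (simp add: trivial_on_reals_def zero_with_infinity_def)

lemma v_1 [simp]: "v 1 = Fin 0"
  using v_of_real[of 1] by simp

lemma v_of_real_ge: "Fin 0 \<le> v (of_real r)"
  using v_of_real[of r] by (cases "r = 0") auto

lemma v_uminus [simp]: "v (- a) = v a"
proof -
  have "v (- a) = v (of_real (- 1)) + v a" using v_mult[of "of_real (- 1)" a] by simp
  also have "\<dots> = v a" using v_of_real[of "-1"] by (cases "v a") auto
  finally show ?thesis .
qed

lemma v_scaleR: "r \<noteq> 0 \<Longrightarrow> v (r *\<^sub>R a) = v a"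
  using v_mult[of "of_real r" a] v_of_real[of r] by (cases "v a") (auto simp: scaleR_conv_of_real)

lemma v_minus_commute: "v (a - b) = v (b - a)"
  using v_uminus[of "a - b"] by simp

lemma v_ge_add: "c \<le> v a \<Longrightarrow> c \<le> v b \<Longrightarrow> c \<le> v (a + b)"
  using v_add[of a b] by (metis min.boundedI order.trans)

lemma v_gt_add: "c < v a \<Longrightarrow> c < v b \<Longrightarrow> c < v (a + b)"
  using v_add[of a b] by (metis min_less_iff_conj order.strict_trans2)

lemma v_gt_diff: "c < v a \<Longrightarrow> c < v b \<Longrightarrow> c < v (a - b)"
  using v_gt_add[of c a "- b"] by simp

lemma v_add_eq: "v a < v b \<Longrightarrow> v (a + b) = v a"
proof (rule antisym)
  assume *: "v a < v b"
  show "v a \<le> v (a + b)" using v_add[of a b] * by (simp add: min_def split: if_splits)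
  show "v (a + b) \<le> v a"
  proof (rule ccontr)
    assume "\<not> v (a + b) \<le> v a"
    then have "v a < v (a + b - b)" using * by (intro v_gt_diff) auto
    then show False by simp
  qed
qed

lemma v_nz: "a \<noteq> 0 \<Longrightarrow> \<exists>g. v a = Fin g"
  using v_Inf by (cases "v a") auto

lemma v_inverse: "v a = Fin g \<Longrightarrow> v (inverse a) = Fin (- g)"
proof -
  assume a: "v a = Fin g"
  then have "a \<noteq> 0" by auto
  then have "v a + v (inverse a) = Fin 0" using v_mult[of a "inverse a"] by simp
  with a show ?thesis by (cases "v (inverse a)") (auto simp: eq_neg_iff_add_eq_0 minus_unique)
qed

text \<open>Equality of leading terms: \<open>b\<close> is \<open>a\<close> times an element of
  residue 1. The relation replaces quotients, which are awkward because neither the elements nor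
  their values need commute.\<close>

definition near :: "'d \<Rightarrow> 'd \<Rightarrow> bool" where
  "near a b \<longleftrightarrow> v a < v (a - b)"

lemma near_refl: "a \<noteq> 0 \<Longrightarrow> near a a"
  using v_nz[of a] by (auto simp: near_def)

lemma near_v: "near a b \<Longrightarrow> v b = v a"
  using v_add_eq[of a "b - a"] v_minus_commute[of a b] by (simp add: near_def)

lemma near_nz: "near a b \<Longrightarrow> a \<noteq> 0" "near a b \<Longrightarrow> b \<noteq> 0"
  using near_v[of a b] by (auto simp: near_def)

lemma near_sym: "near a b \<Longrightarrow> near b a"
  using near_v[of a b] v_minus_commute[of a b] by (simp add: near_def)

lemma near_trans: "near a b \<Longrightarrow> near b c \<Longrightarrow> near a c"
  using near_v[of a b] v_gt_add[of "v a" "a - b" "b - c"] by (simp add: near_def)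

lemma near_mult:
  assumes "near a b" "near c d" shows "near (a * c) (b * d)"
proof -
  from near_nz[OF assms(1)] near_nz[OF assms(2)] obtain g h where gh: "v a = Fin g" "v c = Fin h"
    using v_nz by blast
  have b: "v b = Fin g" using near_v[OF assms(1)] gh by simp
  have "v (a * c) < v ((a - b) * c)"
    using assms(1) gh by (cases "v (a - b)") (auto simp: near_def v_mult intro: add_strict_mono_lo1)
  moreover have "v (a * c) < v (b * (c - d))"
    using assms(2) gh b by (cases "v (c - d)") (auto simp: near_def v_mult intro: add_strict_mono_lo2)
  ultimately have "v (a * c) < v ((a - b) * c + b * (c - d))" by (rule v_gt_add)
  then show ?thesis by (simp add: near_def algebra_simps)
qed

lemma near_inverse:
  assumes "near a b" shows "near (inverse a) (inverse b)"
proof -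
  note nz = near_nz[OF assms]
  then obtain g where g: "v a = Fin g" using v_nz by blast
  have b: "v b = Fin g" using near_v[OF assms] g by simp
  have "inverse a - inverse b = inverse a * (b - a) * inverse b"
    using nz by (simp add: algebra_simps mult.assoc)
  moreover have "v (inverse a) < v (inverse a * (b - a) * inverse b)"
  proof (cases "v (b - a)")
    case (Fin h)
    have "g < h" using assms Fin g v_minus_commute[of a b] by (simp add: near_def)
    then have "- g + (g + - g) < - g + (h + - g)"
      by (intro add_strict_mono_lo2 add_strict_mono_lo1) auto
    then show ?thesis using v_inverse[OF g] v_inverse[OF b] Fin
      by (simp add: v_mult add.assoc diff_conv_add_uminus del: add_uminus_conv_diff)
  qed (use v_inverse[OF g] in \<open>simp add: v_mult\<close>)
  ultimately show ?thesis by (simp add: near_def)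
qed

lemma near_power: "near a b \<Longrightarrow> near (a ^ n) (b ^ n)"
  by (induction n) (auto intro: near_mult near_refl)

lemma near_powi: "near a b \<Longrightarrow> near (a powi n) (b powi n)"
  by (auto simp: power_int_def intro: near_power near_inverse)

text \<open>Words commute only up to leading terms, and this is enough to split the power of a
  product into powers of its factors.\<close>

lemma near_comm_power:
  assumes "near (a * b) (b * a)" shows "near ((a * b) ^ n) (a ^ n * b ^ n)"
proof -
  have nz: "a \<noteq> 0" "b \<noteq> 0" using near_nz[OF assms] by auto
  have c: "near (b * a ^ n) (a ^ n * b)" for n
  proof (induction n)
    case (Suc n)
    have "near (b * a * a ^ n) (a * b * a ^ n)"
      using nz by (intro near_mult near_refl near_sym[OF assms]) auto
    moreover have "near (a * (b * a ^ n)) (a * (a ^ n * b))"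
      by (rule near_mult[OF near_refl Suc]) (rule nz)
    ultimately have "near (b * a * a ^ n) (a * (a ^ n * b))"
      using near_trans[of "b * a * a ^ n" "a * b * a ^ n"] by (simp only: mult.assoc)
    then show ?case by (simp only: mult.assoc power_Suc)
  qed (use nz in \<open>auto intro: near_refl\<close>)
  show ?thesis
  proof (induction n)
    case (Suc n)
    have "near (a * b * (a * b) ^ n) (a * b * (a ^ n * b ^ n))"
      using nz Suc by (intro near_mult near_refl) auto
    moreover have "near (a * (b * a ^ n) * b ^ n) (a * (a ^ n * b) * b ^ n)"
      by (rule near_mult[OF near_mult[OF near_refl c] near_refl]) (use nz in auto)
    ultimately have "near (a * b * (a * b) ^ n) (a * (a ^ n * b) * b ^ n)"
      using near_trans[of "a * b * (a * b) ^ n" "a * b * (a ^ n * b ^ n)"] by (simp only: mult.assoc)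
    then show ?case by (simp only: mult.assoc power_Suc)
  qed (auto intro: near_refl)
qed

lemma near_comm_powi:
  assumes "near (a * b) (b * a)" shows "near ((a * b) powi n) (a powi n * b powi n)"
proof (cases "n \<ge> 0")
  case True
  then show ?thesis using near_comm_power[OF assms] by (simp add: power_int_def)
next
  case False
  define m where "m = nat (- n)"
  have "near ((b * a) ^ m) (b ^ m * a ^ m)" by (rule near_comm_power[OF near_sym[OF assms]])
  then have "near (inverse ((b * a) ^ m)) (inverse (b ^ m * a ^ m))" by (rule near_inverse)
  moreover have "near (inverse ((a * b) ^ m)) (inverse ((b * a) ^ m))"
    by (intro near_inverse near_power assms)
  moreover have "inverse (b ^ m * a ^ m) = inverse (a ^ m) * inverse (b ^ m)"
    using near_nz[OF assms] by (simp add: nonzero_inverse_mult_distrib)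
  ultimately have "near (inverse ((a * b) ^ m)) (inverse (a ^ m) * inverse (b ^ m))"
    using near_trans by metis
  then show ?thesis using False by (simp add: power_int_def m_def power_inverse)
qed

lemma pe_ge: "Fin 0 \<le> v t \<Longrightarrow> Fin 0 \<le> v (pe P t)"
proof (induction P)
  case (pCons a P)
  have "Fin 0 + Fin 0 \<le> v t + v (pe P t)" using pCons by (intro winf_mono)
  then have "Fin 0 \<le> v (t * pe P t)" by (simp add: v_mult)
  then show ?case using v_of_real_ge[of a] by (auto intro: v_ge_add)
qed simp

text \<open>\<open>P(t) - P(r)\<close> is a multiple of \<open>t - r\<close>, so \<open>P(t)\<close>
  has the nonzero residue \<open>P(r)\<close>.\<close>

lemma pe_unit:
  assumes t: "Fin 0 \<le> v t" and r: "Fin 0 < v (t - of_real r)" and P: "poly P r \<noteq> 0"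
  shows "v (pe P t) = Fin 0"
proof -
  have "poly (P - [:poly P r:]) r = 0" by simp
  then obtain U where U: "P - [:poly P r:] = [:- r, 1:] * U" unfolding poly_eq_0_iff_dvd by (elim dvdE)
  have "pe P t - of_real (poly P r) = (t - of_real r) * pe U t"
    using arg_cong[OF U, of "\<lambda>p. pe p t"] by (simp only: pe_diff pe_mult) simp
  then have eq: "pe P t = of_real (poly P r) + (t - of_real r) * pe U t" by (simp add: algebra_simps)
  have "Fin 0 < v ((t - of_real r) * pe U t)"
    unfolding v_mult using r pe_ge[OF t, of U]
    by (cases "v (t - of_real r)"; cases "v (pe U t)") (auto dest: add_strict_mono_lo1[of 0 _ 0])
  then show ?thesis unfolding eq using v_of_real[OF P] v_add_eq by simp
qed

end

text \<open>
  Applied to the values \<open>m t / n t\<close> of the \<open>\<omega>\<close>s: some \<open>p\<close> is such that an odd power of each \<open>\<omega>\<close> has the value of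
  a power of the \<open>p\<close>-th one. Choose \<open>n p\<close> with the largest power of \<open>2\<close> among those with \<open>m p\<close> odd.
\<close>

lemma odd_ratio:
  fixes m n :: "nat \<Rightarrow> int"
  assumes cop: "\<And>t. t \<le> N \<Longrightarrow> coprime (m t) (n t)" and nz: "\<And>t. t \<le> N \<Longrightarrow> n t \<noteq> 0" and m0: "odd (m 0)"
  shows "\<exists>p\<le>N. odd (m p) \<and> (\<forall>t\<le>N. odd ((m p * n t) div gcd (m p * n t) (m t * n p)))"
proof -
  have two: "prime_elem (2::int)" by simp
  define S where "S = {t. t \<le> N \<and> odd (m t)}"
  have S: "finite S" "S \<noteq> {}" using m0 by (auto simp: S_def)
  have "\<exists>p\<in>S. \<forall>t\<in>S. multiplicity 2 (n t) \<le> multiplicity 2 (n p)"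
  proof -
    have "Max ((\<lambda>t. multiplicity 2 (n t)) ` S) \<in> (\<lambda>t. multiplicity 2 (n t)) ` S"
      using S by (intro Max_in) auto
    then obtain p where p: "p \<in> S" "multiplicity 2 (n p) = Max ((\<lambda>t. multiplicity 2 (n t)) ` S)" by auto
    then show ?thesis using S by (intro bexI[of _ p]) auto
  qed
  then obtain p where p: "p \<in> S" and max: "\<And>t. t \<in> S \<Longrightarrow> multiplicity 2 (n t) \<le> multiplicity 2 (n p)" by blast
  have "odd ((m p * n t) div gcd (m p * n t) (m t * n p))" if t: "t \<le> N" for t
  proof
    define X where "X = m p * n t"
    define Y where "Y = m t * n p"
    define d where "d = gcd X Y"
    assume "even ((m p * n t) div gcd (m p * n t) (m t * n p))"
    then have ev: "even (X div d)" by (simp add: X_def Y_def d_def)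
    have mp: "odd (m p)" "p \<le> N" using p by (auto simp: S_def)
    have X: "X \<noteq> 0" using mp nz[OF t] by (auto simp: X_def)
    then have d: "d \<noteq> 0" by (simp add: d_def)
    \<comment> \<open>After division by the gcd at most one of the two numbers is even, so an even
      \<open>X div d\<close> means that \<open>X\<close> contains more factors 2 than
      \<open>Y\<close>.\<close>
    have "coprime (X div d) (Y div d)" using X by (simp add: d_def div_gcd_coprime)
    with ev have od: "odd (Y div d)" by (metis coprime_common_divisor odd_one)
    have Xd: "X = (X div d) * d" and Yd: "Y = (Y div d) * d" by (simp_all add: d_def)
    have Xd0: "X div d \<noteq> 0" using Xd X by auto
    have Yd0: "Y div d \<noteq> 0" using od by auto
    have Y: "Y \<noteq> 0" using Yd Yd0 d by auto
    have "multiplicity 2 (X div d) > 0" using ev Xd0 by (simp add: multiplicity_gt_zero_iff)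
    moreover have "multiplicity 2 (Y div d) = 0" using od by (simp add: not_dvd_imp_multiplicity_0)
    moreover have "multiplicity 2 X = multiplicity 2 (X div d) + multiplicity 2 d"
      using prime_elem_multiplicity_mult_distrib[OF two Xd0 d] Xd by simp
    moreover have "multiplicity 2 Y = multiplicity 2 (Y div d) + multiplicity 2 d"
      using prime_elem_multiplicity_mult_distrib[OF two Yd0 d] Yd by simp
    ultimately have gt: "multiplicity 2 X > multiplicity 2 Y" by simp
    have mp0: "m p \<noteq> 0" using mp by auto
    have "multiplicity 2 (m p) = 0" using mp by (simp add: not_dvd_imp_multiplicity_0)
    then have mX: "multiplicity 2 X = multiplicity 2 (n t)"
      using prime_elem_multiplicity_mult_distrib[OF two, of "m p" "n t"] mp0 nz[OF t] by (simp add: X_def)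
    have "m t \<noteq> 0" using Y by (auto simp: Y_def)
    then have mY: "multiplicity 2 Y = multiplicity 2 (m t) + multiplicity 2 (n p)"
      using prime_elem_multiplicity_mult_distrib[OF two, of "m t" "n p"] nz mp by (auto simp: Y_def)
    \<comment> \<open>For odd \<open>m t\<close> this contradicts the choice of \<open>p\<close>;
      for even \<open>m t\<close>, coprimality makes \<open>n t\<close> odd, and then
      \<open>X\<close> has no factor 2 at all.\<close>
    show False
    proof (cases "odd (m t)")
      case True
      then show False using max[of t] t gt mX mY by (simp add: S_def)
    next
      case False
      then have "odd (n t)" using cop[OF t] by (metis coprime_common_divisor odd_one)
      then have "multiplicity 2 (n t) = 0" by (simp add: not_dvd_imp_multiplicity_0)
      then show False using gt mX by simp
    qed
  qed
  with p show ?thesis by (auto simp: S_def)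
qed

lemma scaleR_powi: "(c *\<^sub>R a) powi n = (c powi n) *\<^sub>R (a powi n)" for a :: "'a::real_div_algebra"
proof -
  have p: "(c *\<^sub>R a) ^ n = (c ^ n) *\<^sub>R (a ^ n)" for c and a :: 'a and n
    by (induction n) auto
  show ?thesis by (simp add: power_int_def inverse_scaleR_distrib p)
qed

lemma power_odd_inj:
  assumes "odd K" "r powi K = (s::real) powi K" "r \<noteq> 0" "s \<noteq> 0"
  shows "r = s"
proof -
  define n where "n = nat \<bar>K\<bar>"
  have n: "odd n" using assms(1) by (simp add: n_def even_nat_iff)
  have "r ^ n = s ^ n"
    using assms by (cases "K \<ge> 0") (auto simp: power_int_def n_def power_inverse)
  then show ?thesis using odd_real_root_power_cancel[OF n] by metis
qed

lemma (in val) v_powi_e: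
  assumes e: "\<And>a b. e (a + b) = e a + (e b :: 'h)" and a: "v a = Fin (e (g :: 'g :: ab_group_add))"
  shows "v (a powi s) = Fin (e (if s \<ge> 0 then nmul (nat s) g else - nmul (nat (- s)) g))"
proof -
  have e0: "e 0 = 0" using e[of 0 0] add_left_cancel[of "e 0" "e 0" 0] by simp
  have em: "e (- h) = - e h" for h
    using e[of h "- h"] e0 by (simp add: eq_neg_iff_add_eq_0 minus_unique)
  have p: "v (a ^ n) = Fin (e (nmul n g))" for n
    by (induction n) (auto simp: e0 v_mult a e)
  show ?thesis
    using p v_inverse[OF p] by (auto simp: power_int_def em power_inverse)
qed

section \<open>Uniqueness\<close>

locale chain_div = chain q lv nu mm nn be + weyl_div x y
  for q :: "rat \<Rightarrow> 'g::linordered_ab_group_add" and lv :: "nat \<Rightarrow> bool" and nu :: "nat \<Rightarrow> 'g"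
    and mm :: "nat \<Rightarrow> int" and nn :: "nat \<Rightarrow> nat" and be :: "nat \<Rightarrow> real" and x y :: "'d::real_div_algebra" +
  fixes e :: "'g \<Rightarrow> 'h::linordered_group_add"
  assumes e_add: "e (a + b) = e a + e b" and e_mono: "strict_mono e"
begin

lemma e_0 [simp]: "e 0 = 0"
  using e_add[of 0 0] add_left_cancel[of "e 0" "e 0" 0] by simp
lemma e_minus: "e (- a) = - e a"
  using e_add[of a "- a"] by (simp add: eq_neg_iff_add_eq_0 minus_unique)
lemma e_less [simp]: "e a < e b \<longleftrightarrow> a < b"
  using e_mono by (simp add: strict_mono_less)
lemma e_le [simp]: "e a \<le> e b \<longleftrightarrow> a \<le> b"
  using e_mono by (simp add: strict_mono_less_eq)
lemma e_eq [simp]: "e a = e b \<longleftrightarrow> a = b"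
  using e_mono by (simp add: strict_mono_eq)

text \<open>The residue field enters only through real approximations of the elements of nonnegative
  value. The embedding \<open>e\<close> transports the commutative computations with weights into
  \<open>'h\<close>, whose addition need not commute.\<close>

definition good :: "('d \<Rightarrow> 'h with_infinity) \<Rightarrow> bool" where
  "good v \<longleftrightarrow> val v \<and> (\<forall>a. Fin 0 \<le> v a \<longrightarrow> (\<exists>r. Fin 0 < v (a - of_real r))) \<and>
     v x = Fin (e (q (- 1))) \<and> (\<forall>i. lv i \<longrightarrow> v (emb (om i)) = Fin (e (nu i)))"

definition pv :: "('d \<Rightarrow> 'h with_infinity) \<Rightarrow> 'g \<Rightarrow> skew \<Rightarrow> bool" where
  "pv v g z \<longleftrightarrow> Fin (e g) \<le> v (emb z)"

lemma good_val: "good v \<Longrightarrow> val v"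
  and good_x: "good v \<Longrightarrow> v x = Fin (e (q (- 1)))"
  and good_om: "good v \<Longrightarrow> lv i \<Longrightarrow> v (emb (om i)) = Fin (e (nu i))"
  and good_res: "good v \<Longrightarrow> Fin 0 \<le> v a \<Longrightarrow> \<exists>r. Fin 0 < v (a - of_real r)"
  by (auto simp: good_def)

lemma v_rho:
  assumes "good v" shows "v (x powi s) = Fin (e (q (- of_int s)))"
proof -
  interpret val v by (rule good_val[OF assms])
  have "v (x powi s) = Fin (e (if s \<ge> 0 then nmul (nat s) (q (- 1)) else - nmul (nat (- s)) (q (- 1))))"
    by (rule v_powi_e[OF e_add good_x[OF assms]])
  also have "(if s \<ge> 0 then nmul (nat s) (q (- 1)) else - nmul (nat (- s)) (q (- 1))) = q (- of_int s)"
    by (simp add: q_nmul flip: q_minus)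
  finally show ?thesis .
qed

lemma pv_ax_pv:
  assumes v: "good v" and n: "lv n" shows "pv_ax n (pv v)"
proof -
  interpret val v by (rule good_val[OF v])
  show ?thesis
    unfolding pv_ax_def
  proof (intro conjI allI impI)
    show "pv v g' z" if "pv v g z" "g' \<le> g" for g g' z
      using that unfolding pv_def by (meson e_le less_eq_with_infinity.simps(1) order.trans)
    show "pv v g (z + z')" if "pv v g z" "pv v g z'" for g z z'
      using that unfolding pv_def alg_hom_add[OF hom_emb] by (rule v_ge_add)
    show "pv v g 0" for g by (simp add: pv_def alg_hom_0[OF hom_emb])
    show "pv v (g + h) (z * z')" if "pv v g z" "pv v h z'" for g h z z'
      using winf_mono[OF that[unfolded pv_def]] by (simp add: pv_def alg_hom_mult[OF hom_emb] v_mult e_add)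
    show "pv v 0 (of_real r)" for r
      using v_of_real_ge by (simp add: pv_def alg_hom_of_real[OF hom_emb])
    show "pv v (q (- of_int s)) (rho s)" for s
      by (simp add: pv_def emb_rho v_rho[OF v])
    show "pv v (nu i) (om i)" if "i \<le> n" for i
      using good_om[OF v lv_le[OF n that]] by (simp add: pv_def)
  qed
qed

lemma wv_ax_v:
  assumes v: "good v" and n: "lv n" shows "wv_ax n (\<lambda>g z. v (emb z) = Fin (e g))"
proof -
  interpret val v by (rule good_val[OF v])
  show ?thesis
    unfolding wv_ax_def
  proof (intro conjI allI impI)
    show "v (emb (z * z')) = Fin (e (g + h))" if "v (emb z) = Fin (e g)" "v (emb z') = Fin (e h)" for g h z z'
      using that by (simp add: alg_hom_mult[OF hom_emb] v_mult e_add)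
    show "v (emb (rho s)) = Fin (e (q (- of_int s)))" for s
      by (simp add: emb_rho v_rho[OF v])
    show "v (emb (om i)) = Fin (e (nu i))" if "i \<le> n" for i
      by (rule good_om[OF v lv_le[OF n that]])
  qed
qed

lemma word_v:
  assumes "good v" "lv k" "Lev k M \<epsilon> h" "w \<in> Wd (Suc k)" "weight.sl (wk k M) (h w) c s j"
  shows "v (emb w) = Fin (e (wk k M s j))"
  using word_pv[OF assms(2-5) wv_ax_v[OF assms(1,2)]] .

text \<open>\<open>E = \<rho> * om 0\<close>, so the weights of both generators at level 0 are sums
  of prescribed values, and a sum is bounded by its monomials.\<close>

lemma Dom_0:
  assumes p: "pv_ax 0 p" shows "Dom 0 1 (\<lambda>b. b) p"
  unfolding Dom_def
proof (intro allI impI)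
  interpret weight "wk 0 1" by (rule weight_wk[OF lv_0]) simp
  fix g b assume b: "lbd g b"
  have "rho 1 * om 0 = En" by (simp add: rho_mult mult.assoc[symmetric])
  then have En: "p (mu 0 - q 1) En"
    using pv_times[OF p pv_rho[OF p, of 1] pv_om[OF p, of 0]] by (simp add: mu_def q_minus)
  have *: "p g (case z of (s, j) \<Rightarrow> cf b s j *\<^sub>R (rho s * En ^ j))" if z: "z \<in> {(s, j). cf b s j \<noteq> 0}" for z
  proof -
    obtain s j where sj: "z = (s, j)" by (cases z)
    have "p (wk 0 1 s j) (rho s * En ^ j)"
      using pv_times[OF p pv_rho[OF p, of s] pv_power[OF p En, of j]] by (simp add: wk_def)
    moreover have "g \<le> wk 0 1 s j" using b z sj by (simp add: lbd_def del: One_nat_def)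
    ultimately show ?thesis using pv_mono[OF p] pv_scaleR[OF p] sj by simp
  qed
  have "p g (sum f A)" if "finite A" "\<And>z. z \<in> A \<Longrightarrow> p g (f z)" for f and A :: "(int \<times> nat) set"
    using that by (induction A rule: finite_induct) (auto simp: pv_0[OF p] intro: pv_add[OF p])
  from this[OF finite_cf *] show "p g b" by (subst skew_sum_mon)
qed

lemma Dom_strict:
  assumes v: "good v" and k: "lv k" and Lev: "Lev k M \<epsilon> h" and inj: "inj0 h" and dom: "Dom k M h (pv v)"
    and s: "weight.slb (wk k M) g (h z)"
  shows "Fin (e g) < v (emb z)"
proof -
  interpret val v by (rule good_val[OF v])
  interpret weight "wk k M" using k Lev Lev_M by (intro weight_wk) auto
  show ?thesis
  proof (rule slb_cases[OF s])
    assume "h z = 0"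
    then have "z = 0" using inj by (auto simp: inj0_def)
    then show ?thesis by (simp add: alg_hom_0[OF hom_emb])
  next
    fix g' assume "g < g'" "lbd g' (h z)"
    then have "Fin (e g) < Fin (e g')" "Fin (e g') \<le> v (emb z)"
      using dom by (auto simp: Dom_def pv_def)
    then show ?thesis by (rule order.strict_trans2)
  qed
qed

lemma near_words:
  assumes v: "good v" and k: "lv k" and Lev: "Lev k M \<epsilon> h" and inj: "inj0 h" and dom: "Dom k M h (pv v)"
    and w: "weight.sl (wk k M) (h w) c s j" "weight.sl (wk k M) (h w') c s j" and wW: "w \<in> Wd (Suc k)"
  shows "val.near v (emb w) (emb w')"
proof -
  interpret val v by (rule good_val[OF v])
  interpret weight "wk k M" using k Lev Lev_M by (intro weight_wk) auto
  have "slb (wk k M s j) (h w - (c / c) *\<^sub>R h w')" by (rule sl_diff_slb[OF w])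
  moreover have "c \<noteq> 0" using w by (simp add: sl_def)
  ultimately have "slb (wk k M s j) (h (w - w'))" by (simp add: alg_hom_diff[OF Lev_hom[OF Lev]])
  from Dom_strict[OF v k Lev inj dom this] show ?thesis
    using word_v[OF v k Lev wW w(1)] by (simp add: near_def alg_hom_diff[OF hom_emb])
qed

text \<open>Leading monomials and coefficients are multiplicative, so both orders of the product
  give the same ones.\<close>

lemma words_commute:
  assumes v: "good v" and k: "lv k" and Lev: "Lev k M \<epsilon> h" and inj: "inj0 h" and dom: "Dom k M h (pv v)"
    and w: "w \<in> Wd (Suc k)" "w' \<in> Wd (Suc k)"
  shows "val.near v (emb w * emb w') (emb w' * emb w)"
proof -
  interpret weight "wk k M" using k Lev Lev_M by (intro weight_wk) auto
  obtain c s j where "sl (h w) c s j" using word_sl[OF k Lev w(1)] by (elim exE conjE)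
  moreover obtain c' s' j' where "sl (h w') c' s' j'" using word_sl[OF k Lev w(2)] by (elim exE conjE)
  ultimately have "sl (h (w * w')) (c * c') (s + s') (j + j')" "sl (h (w' * w)) (c * c') (s + s') (j + j')"
    using sl_times[of "h w" c s j "h w'" c' s' j'] sl_times[of "h w'" c' s' j' "h w" c s j]
    by (simp_all add: alg_hom_mult[OF Lev_hom[OF Lev]] algebra_simps)
  from near_words[OF v k Lev inj dom this Wd_times[OF w]] show ?thesis
    by (simp add: alg_hom_mult[OF hom_emb])
qed

end

text \<open>Up to integral weight 1, \<open>om (Suc k)\<close> is
  \<open>\<Omega>(T) = (T - r) U(T)\<close>. As \<open>r\<close> is a simple root,
  \<open>U(r)\<close> is nonzero and the factor \<open>U(T)\<close> can be cancelled by
  \<open>unit\<close>.\<close>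

lemma (in step2) delta_pv:
  assumes pv: "pv_ax (Suc k) pv" and dom: "Dom k M h pv"
    and unit: "\<And>P g z. poly P r \<noteq> 0 \<Longrightarrow> pv g (z * pe P T) \<Longrightarrow> pv g z"
  shows "pv \<delta> (T - of_real r)"
proof -
  obtain U where U: "\<Omega> = [:- r, 1:] * U" and Ur: "poly U r \<noteq> 0" by (rule Omega_simple_root)
  have "A.lbd (q (of_int 1 / of_nat M')) (h (om (Suc k) - pe \<Omega> T))"
    unfolding lbd_h1 by (rule om'_Omega)
  then have "pv (q (of_int 1 / of_nat M')) (om (Suc k) - pe \<Omega> T)"
    using dom by (simp only: Dom_def)
  then have "pv \<delta> (om (Suc k) - pe \<Omega> T)"
    by (rule pv_mono[OF pv]) (simp add: \<delta>_def)
  moreover have "pv \<delta> (om (Suc k))"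
    by (rule pv_mono[OF pv pv_om[OF pv order_refl]]) (simp add: \<delta>_def)
  ultimately have "pv \<delta> (om (Suc k) + (- 1) *\<^sub>R (om (Suc k) - pe \<Omega> T))"
    by (intro pv_add[OF pv] pv_scaleR[OF pv])
  moreover have "om (Suc k) + (- 1) *\<^sub>R (om (Suc k) - pe \<Omega> T) = (T - of_real r) * pe U T"
    using arg_cong[OF U, of "\<lambda>p. pe p T"] by (simp only: pe_mult) simp
  ultimately show ?thesis using unit[OF Ur] by simp
qed

context chain_div
begin

text \<open>The step is taken with the residue \<open>r\<close> of \<open>T\<close> under
  \<open>v1\<close>. By \<open>agree\<close> it is also the residue under \<open>v2\<close>, so one
  and the same next level is dominated by both.\<close>

lemma uniq_step:
  assumes v: "good v1" "good v2" and lvS: "lv (Suc k)" and Lev: "Lev k M \<epsilon> h" and inj: "inj0 h"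
    and dom: "Dom k M h (pv v1)" "Dom k M h (pv v2)"
    and agree: "\<And>w r. w \<in> Wd (Suc k) \<Longrightarrow> v1 (emb w) = Fin 0 \<Longrightarrow> Fin 0 < v1 (emb w - of_real r) \<Longrightarrow>
      Fin 0 < v2 (emb w - of_real r)"
  shows "\<exists>M' \<epsilon>' h'. Lev (Suc k) M' \<epsilon>' h' \<and> Nxt k M h M' h' \<and>
    (Dom (Suc k) M' h' (pv v1) \<and> Dom (Suc k) M' h' (pv v2))"
proof -
  have k: "lv k" using lvS lv_Suc by blast
  interpret v1: val v1 by (rule good_val[OF v(1)])
  interpret v2: val v2 by (rule good_val[OF v(2)])
  interpret weight "wk k M" using k Lev Lev_M by (intro weight_wk) auto
  note hom_h = Lev_hom[OF Lev]
  from step_data[OF lvS Lev] obtain ee f a W cW C b where D: "ee > 0" "nn k = ee * f"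
    "a * int f = int M * mm k" "coprime a (int ee)" "W \<in> Wd k" "sl (h W) cW a 0"
    "sl (h (om k)) C b 1" "wk k M b 1 = nu k" by blast
  define T where "T = W * om k ^ ee"
  have T: "T \<in> Wd (Suc k)"
    unfolding T_def using D(5) by (intro Wd_times Wd_power Wd_om Wd_mono[OF D(5)]) simp_all
  have slT: "sl (h T) (cW * C ^ ee) (a + int ee * b) ee"
    using sl_times[OF D(6) sl_power[OF D(7), of ee]]
    by (simp add: T_def alg_hom_mult[OF hom_h] alg_hom_power[OF hom_h])
  have f: "f > 0" using nn_pos[OF lvS] D(2) by (cases f) auto
  have wT: "wk k M (a + int ee * b) ee = 0"
  proof -
    have "(of_int (a * int f) :: rat) = of_int (int M * mm k)" using D(3) by (simp only:)
    then have am: "(of_int a :: rat) * of_nat f = of_nat M * of_int (mm k)" by simp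
    have "nmul ee (wk k M b 1) = q (of_nat ee * (of_int (mm k) / of_nat (nn k)))"
      unfolding D(8) nu_rat[OF lvS] by (rule q_nmul)
    also have "of_nat ee * (of_int (mm k) / of_nat (nn k)) = (of_int a / of_nat M :: rat)"
      using am D(1) f Lev_M[OF Lev] by (simp add: D(2) field_simps)
    also have "nmul ee (wk k M b 1) = wk k M (int ee * b) ee"
    proof (induction ee)
      case (Suc n)
      then show ?case using wt_add[of b "int n * b" 1 n] by (simp add: algebra_simps)
    qed (simp add: wt_0)
    finally show ?thesis
      using wt_add[of a "int ee * b" 0 ee] by (simp add: wk_def q_minus)
  qed
  have vT: "v1 (emb T) = Fin 0" "v2 (emb T) = Fin 0"
    using word_v[OF v(1) k Lev T slT] word_v[OF v(2) k Lev T slT] wT by simp_all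
  obtain r where r1: "Fin 0 < v1 (emb T - of_real r)" using good_res[OF v(1), of "emb T"] vT by auto
  have r2: "Fin 0 < v2 (emb T - of_real r)" by (rule agree[OF T vT(1) r1])
  have r_nz: "r \<noteq> 0" using r1 vT by auto
  define \<xi> where "\<xi> = r / cW"
  have cW: "cW \<noteq> 0" using D(6) by (simp add: sl_def)
  have \<xi>: "\<xi> \<noteq> 0" using r_nz cW by (simp add: \<xi>_def)
  \<comment> \<open>\<open>om (Suc k)\<close> has positive value, so its residue
    \<open>c * r ^ f - be k\<close> must vanish; this is the root equation that a step
    demands.\<close>
  have eq: "\<epsilon> powi mm k * \<xi> ^ f = be k"
  proof -
    define A where "A = rho (mm k) * om k ^ nn k"
    define c where "c = \<epsilon> powi mm k / cW ^ f"
    have "sl (h A) (\<epsilon> powi mm k * C ^ nn k) (int M * mm k + int (nn k) * b) (0 + nn k * 1)"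
      unfolding A_def alg_hom_mult[OF hom_h] alg_hom_power[OF hom_h]
      by (intro sl_times sl_power D(7) Lev_sl_rho(1)[OF k Lev])
    moreover have "sl (h T ^ f) ((cW * C ^ ee) ^ f) (int f * (a + int ee * b)) (f * ee)"
      by (rule sl_power[OF slT])
    moreover have "int f * (a + int ee * b) = int M * mm k + int (nn k) * b" "f * ee = 0 + nn k * 1"
      using D(2,3) by (simp_all add: algebra_simps)
    ultimately have "slb (wk k M (int M * mm k + int (nn k) * b) (nn k))
        (h A - (\<epsilon> powi mm k * C ^ nn k / (cW * C ^ ee) ^ f) *\<^sub>R h T ^ f)"
      using sl_diff_slb by simp
    moreover have "\<epsilon> powi mm k * C ^ nn k / (cW * C ^ ee) ^ f = c"
      using D(7) by (simp add: c_def D(2) power_mult_distrib power_mult sl_def)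
    moreover have "wk k M (int M * mm k + int (nn k) * b) (nn k) = 0"
    proof -
      have "wk k M (int f * (a + int ee * b)) (f * ee) = nmul f (wk k M (a + int ee * b) ee)"
      proof (induction f)
        case (Suc n)
        then show ?case using wt_add[of "a + int ee * b" "int n * (a + int ee * b)" ee "n * ee"]
          by (simp add: algebra_simps)
      qed (simp add: wt_0)
      then show ?thesis using D(2,3) wT by (simp add: algebra_simps)
    qed
    ultimately have "slb 0 (h (A - c *\<^sub>R T ^ f))"
      by (simp add: alg_hom_diff[OF hom_h] alg_hom_scaleR[OF hom_h] alg_hom_power[OF hom_h])
    from Dom_strict[OF v(1) k Lev inj dom(1) this]
    have 1: "Fin 0 < v1 (emb A - c *\<^sub>R emb T ^ f)"
      by (simp add: alg_hom_diff[OF hom_emb] alg_hom_scaleR[OF hom_emb] alg_hom_power[OF hom_emb])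
    have 2: "Fin 0 < v1 (emb A - of_real (be k))"
    proof -
      have "Fin 0 < v1 (emb (om (Suc k)))" using good_om[OF v(1) lvS] nu_pos[OF lvS] e_less[of 0] by simp
      then show ?thesis
        by (simp add: om.simps(2) A_def alg_hom_diff[OF hom_emb] alg_hom_of_real[OF hom_emb])
    qed
    have "Fin 0 < v1 ((emb A - of_real (be k)) - (emb A - c *\<^sub>R emb T ^ f))"
      by (rule v1.v_gt_diff[OF 2 1])
    moreover have "(emb A - of_real (be k)) - (emb A - c *\<^sub>R emb T ^ f) = pe (monom c f - [:be k:]) (emb T)"
      by (simp add: pe_diff monom_altdef pe_smult pe_power)
    ultimately have "v1 (pe (monom c f - [:be k:]) (emb T)) \<noteq> Fin 0" by auto
    then have "poly (monom c f - [:be k:]) r = 0"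
      using v1.pe_unit[OF _ r1, of "monom c f - [:be k:]"] vT(1) by (metis order_refl)
    then have "c * r ^ f = be k" by (simp add: poly_monom)
    then show ?thesis by (simp add: c_def \<xi>_def power_divide)
  qed
  from step2_ex[OF lvS Lev D \<xi> eq] obtain d c \<Psi> K
    where "step2 q lv nu mm nn be k M \<epsilon> h ee f a W cW C b \<xi> d c \<Psi> K" by blast
  then interpret S: step2 q lv nu mm nn be k M \<epsilon> h ee f a W cW C b \<xi> d c \<Psi> K .
  have ST: "S.T = T" by (simp add: S.T_def T_def)
  have Sr: "S.r = r" unfolding S.r_def using cW by (simp add: \<xi>_def)
  have "Dom (Suc k) S.M' S.h' (pv v)"
    if v: "good v" and dom: "Dom k M h (pv v)" and vT: "v (emb T) = Fin 0" and r: "Fin 0 < v (emb T - of_real r)" for v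
  proof -
    interpret v: val v by (rule good_val[OF v])
    have "pv v g z" if P: "poly P S.r \<noteq> 0" and z: "pv v g (z * pe P S.T)" for P g z
    proof -
      have "v (pe P (emb T)) = Fin 0"
        using P vT by (intro v.pe_unit[OF _ r]) (auto simp: Sr)
      then have "v (emb (z * pe P T)) = v (emb z)"
        by (cases "v (emb z)") (auto simp: alg_hom_mult[OF hom_emb] alg_hom_pe[OF hom_emb] v.v_mult)
      with z show ?thesis by (simp add: pv_def ST)
    qed
    from S.delta_pv[OF pv_ax_pv[OF v lvS] dom this]
    show ?thesis using inj by (intro S.jump pv_ax_pv[OF v lvS] dom) (auto simp: inj0_def)
  qed
  with v dom vT r1 r2 have "Dom (Suc k) S.M' S.h' (pv v1) \<and> Dom (Suc k) S.M' S.h' (pv v2)" by blast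
  then show ?thesis using S.Lev' S.Nxt by blast
qed

end

context chain_div
begin

text \<open>The index \<open>t\<close> is that of \<open>m\<^sub>t\<close> and \<open>n\<^sub>t\<close>, so \<open>lt t\<close> is \<open>\<omega>\<^sub>t\<^sub>-\<^sub>1\<close>.\<close>

definition lt :: "nat \<Rightarrow> 'd" where "lt t = (case t of 0 \<Rightarrow> x | Suc i \<Rightarrow> emb (om i))"
definition mt :: "nat \<Rightarrow> int" where "mt t = (case t of 0 \<Rightarrow> 1 | Suc i \<Rightarrow> mm i)"
definition nt :: "nat \<Rightarrow> int" where "nt t = (case t of 0 \<Rightarrow> - 1 | Suc i \<Rightarrow> int (nn i))"

lemma v_lt:
  assumes v: "good v" and k: "lv k" and t: "t \<le> k"
  shows "v (lt t) = Fin (e (q (of_int (mt t) / of_int (nt t))))"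
proof (cases t)
  case 0
  then show ?thesis using good_x[OF v] by (simp add: lt_def mt_def nt_def)
next
  case (Suc i)
  have "lv (Suc i)" using lv_le[OF k] t Suc by blast
  then show ?thesis using good_om[OF v lv_Suc] nu_rat Suc by (simp add: lt_def mt_def nt_def)
qed

lemma v_powi_q:
  assumes "good v" "v a = Fin (e (q g))" shows "v (a powi s) = Fin (e (q (of_int s * g)))"
proof -
  interpret val v by (rule good_val[OF assms(1)])
  have "(if s \<ge> 0 then nmul (nat s) (q g) else - nmul (nat (- s)) (q g)) = q (of_int s * g)"
    by (simp add: q_nmul flip: q_minus)
  with v_powi_e[OF e_add assms(2), of s] show ?thesis by simp
qed

text \<open>Up to leading terms an odd power of every letter, hence of every word, is a real
  multiple of a power of one letter \<open>lt p\<close>, with constants common to both valuations.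
  For a word of value 0 the power of \<open>lt p\<close> is trivial, and the residue is an odd root
  of the constant.\<close>

lemma agree:
  assumes v: "good v1" "good v2" and lvS: "lv (Suc k)" and Lev: "Lev k M \<epsilon> h" and inj: "inj0 h"
    and dom: "Dom k M h (pv v1)" "Dom k M h (pv v2)"
    and al: "\<And>s t. s \<le> Suc k \<Longrightarrow> t \<le> Suc k \<Longrightarrow> s \<noteq> t \<Longrightarrow> odd (mt t) \<Longrightarrow> \<exists>\<alpha>. \<alpha> \<noteq> 0 \<and> (\<forall>v\<in>{v1, v2}.
      val.near v (lt s powi ((mt t * nt s) div gcd (mt t * nt s) (mt s * nt t)))
        (\<alpha> *\<^sub>R lt t powi ((mt s * nt t) div gcd (mt t * nt s) (mt s * nt t))))"
    and w: "w \<in> Wd (Suc k)" and w0: "v1 (emb w) = Fin 0" and r: "Fin 0 < v1 (emb w - of_real r)"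
  shows "Fin 0 < v2 (emb w - of_real r)"
proof -
  have k: "lv k" using lvS lv_Suc by blast
  interpret v1: val v1 by (rule good_val[OF v(1)])
  interpret v2: val v2 by (rule good_val[OF v(2)])
  interpret weight "wk k M" using k Lev Lev_M by (intro weight_wk) auto
  have "coprime (mt t) (nt t)" "nt t \<noteq> 0" if "t \<le> Suc k" for t
    using cop nn_pos lv_le[OF lvS that] by (auto simp: mt_def nt_def split: nat.splits)
  from odd_ratio[of "Suc k" mt nt, OF this] obtain p where p: "p \<le> Suc k" "odd (mt p)"
    and odd: "\<And>t. t \<le> Suc k \<Longrightarrow> odd ((mt p * nt t) div gcd (mt p * nt t) (mt t * nt p))"
    by (auto simp: mt_def)
  have ntp: "nt p \<noteq> 0" using nn_pos lv_le[OF lvS p(1)] by (auto simp: nt_def split: nat.splits)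
  define G where "G = (\<lambda>a K B c. odd K \<and> c \<noteq> 0 \<and> v1.near (a powi K) (c *\<^sub>R lt p powi B) \<and>
    v2.near (a powi K) (c *\<^sub>R lt p powi B))"
  have ltp_nz: "lt p \<noteq> 0" using v_lt[OF v(1) lvS p(1)] v1.v_Inf by force
  have letter: "\<exists>K B c. G (lt t) K B c" if t: "t \<le> Suc k" for t
  proof (cases "t = p")
    case True
    have "G (lt t) 1 1 1" using True ltp_nz v1.near_refl v2.near_refl by (simp add: G_def)
    then show ?thesis by blast
  next
    case False
    from al[OF t p(1) this p(2)] odd[OF t] show ?thesis unfolding G_def by blast
  qed
  have powi: "(c *\<^sub>R lt p powi B) powi s = (c powi s) *\<^sub>R lt p powi (B * s)" for c B s
    by (simp add: scaleR_powi power_int_mult)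
  have word: "\<exists>K B c. G (emb w) K B c" if "w \<in> Wd (Suc k)" for w
    using that
  proof (induction rule: Wd.induct)
    case (Wd_rho s)
    from letter[of 0] obtain K B c where G: "G x K B c" by (auto simp: lt_def)
    have eq: "(x powi s) powi K = (x powi K) powi s" by (simp add: mult.commute flip: power_int_mult)
    have "G (emb (rho s)) K (B * s) (c powi s)"
      using G v1.near_powi[of "x powi K" "c *\<^sub>R lt p powi B" s] v2.near_powi[of "x powi K" "c *\<^sub>R lt p powi B" s]
      unfolding G_def emb_rho eq powi by (simp add: power_int_not_zero)
    then show ?case by blast
  next
    case (Wd_om i)
    then show ?case using letter[of "Suc i"] by (simp add: lt_def)
  next
    case (Wd_times w w')
    then obtain K B c K' B' c' where G: "G (emb w) K B c" "G (emb w') K' B' c'" by blast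
    have comb: "val.near u ((emb w * emb w') powi (K * K')) ((c powi K' * c' powi K) *\<^sub>R lt p powi (B * K' + B' * K))"
      if u: "good u" "Dom k M h (pv u)" and n: "val.near u (emb w powi K) (c *\<^sub>R lt p powi B)"
        "val.near u (emb w' powi K') (c' *\<^sub>R lt p powi B')" for u
    proof -
      interpret u: val u by (rule good_val[OF u(1)])
      have "u.near (emb w * emb w') (emb w' * emb w)"
        using words_commute[OF u(1) k Lev inj u(2)] Wd_times by blast
      then have "u.near ((emb w * emb w') powi (K * K')) (emb w powi (K * K') * emb w' powi (K * K'))"
        by (rule u.near_comm_powi)
      moreover have "u.near ((emb w powi K) powi K' * (emb w' powi K') powi K)
          ((c *\<^sub>R lt p powi B) powi K' * (c' *\<^sub>R lt p powi B') powi K)"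
        by (intro u.near_mult u.near_powi n)
      moreover have "(emb w powi K) powi K' = emb w powi (K * K')" "(emb w' powi K') powi K = emb w' powi (K * K')"
        by (simp_all add: power_int_mult[symmetric] mult.commute)
      ultimately have "u.near ((emb w * emb w') powi (K * K')) ((c *\<^sub>R lt p powi B) powi K' * (c' *\<^sub>R lt p powi B') powi K)"
        using u.near_trans by simp
      then show ?thesis by (simp add: powi power_int_add ltp_nz mult.commute[of "c powi K'"])
    qed
    have "G (emb (w * w')) (K * K') (B * K' + B' * K) (c powi K' * c' powi K)"
      using G comb[OF v(1) dom(1)] comb[OF v(2) dom(2)]
      by (simp add: G_def alg_hom_mult[OF hom_emb] power_int_not_zero)
    then show ?case by blast
  qed
  from word[OF w] obtain K B c where K: "odd K" and c: "c \<noteq> 0"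
    and n1: "v1.near (emb w powi K) (c *\<^sub>R lt p powi B)" and n2: "v2.near (emb w powi K) (c *\<^sub>R lt p powi B)"
    by (auto simp: G_def)
  have w02: "v2 (emb w) = Fin 0"
  proof -
    obtain c s j where "sl (h w) c s j" using word_sl[OF k Lev w] by (elim exE conjE)
    from word_v[OF v(1) k Lev w this] word_v[OF v(2) k Lev w this] w0 show ?thesis by simp
  qed
  \<comment> \<open>\<open>mt p\<close> is odd, so \<open>lt p\<close> has nonzero value and no
    nontrivial power of it has value 0.\<close>
  have B: "B = 0"
  proof -
    have "v1 (emb w powi K) = Fin (e (if K \<ge> 0 then nmul (nat K) 0 else - nmul (nat (- K)) 0))"
      by (rule v1.v_powi_e[OF e_add]) (simp add: w0)
    then have "v1 (emb w powi K) = Fin 0" by simp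
    then have "v1 (lt p powi B) = Fin 0" using v1.near_v[OF n1] c by (simp add: v1.v_scaleR)
    moreover have "v1 (lt p powi B) = Fin (e (q (of_int B * (of_int (mt p) / of_int (nt p)))))"
      by (rule v_powi_q[OF v(1) v_lt[OF v(1) lvS p(1)]])
    ultimately have "e (q (of_int B * (of_int (mt p) / of_int (nt p)))) = e (q 0)" by simp
    then have "of_int B * (of_int (mt p) / of_int (nt p)) = (0::rat)" by (simp only: e_eq q_eq_iff)
    then show ?thesis using p(2) ntp by auto
  qed
  have root: "s powi K = c \<and> s \<noteq> 0" if u: "val u" and u0: "u (emb w) = Fin 0" and s: "Fin 0 < u (emb w - of_real s)"
    and n: "val.near u (emb w powi K) (c *\<^sub>R lt p powi B)" for u :: "'d \<Rightarrow> 'h with_infinity" and s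
  proof -
    interpret u: val u by (rule u)
    have "u.near (emb w) (of_real s)" using u0 s by (simp add: u.near_def)
    then have "u.near (emb w powi K) (of_real s powi K)" by (rule u.near_powi)
    then have n': "u.near (of_real s powi K) (of_real c)"
      using n B u.near_trans u.near_sym by (metis of_real_def power_int_0_right)
    have s0: "s \<noteq> 0" using s u0 by auto
    have "s powi K = c"
    proof (rule ccontr)
      assume "s powi K \<noteq> c"
      then have "u (of_real (s powi K - c)) = Fin 0" by (intro u.v_of_real) simp
      moreover have "u (of_real (s powi K)) = Fin 0" using s0 by (intro u.v_of_real) (simp add: power_int_not_zero)
      ultimately show False using n' by (simp add: u.near_def)
    qed
    with s0 show ?thesis by simp
  qed
  obtain r2 where r2: "Fin 0 < v2 (emb w - of_real r2)"
    using good_res[OF v(2), of "emb w"] w02 by auto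
  have "r powi K = c \<and> r \<noteq> 0" by (rule root[OF good_val[OF v(1)] w0 r n1])
  moreover have "r2 powi K = c \<and> r2 \<noteq> 0" by (rule root[OF good_val[OF v(2)] w02 r2 n2])
  ultimately have "r = r2" using power_odd_inj[OF K, of r r2] by auto
  with r2 show ?thesis by simp
qed

text \<open>Comparison with a word of the same leading monomial: a suitable multiple of it differs
  from \<open>z\<close> only by something of larger value.\<close>

lemma sl_v:
  assumes v: "good v" and k: "lv k" and Lev: "Lev k M \<epsilon> h" and inj: "inj0 h" and dom: "Dom k M h (pv v)"
    and z: "weight.sl (wk k M) (h z) c s j"
  shows "v (emb z) = Fin (e (wk k M s j))"
proof -
  interpret val v by (rule good_val[OF v])
  interpret weight "wk k M" using k Lev Lev_M by (intro weight_wk) auto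
  obtain w c' where w: "w \<in> Wd (Suc k)" "sl (h w) c' s j" using Lev_word_ex[OF k Lev] by blast
  have "slb (wk k M s j) (h z - (c / c') *\<^sub>R h w)" by (rule sl_diff_slb[OF z w(2)])
  then have "slb (wk k M s j) (h (z - (c / c') *\<^sub>R w))"
    by (simp add: alg_hom_diff[OF Lev_hom[OF Lev]] alg_hom_scaleR[OF Lev_hom[OF Lev]])
  from Dom_strict[OF v k Lev inj dom this]
  have 1: "Fin (e (wk k M s j)) < v (emb z - (c / c') *\<^sub>R emb w)"
    by (simp add: alg_hom_diff[OF hom_emb] alg_hom_scaleR[OF hom_emb])
  have "c / c' \<noteq> 0" using z w(2) by (simp add: sl_def)
  then have 2: "v ((c / c') *\<^sub>R emb w) = Fin (e (wk k M s j))"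
    using word_v[OF v k Lev w] by (simp add: v_scaleR)
  from 1 2 have "v ((c / c') *\<^sub>R emb w + (emb z - (c / c') *\<^sub>R emb w)) = v ((c / c') *\<^sub>R emb w)"
    by (intro v_add_eq) simp
  with 2 show ?thesis by simp
qed

text \<open>Both valuations dominate a whole chain, and \<open>z\<close> has a single leading
  monomial at some level, hence the value of a word. The second conclusion serves, with
  \<open>v1 = v2\<close>, to compute the value group.\<close>

lemma uniq_val:
  assumes v: "good v1" "good v2"
    and agree: "\<And>k M \<epsilon> h w r. lv (Suc k) \<Longrightarrow> Lev k M \<epsilon> h \<Longrightarrow> inj0 h \<Longrightarrow> Dom k M h (pv v1) \<Longrightarrow> Dom k M h (pv v2) \<Longrightarrow>
      w \<in> Wd (Suc k) \<Longrightarrow> v1 (emb w) = Fin 0 \<Longrightarrow> Fin 0 < v1 (emb w - of_real r) \<Longrightarrow>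
      Fin 0 < v2 (emb w - of_real r)"
    and z: "z \<noteq> 0"
  shows "v1 (emb z) = v2 (emb z) \<and> (\<exists>k w. lv k \<and> w \<in> Wd (Suc k) \<and> v1 (emb z) = v1 (emb w))"
proof -
  let ?Q = "\<lambda>k M h. Dom k M h (pv v1) \<and> Dom k M h (pv v2)"
  have Q0: "?Q 0 1 (\<lambda>b. b)" using Dom_0 pv_ax_pv[OF v(1) lv_0] pv_ax_pv[OF v(2) lv_0] by blast
  have st: "\<exists>M' \<epsilon>' h'. Lev (Suc k) M' \<epsilon>' h' \<and> Nxt k M h M' h' \<and> ?Q (Suc k) M' h'"
    if "lv (Suc k)" "Lev k M \<epsilon> h" "inj0 h" "?Q k M h" for k M \<epsilon> h
    using that agree[OF that(1-3)] by (intro uniq_step[OF v that(1-3)]) auto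
  have "\<exists>Mf \<epsilon>f hf. (\<forall>k. lv k \<longrightarrow> Lev k (Mf k) (\<epsilon>f k) (hf k) \<and> inj0 (hf k) \<and> ?Q k (Mf k) (hf k)) \<and>
    (\<forall>k. lv (Suc k) \<longrightarrow> Nxt k (Mf k) (hf k) (Mf (Suc k)) (hf (Suc k)))"
    by (rule chain_gen[of ?Q, OF Q0]) (rule st)
  then obtain Mf \<epsilon>f hf where
    F: "\<forall>k. lv k \<longrightarrow> Lev k (Mf k) (\<epsilon>f k) (hf k) \<and> inj0 (hf k) \<and> ?Q k (Mf k) (hf k)"
    "\<forall>k. lv (Suc k) \<longrightarrow> Nxt k (Mf k) (hf k) (Mf (Suc k)) (hf (Suc k))" by (elim exE conjE)
  interpret L: levels q lv nu mm nn be Mf \<epsilon>f hf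
    by unfold_locales (use F in blast)+
  from L.Str_ex[OF z] obtain k g where k: "lv k" and "L.Str k z g" by blast
  then obtain y s j where sl: "weight.sl (wk k (Mf k)) (hf k z) y s j" by (auto simp: L.Str_def)
  from F(1) k have Lk: "Lev k (Mf k) (\<epsilon>f k) (hf k)" "inj0 (hf k)" "Dom k (Mf k) (hf k) (pv v1)" "Dom k (Mf k) (hf k) (pv v2)"
    by auto
  obtain w c' where w: "w \<in> Wd (Suc k)" "weight.sl (wk k (Mf k)) (hf k w) c' s j"
    using Lev_word_ex[OF k Lk(1)] by blast
  show ?thesis
    using sl_v[OF v(1) k Lk(1-3) sl] sl_v[OF v(2) k Lk(1,2,4) sl] word_v[OF v(1) k Lk(1) w] w(1) k
    by (intro conjI exI[of _ k] exI[of _ w]) simp_all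
qed

end

section \<open>Existence\<close>

locale levels_div = levels q lv nu mm nn be Mf \<epsilon>f hf + weyl_div x y
  for q :: "rat \<Rightarrow> 'g::linordered_ab_group_add" and lv :: "nat \<Rightarrow> bool" and nu :: "nat \<Rightarrow> 'g"
    and mm :: "nat \<Rightarrow> int" and nn :: "nat \<Rightarrow> nat" and be :: "nat \<Rightarrow> real" and Mf \<epsilon>f hf
    and x y :: "'d::real_div_algebra" +
  assumes frac: "\<exists>a b. b \<noteq> 0 \<and> z = emb a * inverse (emb b)"
begin

definition Val :: "skew \<Rightarrow> 'g \<Rightarrow> bool" where
  "Val b g \<longleftrightarrow> (\<exists>k. lv k \<and> Str k b g)"

lemma Val_nz: "Val b g \<Longrightarrow> b \<noteq> 0"
proof
  assume "Val b g" "b = 0"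
  then obtain k y s j where k: "lv k" "weight.sl (wl k) (hf k 0) y s j" by (auto simp: Val_def Str_def)
  have "hf k 0 = 0" using alg_hom_0[OF Lev_hom[OF Levf[OF k(1)]]] .
  with k show False using weight.sl_def[OF weight_wl[OF k(1)]] by simp
qed

lemma Val_ex: "b \<noteq> 0 \<Longrightarrow> \<exists>g. Val b g"
  using Str_ex unfolding Val_def by blast

lemma Str_common:
  assumes "Val b g" "Val c h"
  obtains k where "lv k" "Str k b g" "Str k c h"
proof -
  from assms obtain i j where ij: "lv i" "Str i b g" "lv j" "Str j c h" by (auto simp: Val_def)
  then have "lv (max i j)" by (simp add: max_def)
  then show ?thesis using that[of "max i j"] ij Str_mono by simp
qed

lemma Str_unique: "lv k \<Longrightarrow> Str k b g \<Longrightarrow> Str k b h \<Longrightarrow> g = h"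
  unfolding Str_def using weight.lead_unique[OF weight_wl] weight.sl_lead[OF weight_wl] by metis

lemma Val_unique: "Val b g \<Longrightarrow> Val b h \<Longrightarrow> g = h"
  using Str_common Str_unique by metis

lemma Val_mult: "Val b g \<Longrightarrow> Val c h \<Longrightarrow> Val (b * c) (g + h)"
proof (rule Str_common)
  fix k assume k: "lv k" "Str k b g" "Str k c h"
  interpret weight "wl k" by (rule weight_wl[OF k(1)])
  from k obtain y s j y' s' j' where 1: "sl (hf k b) y s j" "wl k s j = g" "j = 0 \<or> \<not> lv (Suc k)"
    "sl (hf k c) y' s' j'" "wl k s' j' = h" "j' = 0 \<or> \<not> lv (Suc k)" by (auto simp: Str_def)
  have "sl (hf k (b * c)) (y * y') (s + s') (j + j')"
    using sl_times[OF 1(1,4)] by (simp add: alg_hom_mult[OF Lev_hom[OF Levf[OF k(1)]]])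
  moreover have "wl k (s + s') (j + j') = g + h" using 1 by (simp add: wt_add)
  ultimately have "Str k (b * c) (g + h)" using 1(3,6) unfolding Str_def by auto
  then show ?thesis using k by (auto simp: Val_def)
qed

lemma lbd_mono_level:
  assumes "weight.lbd (wl k) g (hf k z)" "k \<le> l" "lv l"
  shows "weight.lbd (wl l) g (hf l z)"
  using assms(2,3)
proof (induction l rule: dec_induct)
  case (step n)
  then have "weight.lbd (wl n) g (hf n z)" using lv_Suc by blast
  then show ?case using Nxtf[OF step.prems] unfolding Nxt_def by blast
qed (use assms in simp)

text \<open>The approximations increase, so the bound persists up to a level at which
  \<open>b\<close> has reached its final value.\<close>

lemma Val_lbd:
  assumes k: "lv k" and b: "weight.lbd (wl k) g (hf k b)" and V: "Val b f"
  shows "g \<le> f"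
proof -
  from V obtain i where i: "lv i" "Str i b f" by (auto simp: Val_def)
  define l where "l = max i k"
  have l: "lv l" "i \<le> l" "k \<le> l" using i(1) k by (auto simp: l_def max_def)
  interpret weight "wl l" by (rule weight_wl[OF l(1)])
  have "lbd g (hf l b)" using lbd_mono_level[OF b l(3,1)] .
  moreover obtain y s j where "sl (hf l b) y s j" "wl l s j = f" using Str_mono[OF i(2) l(2,1)] by (auto simp: Str_def)
  ultimately show ?thesis using lbd_leadD sl_lead by blast
qed

lemma Val_add:
  assumes "Val b g" "Val c h" "Val (b + c) f" shows "min g h \<le> f"
proof (rule Str_common[OF assms(1,2)])
  fix k assume k: "lv k" "Str k b g" "Str k c h"
  interpret weight "wl k" by (rule weight_wl[OF k(1)])
  have "lbd g (hf k b)" "lbd h (hf k c)" using k sl_lbd by (auto simp: Str_def)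
  then have "lbd (min g h) (hf k b)" "lbd (min g h) (hf k c)" by (auto intro: lbd_mono)
  then have "lbd (min g h) (hf k (b + c))"
    by (simp add: alg_hom_add[OF Lev_hom[OF Levf[OF k(1)]]] lbd_add)
  from Val_lbd[OF k(1) this assms(3)] show ?thesis .
qed

lemma Val_rho: "Val (rho s) (q (- of_int s))"
proof -
  have "Str 0 (rho s) (q (- of_int s))"
    unfolding Str_def using Lev_sl_rho[OF lv_0 Levf[OF lv_0]] by blast
  then show ?thesis using lv_0 by (auto simp: Val_def)
qed

lemma Val_of_real: "r \<noteq> 0 \<Longrightarrow> Val (of_real r) 0"
proof -
  assume r: "r \<noteq> 0"
  interpret weight "wl 0" by (rule weight_wl[OF lv_0])
  have "sl (of_real r) r 0 0" using r by (auto simp: sl_def cf_of_real)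
  then have "Str 0 (of_real r) 0"
    unfolding Str_def using wt_0 by (auto simp: alg_hom_of_real[OF Lev_hom[OF Levf[OF lv_0]]])
  then show ?thesis using lv_0 by (auto simp: Val_def)
qed

lemma Val_om: "lv i \<Longrightarrow> Val (om i) (nu i)"
proof (cases "lv (Suc i)")
  case True
  then have "Str (Suc i) (om i) (nu i)" using Lev_om[OF Levf[OF True], of i] by (auto simp: Str_def)
  then show ?thesis using True by (auto simp: Val_def)
next
  case False
  assume i: "lv i"
  then have "Str i (om i) (nu i)" using Lev_omk[OF Levf[OF i]] False unfolding Str_def by blast
  then show ?thesis using i by (auto simp: Val_def)
qed

text \<open>Equal final values force equal leading monomials: before the last level the degrees in
  \<open>E\<close> are 0, and at the last level \<open>wl_inj\<close> applies. The quotient of the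
  coefficients is then the required real number.\<close>

lemma Val_res:
  assumes "Val b g" "Val c g"
  shows "\<exists>r. b = r *\<^sub>R c \<or> (\<exists>f>g. Val (b - r *\<^sub>R c) f)"
proof (rule Str_common[OF assms])
  fix k assume k: "lv k" "Str k b g" "Str k c g"
  interpret weight "wl k" by (rule weight_wl[OF k(1)])
  from k obtain y s j y' s' j' where 1: "sl (hf k b) y s j" "wl k s j = g" "j = 0 \<or> \<not> lv (Suc k)"
    "sl (hf k c) y' s' j'" "wl k s' j' = g" "j' = 0 \<or> \<not> lv (Suc k)" by (auto simp: Str_def)
  have "j = j'" using 1 wl_inj[OF k(1), of s j s' j'] by auto
  have "wl k s j = wl k s' j" using 1 \<open>j = j'\<close> by simp
  then have "s = s'" unfolding wt_eq_int_iff .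
  with \<open>j = j'\<close> 1 have "slb g (hf k b - (y / y') *\<^sub>R hf k c)" using sl_diff_slb by blast
  then have "slb g (hf k (b - (y / y') *\<^sub>R c))"
    by (simp add: alg_hom_diff[OF Lev_hom[OF Levf[OF k(1)]]] alg_hom_scaleR[OF Lev_hom[OF Levf[OF k(1)]]])
  then show ?thesis
  proof (rule slb_cases)
    assume "hf k (b - (y / y') *\<^sub>R c) = 0"
    then have "b - (y / y') *\<^sub>R c = 0" using injf[OF k(1)] unfolding inj0_def by blast
    then show ?thesis by (intro exI[of _ "y / y'"]) simp
  next
    fix f' assume f': "g < f'" "lbd f' (hf k (b - (y / y') *\<^sub>R c))"
    show ?thesis
    proof (cases "b - (y / y') *\<^sub>R c = 0")
      case False
      then obtain f where f: "Val (b - (y / y') *\<^sub>R c) f" using Val_ex by blast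
      from Val_lbd[OF k(1) f'(2) f] f'(1) have "g < f" by simp
      with f show ?thesis by blast
    qed (auto intro: exI[of _ "y / y'"])
  qed
qed

text \<open>A relation until \<open>VD_eq\<close> shows independence of the fraction. The
  constructed values lie in the commutative group \<open>'g\<close>, so numerator and denominator
  may be treated separately.\<close>

definition VD :: "'d \<Rightarrow> 'g \<Rightarrow> bool" where
  "VD a g \<longleftrightarrow> (\<exists>b c g1 g2. Val b g1 \<and> Val c g2 \<and> a = emb b * inverse (emb c) \<and> g = g1 - g2)"

lemma emb_eq: "emb a = emb b \<Longrightarrow> a = b"
  using emb_nonzero[of "a - b"] by (auto simp: alg_hom_diff[OF hom_emb])

text \<open>The Ore condition is contained in \<open>frac\<close>: it suffices to write
  \<open>inverse c * b\<close> as a right fraction and clear denominators.\<close>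

lemma ore: "(c :: skew) \<noteq> 0 \<Longrightarrow> \<exists>p r. r \<noteq> 0 \<and> b * r = c * p"
proof -
  assume c: "c \<noteq> 0"
  obtain p r where r: "r \<noteq> 0" and eq: "inverse (emb c) * emb b = emb p * inverse (emb r)"
    using frac by blast
  have "emb b = emb c * (inverse (emb c) * emb b)"
    using emb_nonzero[OF c] by (simp add: mult.assoc[symmetric])
  also have "\<dots> = emb c * emb p * inverse (emb r)" by (simp only: eq mult.assoc)
  finally have "emb b * emb r = emb c * emb p"
    using emb_nonzero[OF r] by (simp add: mult.assoc)
  then have "emb (b * r) = emb (c * p)" by (simp add: alg_hom_mult[OF hom_emb])
  with r show ?thesis using emb_eq by blast
qed

lemma skew_mult_nz: "a \<noteq> 0 \<Longrightarrow> b \<noteq> 0 \<Longrightarrow> a * b \<noteq> (0 :: skew)"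
  using Val_ex Val_mult Val_nz by metis

lemma frac_expand:
  assumes "c \<noteq> 0" "r \<noteq> 0"
  shows "emb b * inverse (emb c) = emb (b * r) * inverse (emb (c * r))"
  using emb_nonzero[OF assms(1)] emb_nonzero[OF assms(2)]
  by (simp add: alg_hom_mult[OF hom_emb] nonzero_inverse_mult_distrib mult.assoc)
    (simp add: mult.assoc[symmetric])

lemma common_den:
  "\<exists>b c m. m \<noteq> 0 \<and> z = emb b * inverse (emb m) \<and> z' = emb c * inverse (emb m)"
proof -
  obtain a b where ab: "b \<noteq> 0" "z = emb a * inverse (emb b)" using frac by blast
  obtain a' b' where ab': "b' \<noteq> 0" "z' = emb a' * inverse (emb b')" using frac by blast
  obtain p r where pr: "r \<noteq> 0" "b' * r = b * p" using ore[OF ab(1)] by blast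
  then have p: "p \<noteq> 0" using skew_mult_nz[OF ab'(1) pr(1)] by auto
  have "z = emb (a * p) * inverse (emb (b * p))" using ab frac_expand[OF ab(1) p] by simp
  moreover have "z' = emb (a' * r) * inverse (emb (b * p))" using ab' frac_expand[OF ab'(1) pr(1)] pr by simp
  moreover have "b * p \<noteq> 0" by (rule skew_mult_nz[OF ab(1) p])
  ultimately show ?thesis by blast
qed

lemma VD_ex: "a \<noteq> 0 \<Longrightarrow> \<exists>g. VD a g"
proof -
  assume a: "a \<noteq> 0"
  obtain b c where bc: "c \<noteq> 0" "a = emb b * inverse (emb c)" using frac by blast
  then have "b \<noteq> 0" using a by (auto simp: alg_hom_0[OF hom_emb])
  with bc show ?thesis using Val_ex unfolding VD_def by metis
qed

lemma VD_eq:
  assumes "VD a g" "a = emb b * inverse (emb m)" "Val b h" "Val m h'"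
  shows "g = h - h'"
proof -
  from assms(1) obtain b' c' g1 g2 where 1: "Val b' g1" "Val c' g2" "a = emb b' * inverse (emb c')" "g = g1 - g2"
    by (auto simp: VD_def)
  note nz = Val_nz[OF 1(1)] Val_nz[OF 1(2)] Val_nz[OF assms(3)] Val_nz[OF assms(4)]
  obtain p r where pr: "r \<noteq> 0" "m * r = c' * p" using ore[OF nz(2)] by blast
  have p: "p \<noteq> 0" using pr skew_mult_nz[OF nz(4) pr(1)] by auto
  have "emb (b * r) * inverse (emb (m * r)) = emb (b' * p) * inverse (emb (c' * p))"
    using frac_expand[OF nz(4) pr(1)] frac_expand[OF nz(2) p] assms(2) 1(3) by simp
  moreover have "emb (m * r) \<noteq> 0" by (intro emb_nonzero skew_mult_nz nz pr)
  ultimately have "emb (b * r) = emb (b' * p)" using pr(2) by simp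
  then have eq: "b * r = b' * p" by (rule emb_eq)
  obtain vp vr where "Val p vp" "Val r vr" using Val_ex p pr(1) by blast
  with Val_mult[OF assms(4)] Val_mult[OF 1(2)] Val_mult[OF assms(3)] Val_mult[OF 1(1)] eq pr(2)
  have "h' + vr = g2 + vp" "h + vr = g1 + vp" using Val_unique by metis+
  then show ?thesis using 1(4) by (simp add: algebra_simps) (metis add.assoc add.commute add_left_cancel)
qed

lemma VD_nz: "VD a g \<Longrightarrow> a \<noteq> 0"
  using Val_nz emb_nonzero by (auto simp: VD_def)

lemma VD_unique: "VD a g \<Longrightarrow> VD a h \<Longrightarrow> g = h"
  unfolding VD_def[of a h] using VD_eq by metis

lemma VD_emb: "Val b g \<Longrightarrow> VD (emb b) g"
  unfolding VD_def using Val_of_real[of 1] by (intro exI[of _ b] exI[of _ 1] exI[of _ g] exI[of _ 0])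
    (simp add: alg_hom_1[OF hom_emb])

lemma VD_mult:
  assumes "VD a g" "VD b h" shows "VD (a * b) (g + h)"
proof -
  from assms(1) obtain a1 a2 g1 g2 where a: "Val a1 g1" "Val a2 g2" "a = emb a1 * inverse (emb a2)" "g = g1 - g2"
    by (auto simp: VD_def)
  from assms(2) obtain b1 b2 h1 h2 where b: "Val b1 h1" "Val b2 h2" "b = emb b1 * inverse (emb b2)" "h = h1 - h2"
    by (auto simp: VD_def)
  note nz = Val_nz[OF a(1)] Val_nz[OF a(2)] Val_nz[OF b(1)] Val_nz[OF b(2)]
  obtain p r where pr: "r \<noteq> 0" "b1 * r = a2 * p" using ore[OF nz(2)] by blast
  have p: "p \<noteq> 0" using pr skew_mult_nz[OF nz(3) pr(1)] by auto
  obtain vp vr where V: "Val p vp" "Val r vr" using Val_ex p pr(1) by blast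
  have "h1 + vr = g2 + vp" using Val_mult[OF b(1) V(2)] Val_mult[OF a(2) V(1)] pr(2) Val_unique by metis
  then have "g + h = (g1 + vp) - (h2 + vr)" using a(4) b(4) by (simp add: algebra_simps) (metis add.assoc add.commute)
  moreover have "a * b = emb (a1 * p) * inverse (emb (b2 * r))"
  proof -
    have "b = emb (a2 * p) * inverse (emb (b2 * r))" using b(3) frac_expand[OF nz(4) pr(1)] pr(2) by simp
    then show ?thesis using a(3) emb_nonzero[OF nz(2)]
      by (simp add: alg_hom_mult[OF hom_emb] mult.assoc) (simp add: mult.assoc[symmetric])
  qed
  ultimately show ?thesis unfolding VD_def using Val_mult[OF a(1) V(1)] Val_mult[OF b(2) V(2)] by blast
qed

lemma VD_den:
  assumes "VD a g" "m \<noteq> 0" "a = emb b * inverse (emb m)" "Val m h"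
  shows "Val b (g + h)"
proof -
  have "b \<noteq> 0" using VD_nz[OF assms(1)] assms(3) by (auto simp: alg_hom_0[OF hom_emb])
  then obtain g1 where "Val b g1" using Val_ex by blast
  with VD_eq[OF assms(1,3) this assms(4)] show ?thesis by simp
qed

lemma VD_num: "Val b g \<Longrightarrow> Val m h \<Longrightarrow> VD (emb b * inverse (emb m)) (g - h)"
  unfolding VD_def by blast

lemma VD_add:
  assumes "VD a g" "VD b h" "VD (a + b) f" shows "min g h \<le> f"
proof -
  obtain a1 b1 m where m: "m \<noteq> 0" "a = emb a1 * inverse (emb m)" "b = emb b1 * inverse (emb m)"
    using common_den by blast
  obtain vm where vm: "Val m vm" using Val_ex m(1) by blast
  have ab: "a + b = emb (a1 + b1) * inverse (emb m)"
    using m by (simp add: alg_hom_add[OF hom_emb] distrib_right)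
  have "min (g + vm) (h + vm) \<le> f + vm"
    using VD_den[OF assms(1) m(1,2) vm] VD_den[OF assms(2) m(1,3) vm] VD_den[OF assms(3) m(1) ab vm]
    by (rule Val_add)
  then show ?thesis by (auto simp: min_def split: if_splits)
qed

lemma VD_res:
  assumes "VD a g" "VD b g"
  shows "\<exists>r. a = r *\<^sub>R b \<or> (\<exists>f>g. VD (a - r *\<^sub>R b) f)"
proof -
  obtain a1 b1 m where m: "m \<noteq> 0" "a = emb a1 * inverse (emb m)" "b = emb b1 * inverse (emb m)"
    using common_den by blast
  obtain vm where vm: "Val m vm" using Val_ex m(1) by blast
  from Val_res[OF VD_den[OF assms(1) m(1,2) vm] VD_den[OF assms(2) m(1,3) vm]] obtain r
    where r: "a1 = r *\<^sub>R b1 \<or> (\<exists>f>g + vm. Val (a1 - r *\<^sub>R b1) f)" by blast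
  have ab: "a - r *\<^sub>R b = emb (a1 - r *\<^sub>R b1) * inverse (emb m)"
    using m by (simp add: alg_hom_diff[OF hom_emb] alg_hom_scaleR[OF hom_emb] left_diff_distrib)
  show ?thesis
  proof (cases "a1 = r *\<^sub>R b1")
    case True
    then have "a - r *\<^sub>R b = 0" using ab by (simp add: alg_hom_0[OF hom_emb])
    then show ?thesis by (intro exI[of _ r]) simp
  next
    case False
    with r obtain f where f: "f > g + vm" "Val (a1 - r *\<^sub>R b1) f" by blast
    have "VD (a - r *\<^sub>R b) (f - vm)" unfolding ab by (rule VD_num[OF f(2) vm])
    moreover have "g < f - vm" using f(1) by (simp add: less_diff_eq)
    ultimately show ?thesis by blast
  qed
qed

definition vD :: "'d \<Rightarrow> 'g with_infinity" where
  "vD a = (if a = 0 then Infinity else Fin (THE g. VD a g))"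

lemma vD_Fin: "vD a = Fin g \<longleftrightarrow> VD a g"
proof (cases "a = 0")
  case False
  then obtain h where h: "VD a h" using VD_ex by blast
  then have "(THE g. VD a g) = h" using VD_unique by blast
  with False h show ?thesis using VD_unique by (auto simp: vD_def)
qed (use VD_nz in \<open>auto simp: vD_def\<close>)

lemma vD_Inf: "vD a = Infinity \<longleftrightarrow> a = 0"
  by (simp add: vD_def)

lemma val_vD: "val vD"
proof
  show "valuation vD"
    unfolding valuation_def
  proof (intro conjI allI)
    show "(vD a = Infinity) = (a = 0)" for a by (rule vD_Inf)
    show "vD (a * b) = vD a + vD b" for a b
    proof (cases "a = 0 \<or> b = 0")
      case False
      then obtain g h where "VD a g" "VD b h" using VD_ex by blast
      then show ?thesis using VD_mult by (metis vD_Fin plus_with_infinity.simps(1))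
    qed (auto simp: vD_def)
    show "min (vD a) (vD b) \<le> vD (a + b)" for a b
    proof (cases "a = 0 \<or> b = 0 \<or> a + b = 0")
      case False
      then obtain g h f where "VD a g" "VD b h" "VD (a + b) f" using VD_ex by blast
      moreover from VD_add[OF this] have "Fin (min g h) \<le> Fin f" by simp
      ultimately show ?thesis by (metis vD_Fin less_eq_with_infinity.simps(1) min_def)
    qed (auto simp: vD_def min_def)
  qed
  show "trivial_on_reals vD"
    unfolding trivial_on_reals_def zero_with_infinity_def
    using VD_emb[OF Val_of_real] by (simp add: vD_Fin alg_hom_of_real[OF hom_emb])
qed

lemma vD_x: "vD x = Fin (q (- 1))"
  using VD_emb[OF Val_rho[of 1]] by (simp add: vD_Fin emb_rho)

lemma vD_om: "lv i \<Longrightarrow> vD (emb (om i)) = Fin (nu i)"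
  using VD_emb[OF Val_om] by (simp add: vD_Fin)

lemma vD_res: "Fin 0 \<le> vD a \<Longrightarrow> \<exists>r. Fin 0 < vD (a - of_real r)"
proof -
  assume a: "Fin 0 \<le> vD a"
  show ?thesis
  proof (cases "Fin 0 < vD a")
    case True
    then show ?thesis by (intro exI[of _ 0]) simp
  next
    case False
    with a have "vD a = Fin 0" by simp
    then have "VD a 0" by (simp add: vD_Fin)
    moreover have "VD 1 0" using VD_emb[OF Val_of_real[of 1]] by (simp add: alg_hom_1[OF hom_emb])
    ultimately obtain r where "a = r *\<^sub>R 1 \<or> (\<exists>f>0. VD (a - r *\<^sub>R 1) f)" using VD_res by blast
    then show ?thesis
    proof
      assume "a = r *\<^sub>R 1"
      then show ?thesis by (intro exI[of _ r]) (simp add: vD_def of_real_def)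
    next
      assume "\<exists>f>0. VD (a - r *\<^sub>R 1) f"
      then obtain f where "f > 0" "vD (a - of_real r) = Fin f" by (auto simp: vD_Fin of_real_def)
      then show ?thesis by (intro exI[of _ r]) simp
    qed
  qed
qed

end

section \<open>Residue field and value group\<close>

context val
begin

lemma mem_residue: "b \<in> residue v a \<longleftrightarrow> Fin 0 < v (b - a)"
proof -
  have "residue v a = {h + a | h. Fin 0 < v h}"
    unfolding residue_def a_r_coset_def'
    by (auto simp: valuation_ring_def ring_of_def maximal_ideal_of_def zero_with_infinity_def)
  then show ?thesis by (auto intro: exI[of _ "b - a"])
qed

lemma residue_eq_iff: "residue v a = residue v b \<longleftrightarrow> Fin 0 < v (a - b)"
proof
  assume eq: "residue v a = residue v b"
  have "a \<in> residue v a" by (simp add: mem_residue)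
  then have "a \<in> residue v b" by (simp only: eq)
  then show "Fin 0 < v (a - b)" by (simp add: mem_residue)
next
  assume ab: "Fin 0 < v (a - b)"
  then have ba: "Fin 0 < v (b - a)" by (simp only: v_minus_commute[of b a])
  show "residue v a = residue v b"
  proof (intro Set.set_eqI iffI)
    fix c
    show "c \<in> residue v b" if "c \<in> residue v a"
      using v_gt_add[OF that[unfolded mem_residue] ab] by (simp only: mem_residue diff_add_cancel add_diff_eq)
    show "c \<in> residue v a" if "c \<in> residue v b"
      using v_gt_add[OF that[unfolded mem_residue] ba] by (simp only: mem_residue diff_add_cancel add_diff_eq)
  qed
qed

lemma residue_field_simps:
  "carrier (residue_field v) = {residue v a | a. Fin 0 \<le> v a}"
  "A \<otimes>\<^bsub>residue_field v\<^esub> B = (\<Union>a\<in>A. \<Union>b\<in>B. residue v (a * b))"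
  "A \<oplus>\<^bsub>residue_field v\<^esub> B = {a + b | a b. a \<in> A \<and> b \<in> B}"
  "\<one>\<^bsub>residue_field v\<^esub> = residue v 1"
  by (auto simp: residue_field_def FactRing_def A_RCOSETS_def' rcoset_mult_def set_add_def'
      residue_def valuation_ring_def ring_of_def zero_with_infinity_def)

lemma residue_field_is_realD:
  assumes "residue_field_is_real v" "Fin 0 \<le> v a"
  shows "\<exists>r. Fin 0 < v (a - of_real r)"
proof -
  have "residue v a \<in> carrier (residue_field v)" using assms(2) by (auto simp: residue_field_simps)
  moreover have "(\<lambda>r. residue v (of_real r)) ` UNIV = carrier (residue_field v)"
    using assms(1) by (simp add: residue_field_is_real_def ring_iso_def bij_betw_def ring_of_def)
  ultimately obtain r where "residue v a = residue v (of_real r)" by (metis imageE)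
  then show ?thesis by (auto simp: residue_eq_iff)
qed

lemma residue_mult:
  "(\<Union>a\<in>residue v (of_real r). \<Union>b\<in>residue v (of_real s). residue v (a * b)) = residue v (of_real (r * s))"
proof -
  have "residue v (a * b) = residue v (of_real (r * s))"
    if "a \<in> residue v (of_real r)" "b \<in> residue v (of_real s)" for a b
  proof -
    have a: "Fin 0 < v (a - of_real r)" and b: "Fin 0 < v (b - of_real s)" using that by (simp_all add: mem_residue)
    have "v a \<ge> Fin 0" using v_ge_add[of "Fin 0" "a - of_real r" "of_real r"] a v_of_real_ge by simp
    then have "Fin 0 < v (a * (b - of_real s))"
      using b by (cases "v a"; cases "v (b - of_real s)") (auto simp: v_mult dest: add_strict_mono_lo2[of 0 _ 0])
    moreover have "Fin 0 < v ((a - of_real r) * of_real s)"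
      using a v_of_real_ge[of s]
      by (cases "v (a - of_real r)"; cases "v (of_real s)") (auto simp: v_mult dest: add_strict_mono_lo1[of 0 _ 0])
    ultimately have "Fin 0 < v (a * (b - of_real s) + (a - of_real r) * of_real s)" by (rule v_gt_add)
    then show ?thesis by (simp add: residue_eq_iff algebra_simps)
  qed
  moreover have "of_real r \<in> residue v (of_real r)" for r by (simp add: mem_residue)
  ultimately show ?thesis by blast
qed

lemma residue_add:
  "{a + b | a b. a \<in> residue v (of_real r) \<and> b \<in> residue v (of_real s)} = residue v (of_real (r + s))"
proof (intro Set.set_eqI iffI)
  fix c
  assume "c \<in> {a + b | a b. a \<in> residue v (of_real r) \<and> b \<in> residue v (of_real s)}"
  then obtain a b where "c = a + b" "Fin 0 < v (a - of_real r)" "Fin 0 < v (b - of_real s)"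
    by (auto simp: mem_residue)
  then show "c \<in> residue v (of_real (r + s))"
    using v_gt_add[of "Fin 0" "a - of_real r" "b - of_real s"] by (simp add: mem_residue algebra_simps)
next
  fix c
  assume "c \<in> residue v (of_real (r + s))"
  then have "c - of_real s \<in> residue v (of_real r)" by (simp add: mem_residue algebra_simps)
  moreover have "of_real s \<in> residue v (of_real s)" by (simp add: mem_residue)
  moreover have "c = (c - of_real s) + of_real s" by simp
  ultimately show "c \<in> {a + b | a b. a \<in> residue v (of_real r) \<and> b \<in> residue v (of_real s)}" by blast
qed

lemma residue_field_is_realI:
  assumes "\<And>a. Fin 0 \<le> v a \<Longrightarrow> \<exists>r. Fin 0 < v (a - of_real r)"
  shows "residue_field_is_real v"
  unfolding residue_field_is_real_def
proof (rule ring_iso_memI)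
  show "residue v (of_real r) \<in> carrier (residue_field v)" for r
    using v_of_real_ge by (auto simp: residue_field_simps)
  show "residue v (of_real (r \<otimes>\<^bsub>ring_of UNIV\<^esub> s)) = residue v (of_real r) \<otimes>\<^bsub>residue_field v\<^esub> residue v (of_real s)" for r s
    unfolding residue_field_simps residue_mult by (simp add: ring_of_def)
  show "residue v (of_real (r \<oplus>\<^bsub>ring_of UNIV\<^esub> s)) = residue v (of_real r) \<oplus>\<^bsub>residue_field v\<^esub> residue v (of_real s)" for r s
    unfolding residue_field_simps residue_add by (simp add: ring_of_def)
  show "residue v (of_real \<one>\<^bsub>ring_of UNIV\<^esub>) = \<one>\<^bsub>residue_field v\<^esub>"
    by (simp add: residue_field_simps ring_of_def)
  show "bij_betw (\<lambda>r. residue v (of_real r)) (carrier (ring_of UNIV)) (carrier (residue_field v))"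
    unfolding bij_betw_def
  proof
    show "inj_on (\<lambda>r. residue v (of_real r)) (carrier (ring_of UNIV))"
    proof (rule inj_onI)
      fix r s :: real
      assume "residue v (of_real r) = residue v (of_real s)"
      then have "Fin 0 < v (of_real (r - s))" by (simp add: residue_eq_iff)
      then show "r = s" using v_of_real[of "r - s"] by (cases "r - s = 0") auto
    qed
    show "(\<lambda>r. residue v (of_real r)) ` carrier (ring_of UNIV) = carrier (residue_field v)"
    proof (intro equalityI subsetI)
      fix A assume "A \<in> carrier (residue_field v)"
      then obtain a where a: "A = residue v a" "Fin 0 \<le> v a" by (auto simp: residue_field_simps)
      with assms obtain r where "Fin 0 < v (a - of_real r)" by blast
      then have "A = residue v (of_real r)" using a by (simp add: residue_eq_iff)
      then show "A \<in> (\<lambda>r. residue v (of_real r)) ` carrier (ring_of UNIV)" by (simp add: ring_of_def)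
    qed (use v_of_real_ge in \<open>auto simp: residue_field_simps\<close>)
  qed
qed

end

section \<open>Generated subgroups and subgroups of \<open>\<rat> \<times> \<int>\<close>\<close>

lemma group_add_group: "group (add_group (UNIV :: 'a::group_add set))"
  by (rule groupI) (auto simp: add_group_def add.assoc intro: exI[of _ "- _"] right_minus left_minus)

lemma inv_add_group: "inv\<^bsub>add_group UNIV\<^esub> a = - (a :: 'a::group_add)"
  using group.inv_equality[OF group_add_group, of "- a" a] by (simp add: add_group_def)

lemma generate_add_group:
  fixes S :: "'a::group_add set"
  shows "0 \<in> generate (add_group UNIV) S" "a \<in> S \<Longrightarrow> a \<in> generate (add_group UNIV) S"
    "a \<in> generate (add_group UNIV) S \<Longrightarrow> b \<in> generate (add_group UNIV) S \<Longrightarrow> a + b \<in> generate (add_group UNIV) S"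
    "a \<in> generate (add_group UNIV) S \<Longrightarrow> - a \<in> generate (add_group UNIV) S"
proof -
  show "0 \<in> generate (add_group UNIV) S" using generate.one[of "add_group UNIV" S] by (simp add: add_group_def)
  show "a \<in> S \<Longrightarrow> a \<in> generate (add_group UNIV) S" by (rule generate.incl)
  show "a \<in> generate (add_group UNIV) S \<Longrightarrow> b \<in> generate (add_group UNIV) S \<Longrightarrow> a + b \<in> generate (add_group UNIV) S"
    using generate.eng[of a "add_group UNIV" S b] by (simp add: add_group_def)
  show "a \<in> generate (add_group UNIV) S \<Longrightarrow> - a \<in> generate (add_group UNIV) S"
    using group.generate_m_inv_closed[OF group_add_group, of S a] unfolding inv_add_group by (simp add: add_group_def)
qed

lemma generate_add_group_induct [consumes 1, case_names zero incl minus plus]: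
  fixes S :: "'a::group_add set"
  assumes "a \<in> generate (add_group UNIV) S" "P 0" "\<And>a. a \<in> S \<Longrightarrow> P a" "\<And>a. P a \<Longrightarrow> P (- a)"
    "\<And>a b. P a \<Longrightarrow> P b \<Longrightarrow> P (a + b)"
  shows "P a"
  using assms(1)
proof (induction rule: generate.induct)
  case one
  then show ?case using assms(2) by (simp add: add_group_def)
next
  case (inv h)
  then show ?case using assms(3,4) by (simp add: inv_add_group)
next
  case (eng h1 h2)
  then show ?case using assms(5) by (simp add: add_group_def)
qed (use assms(3) in auto)

lemma (in val) carrier_value_group:
  "carrier (value_group v) = {g. \<exists>a. v a = Fin g}"
  by (simp add: value_group_def add_group_def)

lemma (in val) generate_subset_value_group:
  assumes "\<And>g. g \<in> S \<Longrightarrow> \<exists>a. v a = Fin g"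
  shows "generate (add_group UNIV) S \<subseteq> carrier (value_group v)"
proof
  fix g assume "g \<in> generate (add_group UNIV) S"
  then show "g \<in> carrier (value_group v)"
    unfolding carrier_value_group
  proof (induction rule: generate_add_group_induct)
    case zero
    show ?case using v_1 by blast
  next
    case (minus a)
    then show ?case using v_inverse by blast
  next
    case (plus a b)
    then obtain y z where "v y = Fin a" "v z = Fin b" by blast
    then have "v (y * z) = Fin (a + b)" by (simp add: v_mult)
    then show ?case by blast
  qed (use assms in auto)
qed

abbreviation "QZ \<equiv> add_group (UNIV :: rat set) \<times>\<times> add_group (UNIV :: int set)"

lemma group_QZ: "group QZ"
  by (intro DirProd_group group_add_group)

lemma QZ_simps: "carrier QZ = UNIV" "(a, b) \<otimes>\<^bsub>QZ\<^esub> (c, d) = (a + c, b + d)" "\<one>\<^bsub>QZ\<^esub> = (0, 0)"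
  by (auto simp: DirProd_def add_group_def)

lemma inv_QZ: "inv\<^bsub>QZ\<^esub> (a, b) = (- a, - b)"
  by (rule group.inv_equality[OF group_QZ]) (simp_all add: QZ_simps del: mult_DirProd one_DirProd carrier_DirProd)

text \<open>A group of values is carried over to \<open>\<rat> \<times> \<int>\<close> along an additive map \<open>f\<close> that is injective on \<open>S\<close>.\<close>

lemma iso_QZ:
  fixes f :: "rat \<times> int \<Rightarrow> 'h::group_add" and A :: "'h set"
  assumes f: "\<And>a b. f (a + b) = f a + f b" and S: "subgroup S QZ" and inj: "inj_on f S"
    and A: "A \<subseteq> f ` S" "0 \<in> A" "\<And>a b. a \<in> A \<Longrightarrow> b \<in> A \<Longrightarrow> a + b \<in> A" "\<And>a. a \<in> A \<Longrightarrow> - a \<in> A"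
  shows "\<exists>H. subgroup H QZ \<and> add_group A \<cong> QZ\<lparr>carrier := H\<rparr>"
proof -
  define H where "H = {p \<in> S. f p \<in> A}"
  have f0: "f 0 = 0" using f[of 0 0] add_left_cancel[of "f 0" "f 0" 0] by simp
  have fm: "f (- a) = - f a" for a
    using f[of a "- a"] f0 by (simp add: eq_neg_iff_add_eq_0 minus_unique)
  have Sp: "p + p' \<in> S" if "p \<in> S" "p' \<in> S" for p p'
    using subgroup.m_closed[OF S that] by (cases p; cases p') (simp add: QZ_simps del: mult_DirProd)
  have S0: "0 \<in> S" using subgroup.one_closed[OF S] by (simp add: QZ_simps zero_prod_def del: one_DirProd)
  have Sm: "- p \<in> S" if "p \<in> S" for p
    using subgroup.m_inv_closed[OF S that] by (cases p) (simp add: inv_QZ)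
  have H: "subgroup H QZ"
  proof (rule group.subgroupI[OF group_QZ])
    have "0 \<in> H" using S0 f0 A(2) by (simp add: H_def)
    then show "H \<noteq> {}" by blast
    show "inv\<^bsub>QZ\<^esub> p \<in> H" if "p \<in> H" for p
      using that Sm[of p] fm[of p] A(4) by (cases p) (auto simp: H_def inv_QZ)
    show "p \<otimes>\<^bsub>QZ\<^esub> p' \<in> H" if "p \<in> H" "p' \<in> H" for p p'
      using that Sp[of p p'] f[of p p'] A(3) by (cases p; cases p') (auto simp: H_def QZ_simps add_group_def)
  qed (simp add: QZ_simps del: carrier_DirProd)
  have "f \<in> iso (QZ\<lparr>carrier := H\<rparr>) (add_group A)"
  proof (rule isoI)
    show "f \<in> hom (QZ\<lparr>carrier := H\<rparr>) (add_group A)"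
    proof (rule homI)
      show "f p \<in> carrier (add_group A)" if "p \<in> carrier (QZ\<lparr>carrier := H\<rparr>)" for p
        using that by (simp add: H_def add_group_def)
      show "f (p \<otimes>\<^bsub>QZ\<lparr>carrier := H\<rparr>\<^esub> p') = f p \<otimes>\<^bsub>add_group A\<^esub> f p'" for p p'
        using f[of p p'] by (cases p; cases p') (simp add: QZ_simps add_group_def)
    qed
    show "bij_betw f (carrier (QZ\<lparr>carrier := H\<rparr>)) (carrier (add_group A))"
      unfolding bij_betw_def using A(1) inj by (auto simp: H_def add_group_def intro: inj_on_subset)
  qed
  then have "QZ\<lparr>carrier := H\<rparr> \<cong> add_group A" by (rule is_isoI)
  then have "add_group A \<cong> QZ\<lparr>carrier := H\<rparr>"
    by (rule group.iso_sym[OF subgroup.subgroup_is_group[OF H group_QZ]])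
  with H show ?thesis by blast
qed

lemma int_multiple_diff: "int_multiple (int a - int b) g = nmul a g - nmul b g"
proof (cases "a \<ge> b")
  case True
  then show ?thesis using nmul_add[of b "a - b" g] by (simp add: int_multiple_def nmul_def[symmetric] nat_diff_distrib')
next
  case False
  then have "nmul b g = nmul a g + nmul (b - a) g" using nmul_add[of a "b - a" g] by simp
  with False show ?thesis by (simp add: int_multiple_def nmul_def[symmetric] nat_diff_distrib')
qed

lemma int_multiple_add: "int_multiple (i + j) g = int_multiple i g + int_multiple j g"
proof -
  obtain a b where i: "i = int a - int b" by (metis int_diff_cases)
  obtain c d where j: "j = int c - int d" by (metis int_diff_cases)
  have "i + j = int (a + c) - int (b + d)" by (simp add: i j)
  then have "int_multiple (i + j) g = nmul (a + c) g - nmul (b + d) g" by (simp only: int_multiple_diff)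
  then show ?thesis unfolding i j int_multiple_diff nmul_add by (simp add: algebra_simps)
qed

section \<open>The Weyl algebra inside the image of the skew ring\<close>

lemma (in weyl_div) range_emb:
  assumes \<iota>: "quotient_division_ring \<iota>" "\<iota> weyl_x = x" "\<iota> weyl_y = y"
  shows "\<iota> a \<in> range emb"
proof -
  have add: "\<iota> (a + b) = \<iota> a + \<iota> b" and mult: "\<iota> (a * b) = \<iota> a * \<iota> b" and one: "\<iota> 1 = 1"
    and sc: "\<iota> (r *\<^sub>R a) = r *\<^sub>R \<iota> a" for a b r
    using \<iota>(1) by (auto simp: quotient_division_ring_def)
  have "\<iota> (abs_weyl t) \<in> range emb" for t
  proof (induction t)
    case (Scal r)
    have "weyl_eq (Times (Scal r) (Scal 1)) (Scal r)" using weyl_scal_mult[of r 1] by simp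
    then have "abs_weyl (Scal r) = r *\<^sub>R 1"
      by (simp add: scaleR_weyl.abs_eq one_weyl_def weyl.abs_eq_iff weyl_sym)
    then have "\<iota> (abs_weyl (Scal r)) = of_real r" by (simp add: sc one of_real_def)
    also have "\<dots> = emb (of_real r)" by (simp add: alg_hom_of_real[OF hom_emb])
    finally have "\<iota> (abs_weyl (Scal r)) = emb (of_real r)" .
    then show ?case by simp
  next
    case GenX
    have "\<iota> (abs_weyl GenX) = emb (rho 1)" using \<iota>(2) by (simp add: weyl_x_def emb_rho)
    then show ?case by simp
  next
    case GenY
    have "emb (rho (- 1) * En) = x powi (- 1) * (x * y)"
      by (simp add: alg_hom_mult[OF hom_emb] emb_rho emb_En)
    also have "\<dots> = y" using x_nz by (simp add: mult.assoc[symmetric])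
    finally have "\<iota> (abs_weyl GenY) = emb (rho (- 1) * En)" using \<iota>(3) by (simp add: weyl_y_def)
    then show ?case by simp
  next
    case (Plus a b)
    then obtain p r where "\<iota> (abs_weyl a) = emb p" "\<iota> (abs_weyl b) = emb r" by auto
    then have "\<iota> (abs_weyl (Plus a b)) = emb (p + r)"
      by (simp add: plus_weyl.abs_eq[symmetric] add alg_hom_add[OF hom_emb])
    then show ?case by simp
  next
    case (Times a b)
    then obtain p r where "\<iota> (abs_weyl a) = emb p" "\<iota> (abs_weyl b) = emb r" by auto
    then have "\<iota> (abs_weyl (Times a b)) = emb (p * r)"
      by (simp add: times_weyl.abs_eq[symmetric] mult alg_hom_mult[OF hom_emb])
    then show ?case by simp
  qed
  then show ?thesis by (rule weyl.abs_induct)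
qed

lemma (in weyl_div) frac_emb:
  assumes \<iota>: "quotient_division_ring \<iota>" "\<iota> weyl_x = x" "\<iota> weyl_y = y"
  shows "\<exists>a b. b \<noteq> 0 \<and> z = emb a * inverse (emb b)"
proof -
  have "\<forall>z. \<exists>a s. s \<noteq> 0 \<and> z = \<iota> a * inverse (\<iota> s)" using \<iota>(1) by (simp add: quotient_division_ring_def)
  then obtain a s where as: "s \<noteq> 0" "z = \<iota> a * inverse (\<iota> s)" by blast
  have "\<iota> 0 = 0" using \<iota>(1) unfolding quotient_division_ring_def by (metis add_cancel_right_right)
  moreover have "inj \<iota>" using \<iota>(1) by (simp add: quotient_division_ring_def)
  ultimately have "\<iota> s \<noteq> 0" using as(1) by (metis injD)
  moreover obtain p r where "\<iota> a = emb p" "\<iota> s = emb r" using range_emb[OF \<iota>] by blast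
  ultimately show ?thesis using as(2) by (intro exI[of _ p] exI[of _ r]) (auto simp: alg_hom_0[OF hom_emb])
qed

section \<open>The given data as a chain, and the three conclusions\<close>

locale weyl_chain =
  fixes \<iota> :: "weyl \<Rightarrow> 'd::real_div_algebra"
    and q :: "rat \<Rightarrow> 'g::linordered_ab_group_add"
    and I :: "int set"
    and \<omega> :: "int \<Rightarrow> 'd"
    and \<nu> :: "int \<Rightarrow> 'g"
    and m n :: "int \<Rightarrow> int"
    and \<beta> :: "int \<Rightarrow> real"
  assumes qdr: "quotient_division_ring \<iota>"
    and qemb: "ordered_group_embedding q"
    and I: "I = {-1..} \<or> (\<exists>N\<ge>0. I = {-1..N})"
    and \<omega>1: "\<omega> (-1) = \<iota> weyl_x" and \<omega>0: "\<omega> 0 = \<iota> weyl_y" and \<nu>1: "\<nu> (-1) = q (-1)"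
    and m0: "m 0 = 1" and n0: "n 0 = -1"
    and step: "\<forall>i. 0 \<le> i \<and> i \<in> I \<and> i + 1 \<in> I \<longrightarrow>
           n (i + 1) > 0 \<and> coprime (m (i + 1)) (n (i + 1)) \<and>
           \<nu> i = q (of_int (m (i + 1)) / of_int (n (i + 1))) \<and>
           \<beta> (i + 1) \<noteq> 0 \<and>
           \<omega> (i + 1) = \<iota> weyl_x powi m (i + 1) * \<omega> i powi n (i + 1) - of_real (\<beta> (i + 1)) \<and>
           \<nu> (i + 1) > 0"
    and irr: "\<forall>N\<ge>0. I = {-1..N} \<longrightarrow> \<nu> N \<notin> range q"
    and neg: "\<forall>k\<in>I. (\<Sum>i\<in>{-1..k}. \<nu> i) < 0"
begin

abbreviation "lv k \<equiv> int k \<in> I"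
abbreviation "nu k \<equiv> \<nu> (int k)"
abbreviation "mm k \<equiv> m (int k + 1)"
abbreviation "nn k \<equiv> nat (n (int k + 1))"
abbreviation "be k \<equiv> \<beta> (int k + 1)"
abbreviation "x \<equiv> \<iota> weyl_x"
abbreviation "y \<equiv> \<iota> weyl_y"

lemma q_add: "q (r + s) = q r + q s"
  using qemb by (simp add: ordered_group_embedding_def)

lemma q_uminus1: "q (- 1) = - q 1"
proof -
  have "q 0 = 0" using q_add[of 0 0] by simp
  then show ?thesis using q_add[of 1 "- 1"] by (simp add: eq_neg_iff_add_eq_0 add.commute)
qed

lemma lv_Suc: "lv (Suc k) \<Longrightarrow> lv k" and lv_0: "lv 0" and I_1: "-1 \<in> I" and I_iff: "i \<in> I \<longleftrightarrow> i = - 1 \<or> (i \<ge> 0 \<and> lv (nat i))"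
  using I by auto

lemma step':
  assumes "lv (Suc k)"
  shows "n (int k + 1) > 0" "coprime (mm k) (n (int k + 1))"
    "nu k = q (of_int (mm k) / of_int (n (int k + 1)))" "be k \<noteq> 0"
    "\<omega> (int k + 1) = x powi mm k * \<omega> (int k) powi n (int k + 1) - of_real (be k)"
    "nu (Suc k) > 0"
  using step[rule_format, of "int k"] assms lv_Suc[OF assms] by (simp_all add: add.commute)

sublocale chain q lv nu mm nn be
proof
  show "q (r + s) = q r + q s" for r s by (rule q_add)
  show "strict_mono q" using qemb by (simp add: ordered_group_embedding_def)
  show "lv 0" by (rule lv_0)
  show "lv (Suc k) \<Longrightarrow> lv k" for k by (rule lv_Suc)
  show "lv (Suc k) \<Longrightarrow> nn k > 0" for k using step'(1) by simp
  show "lv (Suc k) \<Longrightarrow> coprime (mm k) (int (nn k))" for k using step'(1,2)[of k] by simp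
  show "lv (Suc k) \<Longrightarrow> nu k = q (of_int (mm k) / of_nat (nn k))" for k using step'(1,3)[of k] by simp
  show "lv (Suc k) \<Longrightarrow> be k \<noteq> 0" for k by (rule step'(4))
  show "lv (Suc k) \<Longrightarrow> nu (Suc k) > 0" for k by (rule step'(6))
  show "(\<Sum>i\<le>k. nu i) < q 1" if k: "lv k" for k
  proof -
    have "{-1..int k} = insert (- 1) (int ` {..k})"
    proof (intro Set.set_eqI iffI)
      fix i assume "i \<in> {-1..int k}"
      then show "i \<in> insert (- 1) (int ` {..k})" by (cases "i = -1") (auto intro: image_eqI[of _ _ "nat i"])
    qed auto
    moreover have "sum \<nu> (insert (- 1) (int ` {..k})) = \<nu> (- 1) + (\<Sum>i\<le>k. nu i)"
      by (subst sum.insert) (auto simp: sum.reindex)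
    ultimately have "(\<Sum>i\<in>{-1..int k}. \<nu> i) = \<nu> (- 1) + (\<Sum>i\<le>k. nu i)" by simp
    with neg k have "q (- 1) + (\<Sum>i\<le>k. nu i) < 0" by (metis \<nu>1)
    then show ?thesis by (simp add: q_uminus1)
  qed
  show "nu k \<notin> range q" if "lv k" "\<not> lv (Suc k)" for k
  proof -
    from I that obtain N where N: "N \<ge> 0" "I = {-1..N}" by auto
    with that have "N = int k" by auto
    with N irr show ?thesis by blast
  qed
qed

sublocale weyl_div x y
proof
  have add: "\<iota> (a + b) = \<iota> a + \<iota> b" and mult: "\<iota> (a * b) = \<iota> a * \<iota> b" and one: "\<iota> 1 = 1" for a b
    using qdr by (auto simp: quotient_division_ring_def)
  have "weyl_y * weyl_x = weyl_x * weyl_y + 1" using weyl_commutation by (simp add: algebra_simps)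
  then have "y * x = x * y + 1" by (metis add mult one)
  then show "y * x - x * y = 1" by simp
qed

lemmas frac = frac_emb[OF qdr refl refl]

lemma emb_om: "lv k \<Longrightarrow> emb (om k) = \<omega> (int k)"
proof (induction k)
  case 0
  have "emb (om 0) = x powi (- 1) * (x * y)"
    by (simp add: alg_hom_mult[OF hom_emb] emb_rho emb_En)
  also have "\<dots> = y" using x_nz by (simp add: mult.assoc[symmetric])
  finally show ?case by (simp add: \<omega>0)
next
  case (Suc k)
  have "\<omega> (int k) powi n (int k + 1) = \<omega> (int k) ^ nn k"
    using step'(1)[OF Suc.prems] by (simp add: power_int_def)
  moreover have "\<omega> (int (Suc k)) = \<omega> (int k + 1)" by (simp add: add.commute)
  ultimately show ?case
    using Suc.IH[OF lv_Suc[OF Suc.prems]] step'(5)[OF Suc.prems]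
    by (simp only: om.simps(2) alg_hom_diff[OF hom_emb] alg_hom_mult[OF hom_emb] emb_rho
        alg_hom_power[OF hom_emb] alg_hom_of_real[OF hom_emb])
qed

lemma existence:
  assumes sg: "\<forall>i\<in>I. \<forall>j\<in>I. 1 \<le> i \<and> 1 \<le> j \<and> even (n i) \<and> even (n j) \<longrightarrow> sgn (\<beta> i) = sgn (\<beta> j)"
  shows "\<exists>v :: 'd \<Rightarrow> 'g with_infinity. extends_to_valuation id I \<omega> \<nu> v"
proof -
  have sgn: "sgn (be i) = sgn (be j)" if "lv (Suc i)" "lv (Suc j)" "even (nn i)" "even (nn j)" for i j
  proof -
    have "even (n (int i + 1))" "even (n (int j + 1))"
      using that step'(1)[OF that(1)] step'(1)[OF that(2)] by (simp_all add: even_nat_iff)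
    moreover have "int i + 1 \<in> I" "int j + 1 \<in> I" using that(1,2) by (simp_all add: add.commute)
    ultimately show ?thesis by (intro sg[rule_format] conjI) auto
  qed
  have "\<exists>Mf \<epsilon>f hf. (\<forall>k. lv k \<longrightarrow> Lev k (Mf k) (\<epsilon>f k) (hf k) \<and> inj0 (hf k)) \<and>
      (\<forall>k. lv (Suc k) \<longrightarrow> Nxt k (Mf k) (hf k) (Mf (Suc k)) (hf (Suc k)))"
    by (rule chain_ex) (rule sgn)
  then obtain Mf \<epsilon>f hf where
    L: "\<forall>k. lv k \<longrightarrow> Lev k (Mf k) (\<epsilon>f k) (hf k) \<and> inj0 (hf k)"
      "\<forall>k. lv (Suc k) \<longrightarrow> Nxt k (Mf k) (hf k) (Mf (Suc k)) (hf (Suc k))" by (elim exE conjE)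
  interpret L: levels_div q lv nu mm nn be Mf \<epsilon>f hf x y
  proof
    show "lv k \<Longrightarrow> Lev k (Mf k) (\<epsilon>f k) (hf k)" "lv k \<Longrightarrow> inj0 (hf k)" for k using L(1) by simp_all
    show "lv (Suc k) \<Longrightarrow> Nxt k (Mf k) (hf k) (Mf (Suc k)) (hf (Suc k))" for k using L(2) by simp
    show "\<exists>a b. b \<noteq> 0 \<and> z = emb a * inverse (emb b)" for z by (rule frac)
  qed
  interpret val L.vD by (rule L.val_vD)
  have "L.vD (\<omega> i) = Fin (\<nu> i)" if "i \<in> I" for i
  proof (cases "i = - 1")
    case True
    then show ?thesis using L.vD_x by (simp add: \<omega>1 \<nu>1)
  next
    case False
    with that have i: "i \<ge> 0" "lv (nat i)" using I_iff[of i] by blast+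
    from L.vD_om[OF i(2)] emb_om[OF i(2)] i(1) show ?thesis by simp
  qed
  then have "extends_to_valuation id I \<omega> \<nu> L.vD"
    unfolding extends_to_valuation_def using val triv residue_field_is_realI[OF L.vD_res] by simp
  then show ?thesis by blast
qed

end

locale weyl_chain_ext = weyl_chain +
  fixes e :: "'b \<Rightarrow> 'h::linordered_group_add"
  assumes eemb: "ordered_group_embedding e"
begin

sublocale chain_div q lv nu mm nn be x y e
  by unfold_locales (use eemb in \<open>auto simp: ordered_group_embedding_def\<close>)

lemma good_ext: "extends_to_valuation e I \<omega> \<nu> v \<Longrightarrow> good v"
proof -
  assume v: "extends_to_valuation e I \<omega> \<nu> v"
  then interpret val v by unfold_locales (simp_all add: extends_to_valuation_def)
  have \<omega>: "v (\<omega> i) = Fin (e (\<nu> i))" if "i \<in> I" for i using v that by (simp add: extends_to_valuation_def)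
  have "residue_field_is_real v" using v by (simp add: extends_to_valuation_def)
  then have "\<forall>a. Fin 0 \<le> v a \<longrightarrow> (\<exists>r. Fin 0 < v (a - of_real r))" using residue_field_is_realD by blast
  moreover have "v x = Fin (e (q (- 1)))" using \<omega>[OF I_1] by (simp add: \<omega>1 \<nu>1)
  moreover have "v (emb (om i)) = Fin (e (nu i))" if "lv i" for i using \<omega>[OF that] emb_om[OF that] by simp
  ultimately show "good v" using val_axioms by (simp add: good_def)
qed

lemma lt_\<omega>: "lv k \<Longrightarrow> t \<le> k \<Longrightarrow> lt t = \<omega> (int t - 1) \<and> mt t = m (int t) \<and> nt t = n (int t)"
proof (cases t)
  case 0
  then show ?thesis by (simp add: lt_def mt_def nt_def \<omega>1 m0 n0)
next
  case (Suc i)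
  assume "lv k" "t \<le> k"
  with Suc have i: "lv (Suc i)" using lv_le by blast
  have t: "int t = int i + 1" using Suc by simp
  show ?thesis using emb_om[OF lv_Suc[OF i]] step'(1)[OF i]
    unfolding t by (simp add: Suc lt_def mt_def nt_def)
qed

text \<open>The exponents are such that the product \<open>P\<close> of powers has value 0, so its
  residue is nonzero. Multiplying by the power of \<open>lt t\<close> turns equality of residues
  into nearness, the form in which \<open>agree\<close> uses it.\<close>

lemma residues_near:
  assumes ext: "extends_to_valuation e I \<omega> \<nu> v" and res: "has_residues q I \<omega> \<nu> m n \<alpha> v"
    and k: "lv (Suc k)" and s: "s \<le> Suc k" and t: "t \<le> Suc k" and st: "s \<noteq> t" and od: "odd (mt t)"
  shows "\<alpha> (int s) (int t) \<noteq> 0 \<and> val.near v (lt s powi ((mt t * nt s) div gcd (mt t * nt s) (mt s * nt t)))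
    (\<alpha> (int s) (int t) *\<^sub>R lt t powi ((mt s * nt t) div gcd (mt t * nt s) (mt s * nt t)))"
proof -
  have v: "good v" by (rule good_ext[OF ext])
  interpret val v by (rule good_val[OF v])
  define d where "d = gcd (mt t * nt s) (mt s * nt t)"
  define A where "A = (mt t * nt s) div d"
  define B where "B = (mt s * nt t) div d"
  define P where "P = lt s powi A * lt t powi (- B)"
  define c where "c = \<alpha> (int s) (int t)"
  have idx: "int u - 1 \<in> I \<and> \<nu> (int u - 1) \<in> range q" if u: "u \<le> Suc k" for u
  proof (cases u)
    case 0
    then show ?thesis using I_1 \<nu>1 by auto
  next
    case (Suc i)
    then have "lv (Suc i)" using lv_le[OF k] u by blast
    then show ?thesis using Suc lv_Suc[of i] step'(3)[of i] by auto
  qed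
  have nz: "nt u \<noteq> 0" if u: "u \<le> Suc k" for u
  proof (cases u)
    case (Suc i)
    then show ?thesis using step'(1)[of i] lv_le[OF k u] by (simp add: nt_def)
  qed (simp add: nt_def)
  \<comment> \<open>An odd \<open>mt t\<close> is nonzero, so the gcd cannot degenerate even if
    \<open>mt s = 0\<close>.\<close>
  have d: "d \<noteq> 0" using od nz[OF s] by (auto simp: d_def)
  have "residue v (of_real c) = residue v P"
    using res[unfolded has_residues_def Let_def, rule_format, of "int s" "int t"] idx[OF s] idx[OF t] st
      lt_\<omega>[OF k s] lt_\<omega>[OF k t] by (simp add: c_def P_def A_def B_def d_def)
  then have cP: "Fin 0 < v (P - of_real c)" by (simp add: residue_eq_iff v_minus_commute)
  have vP: "v P = Fin 0"
  proof -
    have "of_int A * of_int d = (of_int (mt t * nt s) :: rat)" "of_int B * of_int d = (of_int (mt s * nt t) :: rat)"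
      by (simp_all only: of_int_mult[symmetric]) (simp_all add: A_def B_def d_def)
    then have AB: "of_int A = (of_int (mt t) * of_int (nt s) / of_int d :: rat)" "of_int B = (of_int (mt s) * of_int (nt t) / of_int d :: rat)"
      using d by (simp_all add: field_simps)
    have "of_int A * (of_int (mt s) / of_int (nt s)) + of_int (- B) * (of_int (mt t) / of_int (nt t)) = (0 :: rat)"
      using nz[OF s] nz[OF t] d unfolding of_int_minus AB by (simp add: field_simps)
    then have "q (of_int A * (of_int (mt s) / of_int (nt s))) + q (of_int (- B) * (of_int (mt t) / of_int (nt t))) = 0"
      unfolding q_add[symmetric] by simp
    then show ?thesis
      unfolding P_def v_mult v_powi_q[OF v v_lt[OF v k s]] v_powi_q[OF v v_lt[OF v k t]]
      by (simp flip: e_add)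
  qed
  have c: "c \<noteq> 0" using cP vP by auto
  have "near P (of_real c)" using cP vP by (simp add: near_def)
  moreover have ltnz: "lt t \<noteq> 0" using v_lt[OF v k t] v_Inf by force
  ultimately have "near (P * lt t powi B) (of_real c * lt t powi B)"
    by (intro near_mult near_refl) (simp_all add: power_int_not_zero)
  moreover have "P * lt t powi B = lt s powi A"
    using ltnz by (simp add: P_def mult.assoc power_int_minus power_int_not_zero)
  ultimately have "near (lt s powi A) (c *\<^sub>R lt t powi B)" by (simp add: scaleR_conv_of_real)
  with c show ?thesis by (simp add: c_def A_def B_def d_def)
qed

lemma uniqueness:
  assumes v: "extends_to_valuation e I \<omega> \<nu> v1" "has_residues q I \<omega> \<nu> m n \<alpha> v1"
    "extends_to_valuation e I \<omega> \<nu> v2" "has_residues q I \<omega> \<nu> m n \<alpha> v2"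
  shows "v1 = v2"
proof -
  note g = good_ext[OF v(1)] good_ext[OF v(3)]
  interpret v1: val v1 by (rule good_val[OF g(1)])
  interpret v2: val v2 by (rule good_val[OF g(2)])
  have al: "\<exists>\<alpha>. \<alpha> \<noteq> 0 \<and> (\<forall>v\<in>{v1, v2}.
      val.near v (lt s powi ((mt t * nt s) div gcd (mt t * nt s) (mt s * nt t)))
        (\<alpha> *\<^sub>R lt t powi ((mt s * nt t) div gcd (mt t * nt s) (mt s * nt t))))"
    if "lv (Suc k)" "s \<le> Suc k" "t \<le> Suc k" "s \<noteq> t" "odd (mt t)" for k s t
    using residues_near[OF v(1,2) that] residues_near[OF v(3,4) that] by blast
  have emb: "v1 (emb z) = v2 (emb z)" if z: "z \<noteq> 0" for z
    by (rule conjunct1[OF uniq_val[OF g _ z]]) (rule agree[OF g _ _ _ _ _ al])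
  show ?thesis
  proof
    fix a
    obtain b c where bc: "c \<noteq> 0" "a = emb b * inverse (emb c)" using frac by blast
    show "v1 a = v2 a"
    proof (cases "b = 0")
      case True
      then show ?thesis using bc by (simp add: alg_hom_0[OF hom_emb])
    next
      case False
      obtain h where h: "v1 (emb c) = Fin h" using v1.v_nz[OF emb_nonzero[OF bc(1)]] by blast
      then have "v2 (emb c) = Fin h" using emb[OF bc(1)] by simp
      with h show ?thesis using emb[OF False] v1.v_inverse v2.v_inverse bc by (simp add: v1.v_mult v2.v_mult)
    qed
  qed
qed

text \<open>\<open>uniq_val\<close> for the pair \<open>(v, v)\<close>, where agreement is trivial,
  gives every nonzero element of the ring the value of a word, and such values are sums of
  generators.\<close>

lemma value_group_eq:
  assumes ext: "extends_to_valuation e I \<omega> \<nu> v"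
  shows "carrier (value_group v) = generate (add_group UNIV) ((\<lambda>i. e (\<nu> i)) ` I)" (is "_ = ?G")
proof
  have g: "good v" by (rule good_ext[OF ext])
  interpret val v by (rule good_val[OF g])
  show "?G \<subseteq> carrier (value_group v)"
    by (rule generate_subset_value_group) (use ext in \<open>auto simp: extends_to_valuation_def\<close>)
  have word: "\<exists>\<gamma>\<in>?G. v (emb w) = Fin \<gamma>" if k: "lv k" and w: "w \<in> Wd (Suc k)" for k w
    using w
  proof (induction rule: Wd.induct)
    case (Wd_rho s)
    have 1: "e (q (- 1)) \<in> ?G" unfolding \<nu>1[symmetric] by (intro generate_add_group(2) imageI I_1)
    have p: "e (q (- of_nat i)) \<in> ?G" for i
    proof (induction i)
      case (Suc i)
      have "q (- of_nat (Suc i)) = q (- 1) + q (- of_nat i)" by (simp flip: q_add)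
      then show ?case using generate_add_group(3)[OF 1 Suc] by (simp add: e_add)
    qed (use generate_add_group(1) in simp)
    have "e (q (- of_int s)) \<in> ?G"
    proof (cases "s \<ge> 0")
      case True
      then show ?thesis using p[of "nat s"] by simp
    next
      case False
      have "e (q (- of_int s)) = - e (q (- of_nat (nat (- s))))"
        using False by (simp flip: q_minus e_minus)
      then show ?thesis using generate_add_group(4)[OF p[of "nat (- s)"]] by simp
    qed
    then show ?case using v_rho[OF g, of s] by (auto simp: emb_rho)
  next
    case (Wd_om i)
    then have "lv i" using lv_le[OF k, of i] by simp
    then show ?case using good_om[OF g, of i] by (intro bexI[of _ "e (nu i)"] generate_add_group(2)) auto
  next
    case (Wd_times w w')
    then obtain \<gamma> \<gamma>' where "\<gamma> \<in> ?G" "v (emb w) = Fin \<gamma>" "\<gamma>' \<in> ?G" "v (emb w') = Fin \<gamma>'" by blast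
    then show ?case
      by (intro bexI[of _ "\<gamma> + \<gamma>'"] generate_add_group(3)) (simp_all add: alg_hom_mult[OF hom_emb] v_mult)
  qed
  have val: "\<exists>\<gamma>\<in>?G. v (emb z) = Fin \<gamma>" if z: "z \<noteq> 0" for z
  proof -
    have "\<exists>k w. lv k \<and> w \<in> Wd (Suc k) \<and> v (emb z) = v (emb w)"
      by (rule conjunct2[OF uniq_val[OF g g _ z]])
    then show ?thesis using word by metis
  qed
  show "carrier (value_group v) \<subseteq> ?G"
  proof
    fix \<gamma> assume "\<gamma> \<in> carrier (value_group v)"
    then obtain a where a: "v a = Fin \<gamma>" by (auto simp: carrier_value_group)
    obtain b c where bc: "c \<noteq> 0" "a = emb b * inverse (emb c)" using frac by blast
    have "b \<noteq> 0" using a bc by (auto simp: alg_hom_0[OF hom_emb])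
    then obtain g1 g2 where g12: "g1 \<in> ?G" "v (emb b) = Fin g1" "g2 \<in> ?G" "v (emb c) = Fin g2"
      using val bc(1) by blast
    then have "\<gamma> = g1 + - g2" using a bc v_inverse[of "emb c" g2] by (simp add: v_mult)
    then show "\<gamma> \<in> ?G" using generate_add_group(3)[OF g12(1) generate_add_group(4)[OF g12(3)]] by (simp only:)
  qed
qed

lemma value_group_iso:
  assumes ext: "extends_to_valuation e I \<omega> \<nu> v"
  shows "\<exists>H. subgroup H QZ \<and> value_group v \<cong> QZ\<lparr>carrier := H\<rparr>"
proof -
  define G where "G = generate (add_group UNIV) ((\<lambda>i. e (\<nu> i)) ` I)"
  define fin where "fin \<longleftrightarrow> (\<exists>N\<ge>0. I = {-1..N})"
  \<comment> \<open>In the finite case the last value is the only irrational generator and spans the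
    factor \<open>\<int>\<close>. In the infinite case all values are rational; there
    \<open>t = 0\<close>, and \<open>S\<close> keeps only the second coordinate 0 so that
    \<open>f\<close> is injective.\<close>
  define t where "t = (if fin then \<nu> (Max I) else 0)"
  define f where "f = (\<lambda>(r, j). e (q r + int_multiple j t))"
  define S where "S = {p :: rat \<times> int. fin \<or> snd p = 0}"
  have tN: "t = \<nu> N" if "N \<ge> 0" "I = {-1..N}" for N
  proof -
    have "Max I = N" using that by (intro Max_eqI) auto
    moreover have fin using that by (auto simp: fin_def)
    ultimately show ?thesis by (simp add: t_def)
  qed
  have f: "f (a + b) = f a + f b" for a b
    by (cases a; cases b) (simp add: f_def q_add int_multiple_add add.assoc add.left_commute flip: e_add)
  have S: "subgroup S QZ"
  proof (rule group.subgroupI[OF group_QZ])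
    show "inv\<^bsub>QZ\<^esub> p \<in> S" if "p \<in> S" for p
      using that by (cases p) (auto simp: S_def inv_QZ)
  qed (auto simp: QZ_simps S_def add_group_def)
  have Sm: "a - b \<in> S" if "a \<in> S" "b \<in> S" for a b using that by (auto simp: S_def)
  have f0: "p = 0" if p: "p \<in> S" "f p = 0" for p
  proof -
    obtain r j where rj: "p = (r, j)" by (cases p)
    have eq: "q r + int_multiple j t = 0" using p e_eq[of _ 0] by (simp add: f_def rj)
    \<comment> \<open>Clearing the denominator of \<open>r\<close> gives an integral relation
      between \<open>t\<close> and \<open>q (- 1)\<close>, which rational independence
      excludes.\<close>
    have j: "j = 0"
    proof (cases fin)
      case True
      then obtain N where N: "N \<ge> 0" "I = {-1..N}" by (auto simp: fin_def)
      then have t: "t = \<nu> N" by (rule tN)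
      obtain b c where bc: "quotient_of r = (b, c)" by fastforce
      then have c: "c > 0" and r: "r = of_int b / of_int c"
        by (auto simp: quotient_of_denom_pos quotient_of_div)
      have im: "int_multiple i (int_multiple j g) = int_multiple (i * j) g" for i j :: int and g :: 'b
      proof -
        have *: "int_multiple (int a) (int_multiple j g) = int_multiple (int a * j) g" for a
        proof (induction a)
          case (Suc a)
          then show ?case using int_multiple_add[of "int a" 1 "int_multiple j g"] int_multiple_add[of "int a * j" j g]
            by (simp add: algebra_simps int_multiple_def[of 1])
        qed (simp add: int_multiple_def)
        show ?thesis
        proof (cases "i \<ge> 0")
          case True
          then show ?thesis using *[of "nat i"] by simp
        next
          case False
          then show ?thesis using *[of "nat (- i)"] int_multiple_minus[of "- i" "int_multiple j g"] int_multiple_minus[of "- (i * j)" g]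
            by simp
        qed
      qed
      have iq: "int_multiple i (q z) = q (of_int i * z)" for i z
        by (auto simp: int_multiple_def nmul_def[symmetric] q_nmul simp flip: q_minus)
      have "int_multiple j t = q (- r)" using eq by (simp add: q_minus eq_neg_iff_add_eq_0 add.commute)
      then have "int_multiple (c * j) t = q (of_int c * (- r))" using im[of c j t] iq[of c "- r"] by simp
      also have "of_int c * (- r) = - of_int b" using c r by simp
      finally have *: "int_multiple (c * j) t + int_multiple (- b) (q (- 1)) = 0"
        by (simp add: iq flip: q_add)
      have "t \<notin> range q" unfolding t by (rule irr[rule_format, OF N])
      then have "\<forall>a b. int_multiple a t + int_multiple b (q (- 1)) = 0 \<longrightarrow> a = 0 \<and> b = 0"
        by (rule iffD1[OF not_rational_iff_rationally_independent[OF qemb]])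
      from this[rule_format, OF *] have "c * j = 0" by simp
      with c show ?thesis by simp
    qed (use p in \<open>auto simp: S_def rj\<close>)
    then have "q r = q 0" using eq by (simp add: int_multiple_def)
    then have "r = 0" by (simp only: q_eq_iff)
    then show ?thesis using j by (simp add: rj zero_prod_def)
  qed
  have inj: "inj_on f S"
  proof (rule inj_onI)
    fix a b assume ab: "a \<in> S" "b \<in> S" "f a = f b"
    have "f a = f (a - b) + f b" using f[of "a - b" b] by simp
    then have "f (a - b) = 0" using ab(3) add_right_cancel[of "f (a - b)" "f b" 0] by simp
    with f0[OF Sm[OF ab(1,2)]] show "a = b" by simp
  qed
  have fz: "f 0 = 0" by (simp add: f_def zero_prod_def int_multiple_def)
  have fm: "f (- a) = - f a" for a
    using f[of a "- a"] fz by (simp add: eq_neg_iff_add_eq_0 minus_unique)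
  have GS: "G \<subseteq> f ` S"
  proof
    fix \<gamma> assume "\<gamma> \<in> G"
    then show "\<gamma> \<in> f ` S"
      unfolding G_def
    proof (induction rule: generate_add_group_induct)
      case zero
      have "f 0 \<in> f ` S" by (rule imageI) (simp add: S_def)
      then show ?case by (simp add: fz)
    next
      case (incl a)
      then obtain i where i: "i \<in> I" "a = e (\<nu> i)" by blast
      show ?case
      proof (cases "\<nu> i \<in> range q")
        case True
        then obtain r where "\<nu> i = q r" by blast
        then have "a = f (r, 0)" using i by (simp add: f_def int_multiple_def)
        then show ?thesis by (auto simp: S_def)
      next
        case False
        have i0: "i \<ge> 0" "lv (nat i)" using False i(1) I_iff[of i] \<nu>1 by (metis rangeI)+
        have "\<not> lv (Suc (nat i))" using False step'(3)[of "nat i"] i0 by auto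
        with I i0 obtain N where N: "N \<ge> 0" "I = {-1..N}" by auto
        with i0 \<open>\<not> lv (Suc (nat i))\<close> have "N = i" by auto
        then have "t = \<nu> i" using tN[OF N] by simp
        then have "a = f (0, 1)" using i(2) by (simp add: f_def int_multiple_def)
        moreover have "(0, 1) \<in> S" using N by (auto simp: S_def fin_def)
        ultimately show ?thesis by blast
      qed
    next
      case (minus a)
      then obtain p where "p \<in> S" "a = f p" by blast
      then show ?case using fm[of p] by (intro image_eqI[of _ _ "- p"]) (auto simp: S_def)
    next
      case (plus a b)
      then obtain p p' where "p \<in> S" "a = f p" "p' \<in> S" "b = f p'" by blast
      then show ?case using f[of p p'] by (intro image_eqI[of _ _ "p + p'"]) (auto simp: S_def)
    qed
  qed
  have "\<exists>H. subgroup H QZ \<and> add_group G \<cong> QZ\<lparr>carrier := H\<rparr>"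
    by (rule iso_QZ[OF f S inj GS]) (auto simp: G_def intro: generate_add_group)
  moreover have "value_group v = add_group G"
    using value_group_eq[OF ext] by (simp add: value_group_def add_group_def G_def)
  ultimately show ?thesis by simp
qed

end

theorem theorem3p8:
  fixes \<iota> :: "weyl \<Rightarrow> 'd::real_div_algebra"
    and q :: "rat \<Rightarrow> 'g::linordered_ab_group_add"
    and e :: "'g \<Rightarrow> 'h::linordered_group_add"
    and I :: "int set"
    and \<omega> :: "int \<Rightarrow> 'd"
    and \<nu> :: "int \<Rightarrow> 'g"
    and m n :: "int \<Rightarrow> int"
    and \<beta> :: "int \<Rightarrow> real"
  assumes "quotient_division_ring \<iota>"
    and "ordered_group_embedding q"
    and "ordered_group_embedding e"
    and "I = {-1..} \<or> (\<exists>N\<ge>0. I = {-1..N})"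
    and "\<omega> (-1) = \<iota> weyl_x" and "\<omega> 0 = \<iota> weyl_y" and "\<nu> (-1) = q (-1)"
    and "m 0 = 1" and "n 0 = -1"
    and "\<forall>i. 0 \<le> i \<and> i \<in> I \<and> i + 1 \<in> I \<longrightarrow>
           n (i + 1) > 0 \<and> coprime (m (i + 1)) (n (i + 1)) \<and>
           \<nu> i = q (of_int (m (i + 1)) / of_int (n (i + 1))) \<and>
           \<beta> (i + 1) \<noteq> 0 \<and>
           \<omega> (i + 1) = \<iota> weyl_x powi m (i + 1) * \<omega> i powi n (i + 1) - of_real (\<beta> (i + 1)) \<and>
           \<nu> (i + 1) > 0"
    and "\<forall>N\<ge>0. I = {-1..N} \<longrightarrow> \<nu> N \<notin> range q"
    and "\<forall>k\<in>I. (\<Sum>i\<in>{-1..k}. \<nu> i) < 0"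
    and "\<forall>i\<in>I. \<forall>j\<in>I. 1 \<le> i \<and> 1 \<le> j \<and> even (n i) \<and> even (n j) \<longrightarrow> sgn (\<beta> i) = sgn (\<beta> j)"
  shows "(\<exists>v :: 'd \<Rightarrow> 'g with_infinity. extends_to_valuation id I \<omega> \<nu> v) \<and>
    (\<forall>\<alpha> :: int \<Rightarrow> int \<Rightarrow> real. \<exists>\<^sub>\<le>\<^sub>1 v :: 'd \<Rightarrow> 'h with_infinity.
        extends_to_valuation e I \<omega> \<nu> v \<and> has_residues q I \<omega> \<nu> m n \<alpha> v) \<and>
    (\<forall>v :: 'd \<Rightarrow> 'h with_infinity. extends_to_valuation e I \<omega> \<nu> v \<longrightarrow>
        carrier (value_group v) = generate (add_group UNIV) ((\<lambda>i. e (\<nu> i)) ` I) \<and>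
        (\<exists>H. subgroup H (add_group (UNIV :: rat set) \<times>\<times> add_group (UNIV :: int set)) \<and>
             value_group v \<cong>
               (add_group (UNIV :: rat set) \<times>\<times> add_group (UNIV :: int set))\<lparr>carrier := H\<rparr>))"
proof -
  interpret M: weyl_chain \<iota> q I \<omega> \<nu> m n \<beta>
    by unfold_locales (fact assms)+
  interpret E: weyl_chain_ext \<iota> q I \<omega> \<nu> m n \<beta> e
    by unfold_locales (fact assms(3))
  show ?thesis
  proof (intro conjI allI impI)
    show "\<exists>v :: 'd \<Rightarrow> 'g with_infinity. extends_to_valuation id I \<omega> \<nu> v"
      by (rule M.existence) (fact assms)
    show "\<exists>\<^sub>\<le>\<^sub>1 v :: 'd \<Rightarrow> 'h with_infinity. extends_to_valuation e I \<omega> \<nu> v \<and> has_residues q I \<omega> \<nu> m n \<alpha> v" for \<alpha>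
      using E.uniqueness by (auto simp: Uniq_def)
    fix v :: "'d \<Rightarrow> 'h with_infinity"
    assume v: "extends_to_valuation e I \<omega> \<nu> v"
    show "carrier (value_group v) = generate (add_group UNIV) ((\<lambda>i. e (\<nu> i)) ` I)"
      by (rule E.value_group_eq[OF v])
    show "\<exists>H. subgroup H (add_group (UNIV :: rat set) \<times>\<times> add_group (UNIV :: int set)) \<and>
        value_group v \<cong> (add_group (UNIV :: rat set) \<times>\<times> add_group (UNIV :: int set))\<lparr>carrier := H\<rparr>"
      by (rule E.value_group_iso[OF v])
  qed
qed

end
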